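(* For all integers $n\ge1$, $$\overline{spt1}(n)\equiv\left(\frac{n}{3}\right)\overline{\alpha}(n)\pmod 3,$$ where $\left(\frac{n}{3}\right)$ is the Legendre symbol.
   Context: An overpartition of $n$ is a partition of $n$ in which the first occurrence of each distinct part may be overlined. $\overline{spt1}(n)$ is the sum, over all overpartitions $\lambda$ of $n$ whose smallest part is odd, of the number of occurrences of the smallest part of $\lambda$. The (Dyson) rank of an overpartition is its largest part minus its number of parts, and $\overline{\alpha}(n)$ is the number of overpartitions of $n$ with even rank minus the number with odd rank. *)

theory Defs
  imports "HOL-Library.Multiset" "HOL-Number_Theory.Number_Theory"
begin

text \<open>An overpartition of n: a multiset M of positive parts summing to n together with
  the set S of distinct part sizes whose first occurrence is overlined (S is a subset of
  the distinct parts of M).\<close>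
definition overpartitions :: "nat \<Rightarrow> (nat multiset \<times> nat set) set" where
  "overpartitions n = {(M, S). (\<forall>x \<in># M. 0 < x) \<and> sum_mset M = n \<and> S \<subseteq> set_mset M}"

definition smallest_part :: "nat multiset \<Rightarrow> nat" where
  "smallest_part M = Min (set_mset M)"

definition largest_part :: "nat multiset \<Rightarrow> nat" where
  "largest_part M = Max (set_mset M)"

definition ovrank :: "nat multiset \<times> nat set \<Rightarrow> int" where
  "ovrank p = int (largest_part (fst p)) - int (size (fst p))"

definition spt1bar :: "nat \<Rightarrow> int" where
  "spt1bar n = (\<Sum>p \<in> {p \<in> overpartitions n. odd (smallest_part (fst p))}.
                  int (count (fst p) (smallest_part (fst p))))"

definition alphabar :: "nat \<Rightarrow> int" where
  "alphabar n = int (card {p \<in> overpartitions n. even (ovrank p)})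
              - int (card {p \<in> overpartitions n. odd (ovrank p)})"

end

theory Submission
  imports Defs "HOL-Computational_Algebra.Formal_Laurent_Series"
begin

text \<open>
  Write \<open>F\<close> and \<open>S\<close> for the generating functions of \<open>alphabar\<close> and \<open>spt1bar\<close>, \<open>D = q d/dq\<close> and
  \<open>\<theta> = \<Sum>\<^sub>j (-1)\<^sup>j q^(j\<^sup>2)\<close>. Since the Legendre symbol \<open>(n/3)\<close> is congruent to \<open>n\<close>, the claim is
  \<open>D F \<equiv> S (mod 3)\<close>.

  With \<open>b\<^sub>m = \<Prod>\<^sub>i\<^sub>\<le>\<^sub>m (1 - q^i)/(1 + q^i)\<close>, which tends to \<open>\<theta>\<close>, both series are sums over the \<open>b\<^sub>m\<close>:
  sorting by the largest part gives \<open>F = 1 - \<Sum> (-1)\<^sup>m (b\<^sub>m\<^sub>-\<^sub>1 - b\<^sub>m)\<close>, and sorting by the smallest part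
  gives \<open>\<theta> S = \<Sum> 2 q^m b\<^sub>m / (1 - q^m)\<^sup>2\<close> over odd \<open>m\<close>. Expanding \<open>b\<^sub>m\<close> in central
  \<open>q\<close>-binomial coefficients (a Bailey pair), for which the relevant sums telescope, turns
  \<open>\<theta> F\<close> and \<open>\<theta> S\<close> into explicit sums over divisors.

  Finally \<open>\<theta>\<^sup>2 D F = \<theta> D(\<theta> F) - (\<theta> F) D \<theta>\<close>, and an elementary identity of Liouville type for the
  form \<open>j\<^sup>2 + d e\<close> shows that this is \<open>\<theta>\<close> times an explicit divisor sum with cubic weights; modulo 3
  the cubes disappear and \<open>\<theta> S\<close> remains. As \<open>\<theta>\<close> is invertible, \<open>D F \<equiv> S\<close>.
\<close>

section \<open>Finite identities for central q-binomial coefficients\<close>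

text \<open>The \<open>b_m\<close> tend to \<open>theta\<close>, which is not 0, so the alternating
  sum of the \<open>b_m\<close> themselves diverges and only the differences
  \<open>b_(m-1) - b_m\<close> can be summed. Oddness of \<open>m\<close> does not fit the
  telescoping: it is imposed by subtracting the even \<open>m\<close> from all \<open>m\<close>, and
  the even ones need a second expansion, of \<open>b_(2m)\<close> in base \<open>q^2\<close>. This
  subtraction is the origin of \<open>halve\<close>; modulo 3 halving is multiplication by -1, and
  so the spt side acquires the signs of the rank side. The finite identities divide by
  \<open>1 - q^i\<close> and \<open>1 + q^i\<close>, so they are proved in a field, the Laurent
  series, and brought back to power series. Every limit is replaced by a congruence modulo
  \<open>q^(n+1)\<close> between truncations depending on \<open>n\<close>. The bracket of
  \<open>theta\<close> and \<open>theta F\<close> is useful because its coefficients weigh the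
  solutions of \<open>j^2 + d e = n\<close> by the polynomial \<open>d e - j^2\<close>, which a
  shear preserving the quadratic form can handle.\<close>

definition qfact :: "'a::comm_ring_1 \<Rightarrow> nat \<Rightarrow> 'a" where
  "qfact q n = (\<Prod>i=1..n. 1 - q ^ i)"

definition qratio :: "'a::{comm_ring_1,inverse} \<Rightarrow> nat \<Rightarrow> 'a" where
  "qratio q n = (\<Prod>i=1..n. (1 - q ^ i) * inverse (1 + q ^ i))"

text \<open>The Gaussian binomial of \<open>2n\<close> over \<open>n - j\<close> divided by the one
  of \<open>2n\<close> over \<open>n\<close>. With this normalisation the value at
  \<open>j = 0\<close> is 1, and so is the limit for large \<open>n\<close>.\<close>

definition qcentral :: "'a::{comm_ring_1,inverse} \<Rightarrow> nat \<Rightarrow> nat \<Rightarrow> 'a" where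
  "qcentral q n j =
     (if j \<le> n then (qfact q n)\<^sup>2 * inverse (qfact q (n - j)) * inverse (qfact q (n + j)) else 0)"

text \<open>The closed form of the sum of \<open>k * q^(n k)\<close> over \<open>k\<close>, which
  counts a part \<open>n\<close> by its multiplicity; \<open>wplus\<close> is the version with
  alternating signs.\<close>

definition wminus :: "'a::{comm_ring_1,inverse} \<Rightarrow> nat \<Rightarrow> 'a" where
  "wminus q n = q ^ n * inverse ((1 - q ^ n)\<^sup>2)"

definition wplus :: "'a::{comm_ring_1,inverse} \<Rightarrow> nat \<Rightarrow> 'a" where
  "wplus q n = q ^ n * inverse ((1 + q ^ n)\<^sup>2)"

lemma qfact_0 [simp]: "qfact q 0 = 1"
  and qfact_Suc: "qfact q (Suc n) = qfact q n * (1 - q ^ Suc n)"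
  by (simp_all add: qfact_def)

lemma qratio_0 [simp]: "qratio q 0 = 1"
  and qratio_Suc: "qratio q (Suc n) = qratio q n * ((1 - q ^ Suc n) * inverse (1 + q ^ Suc n))"
  by (simp_all add: qratio_def)

text \<open>An abstract field element, because the identities are needed for the variable and also
  for its square. The assumptions keep every denominator nonzero.\<close>

locale generic_q =
  fixes q :: "'a::field"
  assumes q_nonzero: "q \<noteq> 0"
    and power_neq_1: "0 < i \<Longrightarrow> q ^ i \<noteq> 1"
    and power_neq_minus_1: "0 < i \<Longrightarrow> q ^ i \<noteq> -1"
begin

lemma one_minus_nonzero: "0 < i \<Longrightarrow> 1 - q ^ i \<noteq> 0"
  using power_neq_1[of i] by auto

lemma one_plus_nonzero: "0 < i \<Longrightarrow> 1 + q ^ i \<noteq> 0"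
  using power_neq_minus_1[of i] by (metis add.commute eq_neg_iff_add_eq_0)

lemma qfact_nonzero: "qfact q n \<noteq> 0"
  using one_minus_nonzero by (simp add: qfact_def)

lemma qratio_nonzero: "qratio q n \<noteq> 0"
  using one_minus_nonzero one_plus_nonzero by (simp add: qratio_def)

lemma qcentral_0 [simp]: "qcentral q n 0 = 1"
  using qfact_nonzero[of n] by (simp add: qcentral_def power2_eq_square field_simps)

lemma qcentral_eq_0: "n < j \<Longrightarrow> qcentral q n j = 0"
  by (simp add: qcentral_def)

text \<open>The division-free form covers all \<open>j\<close>: from \<open>j = Suc n\<close> on,
  the truncated exponent \<open>Suc n - j\<close> is 0, so the left side vanishes together with
  \<open>qcentral q n j\<close>.\<close>

lemma qcentral_Suc_left:
  "qcentral q (Suc n) j * (1 - q ^ (Suc n - j)) * (1 - q ^ (Suc n + j)) =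
     (1 - q ^ Suc n)\<^sup>2 * qcentral q n j"
proof -
  consider "j \<le> n" | "j = Suc n" | "Suc n < j" by linarith
  then show ?thesis
  proof cases
    case 1
    have "qfact q (Suc n - j) = qfact q (n - j) * (1 - q ^ (Suc n - j))"
      using 1 by (simp add: Suc_diff_le qfact_Suc)
    moreover have "qfact q (Suc n + j) = qfact q (n + j) * (1 - q ^ (Suc n + j))"
      by (simp add: qfact_Suc)
    moreover have "1 - q ^ (Suc n - j) \<noteq> 0" "1 - q ^ (Suc n + j) \<noteq> 0"
      using 1 one_minus_nonzero[of "Suc n - j"] one_minus_nonzero[of "Suc n + j"] by simp_all
    moreover have "a \<noteq> 0 \<Longrightarrow> b \<noteq> 0 \<Longrightarrow> u \<noteq> 0 \<Longrightarrow> v \<noteq> 0 \<Longrightarrow>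
        (f * w)\<^sup>2 * inverse (a * u) * inverse (b * v) * u * v = w\<^sup>2 * (f\<^sup>2 * inverse a * inverse b)"
      for a b u v f w :: 'a
      by (simp add: field_simps power2_eq_square)
    ultimately show ?thesis
      using 1 qfact_nonzero[of "n - j"] qfact_nonzero[of "n + j"]
      by (simp del: power_Suc add_Suc add: qcentral_def qfact_Suc[of q n])
  qed (simp_all add: qcentral_def)
qed

lemma qcentral_Suc_right:
  "j \<le> n \<Longrightarrow> qcentral q n (Suc j) * (1 - q ^ Suc (n + j)) = (1 - q ^ (n - j)) * qcentral q n j"
proof -
  assume j: "j \<le> n"
  show ?thesis
  proof (cases "j = n")
    case False
    then have "j < n" using j by simp
    then obtain k where k: "n - j = Suc k" "n - Suc j = k"
      by (metis Suc_diff_Suc)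
    have "1 - q ^ Suc k \<noteq> 0" "1 - q ^ Suc (n + j) \<noteq> 0"
      using one_minus_nonzero by blast+
    then show ?thesis
      using \<open>j < n\<close> qfact_nonzero[of k] qfact_nonzero[of "n + j"]
      by (simp del: power_Suc add: qcentral_def k qfact_Suc field_simps)
  qed (simp add: qcentral_def)
qed

text \<open>The sum satisfies the first-order recurrence of \<open>qratio\<close>; the recurrence is telescoped by \<open>G\<close>.\<close>
lemma qratio_expansion:
  "qratio q n = 1 + 2 * (\<Sum>j=1..n. (-1) ^ j * q ^ j\<^sup>2 * qcentral q n j)"
proof (induction n)
  case (Suc n)
  define m where "m = Suc n"
  define y where "y = q ^ m"
  define t where "t k j = (-1) ^ j * q ^ j\<^sup>2 * qcentral q k j" for k j
  define G where "G j = - ((-1) ^ j * q ^ (j\<^sup>2 - j) * qcentral q m j * (1 - q ^ (m + j)) * y / (1 - y))" for j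
  have y: "1 - y \<noteq> 0" "1 + y \<noteq> 0"
    using one_minus_nonzero one_plus_nonzero by (simp_all add: y_def m_def del: power_Suc)
  have step: "(1 + y) * t m j - (1 - y) * t n j = G (Suc j) - G j" if j: "j \<in> {1..m}" for j
  proof -
    define z p R where "z = q ^ j" and "p = q ^ (m - j)" and "R = q ^ (j\<^sup>2 - j)"
    have pz: "p * z = y"
      using j by (simp add: p_def z_def y_def flip: power_add)
    have jj: "j \<le> j\<^sup>2" by (simp add: power2_eq_square)
    have e1: "q ^ j\<^sup>2 = R * z"
      using jj by (simp add: R_def z_def flip: power_add)
    have "(Suc j)\<^sup>2 - Suc j = (j\<^sup>2 - j) + j + j"
      using jj by (simp add: power2_eq_square)
    then have e2: "q ^ ((Suc j)\<^sup>2 - Suc j) = R * z * z"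
      by (simp add: R_def z_def power_add)
    have e3: "q ^ (m + j) = y * z" by (simp add: y_def z_def power_add)
    define g h where "g = qcentral q m j" and "h = qcentral q n j"
    have h: "g * (1 - p) * (1 - y * z) = (1 - y)\<^sup>2 * h"
      using qcentral_Suc_left[of n j]
      unfolding g_def h_def p_def e3[symmetric] y_def[symmetric] m_def[symmetric] by (simp add: e3)
    have g': "qcentral q m (Suc j) * (1 - q ^ (m + Suc j)) = (1 - p) * g"
      using qcentral_Suc_right[of j m] j by (simp add: p_def g_def del: power_Suc)
    have "G (Suc j) = (-1) ^ j * R * z * z * (qcentral q m (Suc j) * (1 - q ^ (m + Suc j))) * y / (1 - y)"
      unfolding G_def e2 by (simp add: mult.assoc del: add_Suc_right)
    then have G1: "G (Suc j) = (-1) ^ j * R * z * z * ((1 - p) * g) * y / (1 - y)"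
      by (simp only: g')
    have G0: "G j = - ((-1) ^ j * R * g * (1 - y * z) * y / (1 - y))"
      by (simp add: G_def e3 R_def g_def)
    have h': "h = g * (1 - p) * (1 - y * z) / (1 - y)\<^sup>2"
      using h y by (simp add: field_simps)
    have key: "(1 + y) * (1 - y)\<^sup>2 * (z * g) - (1 - y) * (z * (g * (1 - p) * (1 - y * z)))
       = (1 - y) * (z * z * ((1 - p) * g) * y + g * (1 - y * z) * y)"
      unfolding pz[symmetric] by (simp add: algebra_simps power2_eq_square)
    have "(1 + y) * (z * g) - (1 - y) * (z * h)
        = z * z * ((1 - p) * g) * y / (1 - y) + g * (1 - y * z) * y / (1 - y)"
    proof -
      have "(1 - y)\<^sup>2 * ((1 + y) * (z * g) - (1 - y) * (z * h)) =
          (1 - y)\<^sup>2 * (z * z * ((1 - p) * g) * y / (1 - y) + g * (1 - y * z) * y / (1 - y))"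
        (is "?L = ?R")
      proof -
        have "?L = (1 + y) * (1 - y)\<^sup>2 * (z * g) - (1 - y) * (z * ((1 - y)\<^sup>2 * h))"
          by (simp add: algebra_simps)
        also have "\<dots> = (1 - y) * (z * z * ((1 - p) * g) * y + g * (1 - y * z) * y)"
          using key by (simp only: h)
        also have "\<dots> = ?R"
          using y by (simp add: power2_eq_square add_divide_distrib[symmetric])
        finally show ?thesis .
      qed
      then show ?thesis using y by simp
    qed
    then have "(-1) ^ j * R * ((1 + y) * (z * g) - (1 - y) * (z * h)) =
       (-1) ^ j * R * (z * z * ((1 - p) * g) * y / (1 - y) + g * (1 - y * z) * y / (1 - y))"
      by simp
    then show ?thesis
      unfolding G1 G0 t_def e1 g_def[symmetric] h_def[symmetric]
      by (simp add: algebra_simps)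
  qed
  have "(\<Sum>j=1..m. (1 + y) * t m j - (1 - y) * t n j) = (\<Sum>j=1..m. G (Suc j) - G j)"
    using step by simp
  also have "\<dots> = G (Suc m) - G 1"
    by (rule sum_Suc_diff) simp
  also have "G (Suc m) = 0" by (simp add: G_def qcentral_eq_0)
  \<comment> \<open>The boundary value pays for the term \<open>j = 0\<close> of the symmetric sum,
    which contributes \<open>(1 + y) - (1 - y) = 2 * y\<close> to the recurrence.\<close>
  also have "G 1 = y"
  proof -
    have "qcentral q m 1 * (1 - q ^ (m + 1)) = 1 - y"
      using qcentral_Suc_right[of 0 m] by (simp add: y_def)
    moreover have "G 1 = qcentral q m 1 * (1 - q ^ (m + 1)) * y / (1 - y)"
      by (simp add: G_def)
    ultimately show ?thesis using y by simp
  qed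
  finally have sums: "(1 + y) * (\<Sum>j=1..m. t m j) - (1 - y) * (\<Sum>j=1..m. t n j) = - y"
    by (simp add: sum_subtractf sum_distrib_left)
  have "t n m = 0" by (simp add: t_def m_def qcentral_eq_0)
  then have "(\<Sum>j=1..m. t n j) = (\<Sum>j=1..n. t n j)"
    by (simp add: m_def)
  with Suc.IH have IH: "qratio q n = 1 + 2 * (\<Sum>j=1..m. t n j)" by (simp add: t_def)
  have "(1 + y) * (1 + 2 * a) - (1 - y) * (1 + 2 * b) = 2 * ((1 + y) * a - (1 - y) * b + y)"
    for a b by (simp add: algebra_simps)
  from this[of "\<Sum>j=1..m. t m j" "\<Sum>j=1..m. t n j"]
  have "(1 + y) * (1 + 2 * (\<Sum>j=1..m. t m j)) = (1 - y) * qratio q n"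
    unfolding IH sums by simp
  moreover have "(1 + y) * qratio q m = (1 - y) * qratio q n"
    using y by (simp add: m_def y_def qratio_Suc field_simps del: power_Suc)
  ultimately have "qratio q m = 1 + 2 * (\<Sum>j=1..m. t m j)"
    using y by (metis mult_left_cancel)
  then show ?case by (simp add: m_def t_def)
qed simp

text \<open>With \<open>y = p z\<close> the recurrence reduces to
  \<open>z ((1 - y)^2 - (1 - p) (1 - y z)) = y (1 - z)^2\<close>. For \<open>j > 0\<close> the
  factor \<open>(1 - q^j)^2 / q^j\<close> is the reciprocal of \<open>wminus q j\<close>, so
  \<open>wminus q m * qcentral q m j\<close> is \<open>wminus q j\<close> times an increment in
  \<open>m\<close>. All later telescoping in \<open>m\<close> rests on this.\<close>

lemma qcentral_diff:
  assumes "0 < m"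
  shows "(qcentral q m j - qcentral q (m - 1) j) * q ^ j = wminus q m * (1 - q ^ j)\<^sup>2 * qcentral q m j"
proof (cases "j \<le> m")
  case True
  define y z p g h where "y = q ^ m" and "z = q ^ j" and "p = q ^ (m - j)"
    and "g = qcentral q m j" and "h = qcentral q (m - 1) j"
  have y: "1 - y \<noteq> 0"
    using one_minus_nonzero assms by (simp add: y_def)
  have pz: "p * z = y"
    using True by (simp add: p_def z_def y_def flip: power_add)
  have "g * (1 - p) * (1 - y * z) = (1 - y)\<^sup>2 * h"
    using qcentral_Suc_left[of "m - 1" j] assms
    by (simp add: g_def h_def p_def y_def z_def power_add del: power_Suc)
  then have "(1 - y)\<^sup>2 * ((g - h) * z) = (1 - y)\<^sup>2 * g * z - z * (g * (1 - p) * (1 - y * z))"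
    by (simp add: algebra_simps)
  also have "\<dots> = y * (1 - z)\<^sup>2 * g"
    unfolding pz[symmetric] by (simp add: algebra_simps power2_eq_square)
  finally have "(1 - y)\<^sup>2 * ((g - h) * z) = y * (1 - z)\<^sup>2 * g" .
  then show ?thesis
    unfolding g_def[symmetric] h_def[symmetric] z_def[symmetric] wminus_def y_def[symmetric]
    using y by (simp add: field_simps)
qed (simp add: qcentral_def)

text \<open>For each fixed \<open>j\<close> the sum over \<open>m\<close> telescopes by
  \<open>qcentral_diff\<close> and leaves only its upper end,
  \<open>wminus q j * qcentral q n j\<close>. The coefficients \<open>a\<close> stay arbitrary so
  that both expansions of \<open>qratio\<close>, in base \<open>q\<close> and in base
  \<open>q^2\<close>, can be inserted.\<close>

lemma sum_wminus_expansion: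
  assumes B: "\<And>m. B m = c + (\<Sum>j=1..m. a j * qcentral q m j)"
  shows "(\<Sum>m=1..n. wminus q m * B m)
       = c * (\<Sum>m=1..n. wminus q m) + (\<Sum>j=1..n. a j * wminus q j * qcentral q n j)"
proof (induction n)
  case (Suc n)
  define m where "m = Suc n"
  have "a j * wminus q j * (qcentral q m j - qcentral q n j) = wminus q m * (a j * qcentral q m j)"
    if "j \<in> {1..m}" for j
  proof -
    define z where "z = q ^ j"
    have z: "z \<noteq> 0" "1 - z \<noteq> 0"
      using that q_nonzero one_minus_nonzero by (auto simp: z_def)
    have "qcentral q m j - qcentral q n j = wminus q m * (1 - z)\<^sup>2 * qcentral q m j / z"
      using qcentral_diff[of m j] z by (simp add: z_def m_def field_simps del: power_Suc)
    moreover have "wminus q j = z * inverse ((1 - z)\<^sup>2)"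
      by (simp add: wminus_def z_def)
    ultimately show ?thesis
      using z by simp
  qed
  then have "(\<Sum>j=1..m. a j * wminus q j * (qcentral q m j - qcentral q n j))
      = (\<Sum>j=1..m. wminus q m * (a j * qcentral q m j))"
    by (rule sum.cong[OF refl])
  then have "(\<Sum>j=1..m. a j * wminus q j * qcentral q m j)
      = (\<Sum>j=1..m. a j * wminus q j * qcentral q n j) + wminus q m * (B m - c)"
    by (simp add: B sum_subtractf sum_distrib_left algebra_simps)
  moreover have "(\<Sum>j=1..m. a j * wminus q j * qcentral q n j)
      = (\<Sum>j=1..n. a j * wminus q j * qcentral q n j)"
    by (simp add: m_def qcentral_eq_0)
  ultimately show ?case
    using Suc.IH by (simp add: m_def algebra_simps)
qed simp

text \<open>Since \<open>(1 - z)^2 / (1 + z)^2 = 1 - 4 z / (1 + z)^2\<close>, the increment in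
  \<open>m\<close> of the left side \<open>A\<close> involves only \<open>A\<close> itself and
  \<open>qratio\<close>. In the resulting recurrence \<open>1 + 4 * wminus q m\<close> is the square
  of the quotient of consecutive values of \<open>qratio\<close>, so dividing by
  \<open>(qratio q m)^2\<close> turns it into a plain sum with summand
  \<open>4 * wplus q m / qratio q m\<close>.\<close>

lemma wplus_expansion:
  "1 + 8 * (\<Sum>j=1..n. (-1) ^ j * q ^ j\<^sup>2 * wplus q j * qcentral q n j)
     = (qratio q n)\<^sup>2 * (1 + 4 * (\<Sum>m=1..n. wplus q m * inverse (qratio q m)))"
proof (induction n)
  case (Suc n)
  define m where "m = Suc n"
  define y where "y = q ^ m"
  define t where "t k j = (-1) ^ j * q ^ j\<^sup>2 * qcentral q k j" for k j
  define A where "A k = 1 + 8 * (\<Sum>j=1..k. wplus q j * t k j)" for k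
  have y: "1 - y \<noteq> 0" "1 + y \<noteq> 0"
    using one_minus_nonzero one_plus_nonzero by (simp_all add: y_def m_def del: power_Suc)
  have "wplus q j * (t m j - t n j) = wminus q m * (t m j - 4 * (wplus q j * t m j))"
    if "j \<in> {1..m}" for j
  proof -
    define z where "z = q ^ j"
    have z: "z \<noteq> 0" "1 + z \<noteq> 0"
      using that q_nonzero one_plus_nonzero by (auto simp: z_def)
    have "qcentral q m j - qcentral q n j = wminus q m * (1 - z)\<^sup>2 * qcentral q m j / z"
      using qcentral_diff[of m j] z by (simp add: z_def m_def field_simps del: power_Suc)
    moreover have "t m j - t n j = (-1) ^ j * q ^ j\<^sup>2 * (qcentral q m j - qcentral q n j)"
      by (simp add: t_def right_diff_distrib)
    ultimately have "t m j - t n j = wminus q m * t m j * ((1 - z)\<^sup>2 / z)"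
      by (simp add: t_def mult_ac)
    then have "wplus q j * (t m j - t n j) = wminus q m * t m j * ((1 - z)\<^sup>2 / z * wplus q j)"
      by simp
    also have "(1 - z)\<^sup>2 / z * wplus q j = 1 - 4 * wplus q j"
    proof -
      have "(1 - z)\<^sup>2 = (1 + z)\<^sup>2 - 4 * z"
        by (simp add: power2_eq_square algebra_simps)
      then show ?thesis
        using z unfolding wplus_def z_def[symmetric] by (simp add: field_simps)
    qed
    finally show ?thesis by (simp add: algebra_simps)
  qed
  then have "(\<Sum>j=1..m. wplus q j * (t m j - t n j))
      = (\<Sum>j=1..m. wminus q m * (t m j - 4 * (wplus q j * t m j)))"
    by (rule sum.cong[OF refl])
  then have "(\<Sum>j=1..m. wplus q j * t m j) - (\<Sum>j=1..m. wplus q j * t n j)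
      = wminus q m * ((\<Sum>j=1..m. t m j) - 4 * (\<Sum>j=1..m. wplus q j * t m j))"
    by (simp add: sum_subtractf sum_distrib_left right_diff_distrib)
  moreover have "(\<Sum>j=1..m. wplus q j * t n j) = (\<Sum>j=1..n. wplus q j * t n j)"
    by (simp add: m_def t_def qcentral_eq_0)
  moreover have "qratio q m = 1 + 2 * (\<Sum>j=1..m. t m j)"
    by (simp add: t_def qratio_expansion)
  ultimately have rec: "A m * (1 + 4 * wminus q m) = A n + 4 * wminus q m * qratio q m"
  proof -
    assume *: "(\<Sum>j=1..m. wplus q j * t m j) - (\<Sum>j=1..m. wplus q j * t n j)
        = wminus q m * ((\<Sum>j=1..m. t m j) - 4 * (\<Sum>j=1..m. wplus q j * t m j))"
      "(\<Sum>j=1..m. wplus q j * t n j) = (\<Sum>j=1..n. wplus q j * t n j)"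
      "qratio q m = 1 + 2 * (\<Sum>j=1..m. t m j)"
    have "S - S' = w * (T - 4 * S) \<Longrightarrow>
        (1 + 8 * S) * (1 + 4 * w) = 1 + 8 * S' + 4 * w * (1 + 2 * T)" for S S' T w :: 'a
    proof -
      assume "S - S' = w * (T - 4 * S)"
      then have S': "S' = S - w * (T - 4 * S)" by (simp add: algebra_simps)
      show ?thesis unfolding S' by (simp add: algebra_simps)
    qed
    from this[OF *(1)] show ?thesis
      unfolding A_def *(2,3) .
  qed
  have w: "1 + 4 * wminus q m = (1 + y)\<^sup>2 / (1 - y)\<^sup>2"
  proof -
    have "(1 + y)\<^sup>2 = (1 - y)\<^sup>2 + 4 * y"
      by (simp add: power2_eq_square algebra_simps)
    then show ?thesis
      using y unfolding wminus_def y_def[symmetric] by (simp add: add_divide_distrib divide_inverse distrib_right)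
  qed
  have b: "qratio q m = qratio q n * (1 - y) / (1 + y)"
    by (simp add: m_def y_def qratio_Suc divide_inverse mult.assoc del: power_Suc)
  define S where "S = (\<Sum>m=1..n. wplus q m * inverse (qratio q m))"
  have IH: "A n = (qratio q n)\<^sup>2 * (1 + 4 * S)"
    using Suc.IH by (simp add: A_def t_def S_def algebra_simps)
  have "A m * (1 + 4 * wminus q m)
      = (qratio q m)\<^sup>2 * (1 + 4 * (S + wplus q m * inverse (qratio q m))) * (1 + 4 * wminus q m)"
  proof -
    have v: "wplus q m * (1 + 4 * wminus q m) = wminus q m"
      unfolding w using y by (simp add: wplus_def wminus_def y_def[symmetric] divide_inverse)
    have c: "(qratio q m)\<^sup>2 * (1 + 4 * wminus q m) = (qratio q n)\<^sup>2"
      unfolding w b using y by (simp add: power_divide power_mult_distrib)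
    have "d\<^sup>2 * (1 + 4 * (S + v * inverse d)) * x = d\<^sup>2 * x * (1 + 4 * S) + 4 * (v * x) * d"
      if "d \<noteq> 0" for d v x :: 'a
      using that by (simp add: algebra_simps power2_eq_square)
    note expand = this[OF qratio_nonzero]
    show ?thesis
      unfolding expand unfolding v c rec IH by simp
  qed
  moreover have "1 + 4 * wminus q m \<noteq> 0"
    using y by (simp add: w)
  ultimately have "A m = (qratio q m)\<^sup>2 * (1 + 4 * (S + wplus q m * inverse (qratio q m)))"
    by simp
  then show ?case
    by (simp add: A_def t_def S_def m_def algebra_simps)
qed simp

lemma generic_q_square: "generic_q (q\<^sup>2)"
proof
  fix i :: nat assume "0 < i"
  then show "(q\<^sup>2) ^ i \<noteq> 1"
    using power_neq_1[of "2 * i"] by (simp add: power_mult)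
  show "(q\<^sup>2) ^ i \<noteq> -1"
  proof
    assume "(q\<^sup>2) ^ i = -1"
    moreover have "q ^ (4 * i) = ((q\<^sup>2) ^ i)\<^sup>2"
      by (simp add: mult.commute flip: power_mult)
    ultimately have "q ^ (4 * i) = 1" by simp
    then show False using power_neq_1[of "4 * i"] \<open>0 < i\<close> by simp
  qed
qed (simp add: q_nonzero)

text \<open>Needed because \<open>wminus q (2 m)\<close> is \<open>wminus (q^2) m\<close>: for the
  sum over even indices to telescope, \<open>qratio\<close> at even indices must be expanded in the
  coefficients of base \<open>q^2\<close>.\<close>

lemma qratio_expansion_even:
  "qratio q (2 * n) = 1 + 2 * (\<Sum>j=1..n. (-1) ^ j * q ^ j\<^sup>2 * qcentral (q\<^sup>2) n j)"
proof (induction n)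
  case (Suc n)
  interpret sq: generic_q "q\<^sup>2" by (rule generic_q_square)
  define m where "m = Suc n"
  \<comment> \<open>These are the powers \<open>q^(2m)\<close> and \<open>q^(2m-1)\<close> in the
    two factors that \<open>qratio\<close> gains between \<open>2n\<close> and
    \<open>2m\<close>.\<close>
  define y u where "y = (q\<^sup>2) ^ m" and "u = q ^ (2 * n + 1)"
  have uy: "q * u = y"
    by (simp add: u_def y_def m_def power_mult power2_eq_square)
  define t where "t k j = (-1) ^ j * q ^ j\<^sup>2 * qcentral (q\<^sup>2) k j" for k j
  \<comment> \<open>A certificate as in creative telescoping: a rational multiple of the summand
    whose difference in \<open>j\<close> is the recurrence. It is checked after multiplication by
    \<open>(1 - y)^2 * q * z\<close>, which clears its denominators.\<close>
  define G where "G j = - (t m j * (1 - (q\<^sup>2) ^ (m + j)) * (y / (q\<^sup>2) ^ j + u) / (1 - y))" for j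
  have y: "1 - y \<noteq> 0" "1 + y \<noteq> 0"
    using sq.one_minus_nonzero sq.one_plus_nonzero by (simp_all add: y_def m_def del: power_Suc)
  have step: "(1 + y) * (1 + u) * t m j - (1 - y) * (1 - u) * t n j = G (Suc j) - G j"
    if j: "j \<in> {1..m}" for j
  proof -
    define z p g h s where "z = (q\<^sup>2) ^ j" and "p = (q\<^sup>2) ^ (m - j)"
      and "g = qcentral (q\<^sup>2) m j" and "h = qcentral (q\<^sup>2) n j" and "s = (-1) ^ j * q ^ j\<^sup>2"
    have z: "z \<noteq> 0" by (simp add: z_def q_nonzero)
    have pz: "p * z = y"
      using j by (simp add: p_def z_def y_def flip: power_add)
    have e3: "(q\<^sup>2) ^ (m + j) = y * z" by (simp add: y_def z_def power_add)
    have h: "g * (1 - p) * (1 - y * z) = (1 - y)\<^sup>2 * h"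
      using sq.qcentral_Suc_left[of n j]
      unfolding g_def h_def p_def e3[symmetric] y_def[symmetric] m_def[symmetric] by (simp add: e3)
    have g': "qcentral (q\<^sup>2) m (Suc j) * (1 - (q\<^sup>2) ^ (m + Suc j)) = (1 - p) * g"
      using sq.qcentral_Suc_right[of j m] j by (simp add: p_def g_def del: power_Suc)
    have e: "q ^ (Suc j)\<^sup>2 = q ^ j\<^sup>2 * z * q"
    proof -
      have "(Suc j)\<^sup>2 = j\<^sup>2 + 2 * j + 1" by (simp add: power2_eq_square)
      then show ?thesis by (simp only: power_add z_def power_mult power_one_right)
    qed
    have e4: "(q\<^sup>2) ^ Suc j = z * q\<^sup>2" by (simp add: z_def)
    have "G (Suc j) = s * z * q * (qcentral (q\<^sup>2) m (Suc j) * (1 - (q\<^sup>2) ^ (m + Suc j)))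
        * (y / (z * q\<^sup>2) + u) / (1 - y)"
      unfolding G_def t_def e e4 s_def by (simp add: mult_ac del: add_Suc_right)
    then have G1: "G (Suc j) = s * z * q * ((1 - p) * g) * (y / (z * q\<^sup>2) + u) / (1 - y)"
      by (simp only: g')
    have G0: "G j = - (s * g * (1 - y * z) * (y / z + u) / (1 - y))"
      by (simp add: G_def e3 t_def s_def g_def z_def)
    have "(1 - y)\<^sup>2 * (q * z * ((1 + y) * (1 + u) * (s * g) - (1 - y) * (1 - u) * (s * h)))
        = (1 - y)\<^sup>2 * (q * z * (G (Suc j) - G j))" (is "?L = ?R")
    proof -
      have "?L = q * z * ((1 - y)\<^sup>2 * (1 + y) * (1 + u) * (s * g)
          - (1 - y) * (1 - u) * (s * ((1 - y)\<^sup>2 * h)))"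
        by (simp add: algebra_simps)
      also have "\<dots> = z * s * g * (1 - y) * ((1 - y) * (1 + y) * (q + q * u)
          - (q - q * u) * ((1 - p) * (1 - y * z)))"
        unfolding h[symmetric] by (simp add: algebra_simps power2_eq_square)
      also have "\<dots> = s * g * (1 - y) * (z * z * q * (1 - p) * (q * u) + z * (1 - p) * y
          + (1 - y * z) * (q * y + z * (q * u)))"
        unfolding uy unfolding pz[symmetric] by (simp add: algebra_simps power2_eq_square)
      also have "\<dots> = ?R"
        unfolding G1 G0 using y z q_nonzero
        by (simp add: power2_eq_square add_divide_distrib[symmetric] diff_divide_distrib[symmetric] divide_simps)
          (simp add: algebra_simps)
      finally show ?thesis .
    qed
    then have "(1 + y) * (1 + u) * (s * g) - (1 - y) * (1 - u) * (s * h) = G (Suc j) - G j"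
      using y z q_nonzero by simp
    then show ?thesis
      by (simp add: t_def s_def g_def h_def)
  qed
  have "(\<Sum>j=1..m. (1 + y) * (1 + u) * t m j - (1 - y) * (1 - u) * t n j)
      = (\<Sum>j=1..m. G (Suc j) - G j)"
    using step by simp
  also have "\<dots> = G (Suc m) - G 1"
    by (rule sum_Suc_diff) simp
  also have "G (Suc m) = 0" by (simp add: G_def t_def qcentral_eq_0 sq.qcentral_eq_0)
  also have "G 1 = y + u"
  proof -
    have "qcentral (q\<^sup>2) m 1 * (1 - (q\<^sup>2) ^ (m + 1)) = 1 - y"
      using sq.qcentral_Suc_right[of 0 m] by (simp add: y_def)
    then have "G 1 = q * (1 - y) * (y / q\<^sup>2 + u) / (1 - y)"
      by (simp add: G_def t_def mult.assoc)
    also have "\<dots> = y / q + q * u"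
      using y q_nonzero by (simp add: field_simps power2_eq_square)
    also have "\<dots> = y + u"
      using q_nonzero unfolding uy[symmetric] by simp
    finally show ?thesis .
  qed
  finally have sums: "(1 + y) * (1 + u) * (\<Sum>j=1..m. t m j)
      - (1 - y) * (1 - u) * (\<Sum>j=1..m. t n j) = - (y + u)"
    by (simp add: sum_subtractf sum_distrib_left)
  have "t n m = 0" by (simp add: t_def m_def sq.qcentral_eq_0)
  then have "(\<Sum>j=1..m. t n j) = (\<Sum>j=1..n. t n j)"
    by (simp add: m_def)
  with Suc.IH have IH: "qratio q (2 * n) = 1 + 2 * (\<Sum>j=1..m. t n j)" by (simp add: t_def)
  have "(1 + y) * (1 + u) * (1 + 2 * a) - (1 - y) * (1 - u) * (1 + 2 * b)
      = 2 * ((1 + y) * (1 + u) * a - (1 - y) * (1 - u) * b + (y + u))"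
    for a b by (simp add: algebra_simps)
  from this[of "\<Sum>j=1..m. t m j" "\<Sum>j=1..m. t n j"]
  have *: "(1 + y) * (1 + u) * (1 + 2 * (\<Sum>j=1..m. t m j)) = (1 - y) * (1 - u) * qratio q (2 * n)"
    unfolding IH sums by simp
  have u: "1 + u \<noteq> 0" using one_plus_nonzero[of "2 * n + 1"] by (simp add: u_def)
  have "qratio q (2 * m) = qratio q (2 * n) * ((1 - u) * inverse (1 + u)) * ((1 - y) * inverse (1 + y))"
  proof -
    have "2 * m = Suc (Suc (2 * n))" "y = q ^ Suc (Suc (2 * n))" "u = q ^ Suc (2 * n)"
      by (simp_all add: m_def y_def u_def power_mult[symmetric] del: power_Suc)
    then show ?thesis by (simp only: qratio_Suc)
  qed
  then have "qratio q (2 * m) = (1 - y) * (1 - u) * qratio q (2 * n) / ((1 + y) * (1 + u))"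
    by (simp add: divide_inverse mult_ac)
  then have "(1 + y) * (1 + u) * qratio q (2 * m) = (1 - y) * (1 - u) * qratio q (2 * n)"
    using y u by simp
  with * have "qratio q (2 * m) = 1 + 2 * (\<Sum>j=1..m. t m j)"
    using y u by (metis mult_left_cancel no_zero_divisors)
  then show ?case by (simp add: m_def t_def)
qed simp

end

section \<open>Truncated power series\<close>

definition fps_agree :: "nat \<Rightarrow> 'a fps \<Rightarrow> 'a fps \<Rightarrow> bool" where
  "fps_agree n f g \<longleftrightarrow> (\<forall>i\<le>n. fps_nth f i = fps_nth g i)"

lemma fps_agree_refl [simp]: "fps_agree n f f"
  by (simp add: fps_agree_def)

lemma fps_agree_sym: "fps_agree n f g \<Longrightarrow> fps_agree n g f"
  by (simp add: fps_agree_def)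

lemma fps_agree_trans [trans]: "fps_agree n f g \<Longrightarrow> fps_agree n g h \<Longrightarrow> fps_agree n f h"
  by (simp add: fps_agree_def)

lemma fps_agree_add:
  "fps_agree n f g \<Longrightarrow> fps_agree n f' g' \<Longrightarrow> fps_agree n (f + f') (g + g')"
  by (simp add: fps_agree_def)

lemma fps_agree_diff:
  "fps_agree n f g \<Longrightarrow> fps_agree n f' g' \<Longrightarrow> fps_agree n (f - f') (g - g')"
  for f g :: "'a::group_add fps"
  by (simp add: fps_agree_def)

lemma fps_agree_mult:
  "fps_agree n f g \<Longrightarrow> fps_agree n f' g' \<Longrightarrow> fps_agree n (f * f') (g * g')"
  for f g :: "'a::comm_ring_1 fps"
  unfolding fps_agree_def fps_mult_nth by (auto intro!: sum.cong)

lemma fps_agree_sum: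
  "(\<And>x. x \<in> S \<Longrightarrow> fps_agree n (f x) (g x)) \<Longrightarrow> fps_agree n (sum f S) (sum g S)"
  for f g :: "'b \<Rightarrow> 'a::comm_ring_1 fps"
  unfolding fps_agree_def by (simp add: fps_sum_nth)

lemma fps_agree_cmult: "fps_agree n f g \<Longrightarrow> fps_agree n (c * f) (c * g)"
  for f g :: "'a::comm_ring_1 fps"
  by (intro fps_agree_mult fps_agree_refl)

lemma fps_agree_sum_cmult:
  "(\<And>x. x \<in> S \<Longrightarrow> fps_agree n (f x) (g x)) \<Longrightarrow>
     fps_agree n (\<Sum>x\<in>S. c x * f x) (\<Sum>x\<in>S. c x * g x)"
  for f g :: "'b \<Rightarrow> 'a::comm_ring_1 fps"
  by (intro fps_agree_sum fps_agree_cmult)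

lemma fps_agree_mono: "fps_agree n f g \<Longrightarrow> m \<le> n \<Longrightarrow> fps_agree m f g"
  by (simp add: fps_agree_def)

lemma fps_agree_inverse:
  fixes f g :: "'a::field fps"
  assumes "fps_agree n f g" "fps_nth f 0 \<noteq> 0" "fps_nth g 0 \<noteq> 0"
  shows "fps_agree n (inverse f) (inverse g)"
proof -
  have "fps_agree n (inverse f * (g * inverse g)) (inverse f * (f * inverse g))"
    using assms(1) by (intro fps_agree_mult fps_agree_refl) (rule fps_agree_sym)
  moreover have "inverse f * (g * inverse g) = inverse f"
    using inverse_mult_eq_1'[OF assms(3)] by simp
  moreover have "inverse f * (f * inverse g) = inverse g"
    using inverse_mult_eq_1[OF assms(2)] by (simp add: mult.assoc[symmetric])
  ultimately show ?thesis by simp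
qed

lemma fps_agree_X_power_mult:
  "fps_agree m f g \<Longrightarrow> n \<le> k + m \<Longrightarrow> fps_agree n (fps_X ^ k * f) (fps_X ^ k * g)"
  for f g :: "'a::comm_ring_1 fps"
  unfolding fps_agree_def by (auto simp: fps_X_power_mult_nth)

lemma fps_agree_X_power_mult_0: "n < k \<Longrightarrow> fps_agree n (fps_X ^ k * f) 0"
  for f :: "'a::comm_ring_1 fps"
  unfolding fps_agree_def by (auto simp: fps_X_power_mult_nth)

lemma fps_eqI_agree: "(\<And>n. fps_agree n f g) \<Longrightarrow> f = g"
  by (auto simp: fps_agree_def fps_eq_iff)

section \<open>Transport of the finite identities from Laurent series to power series\<close>

lemma fps_to_fls_inverse:
  "fps_nth f 0 \<noteq> 0 \<Longrightarrow> fps_to_fls (inverse f) = inverse (fps_to_fls f)"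
  for f :: "'a::field fps"
  by (simp add: fls_inverse_fps_to_fls)

lemma fps_to_fls_sum: "fps_to_fls (sum f S) = (\<Sum>x\<in>S. fps_to_fls (f x))"
  by (induction S rule: infinite_finite_induct) auto

lemma fps_to_fls_prod: "fps_to_fls (prod f S) = (\<Prod>x\<in>S. fps_to_fls (f x))"
  for f :: "'b \<Rightarrow> 'a::comm_ring_1 fps"
  by (induction S rule: infinite_finite_induct) (auto simp: fls_times_fps_to_fls)

lemma generic_q_fls: "generic_q (fls_X :: rat fls)"
proof
  fix i :: nat assume i: "0 < i"
  have "fls_nth ((fls_X :: rat fls) ^ i) 0 = 0"
    using i by (simp add: fls_X_power_nth)
  then show "(fls_X :: rat fls) ^ i \<noteq> 1" "(fls_X :: rat fls) ^ i \<noteq> -1"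
    by (metis fls_one_nth zero_neq_one, metis fls_one_nth fls_uminus_nth neg_equal_0_iff_equal zero_neq_one)
qed simp

lemma fps_power_nth_0_zero: "fps_nth q 0 = 0 \<Longrightarrow> 0 < i \<Longrightarrow> fps_nth (q ^ i) 0 = (0::'a::idom)"
  by (simp add: fps_power_zeroth)

lemma qfact_nth_0: "fps_nth q 0 = 0 \<Longrightarrow> fps_nth (qfact q n) 0 = (1::'a::idom)"
  by (induction n) (simp_all add: qfact_Suc fps_power_zeroth)

lemma qratio_nth_0: "fps_nth q 0 = 0 \<Longrightarrow> fps_nth (qratio q n) 0 = (1::'a::field)"
  by (induction n) (simp_all add: qratio_Suc fps_power_zeroth)

context
  fixes q :: "rat fps"
  assumes q0: "fps_nth q 0 = 0"
begin

lemma fps_to_fls_qfact: "fps_to_fls (qfact q n) = qfact (fps_to_fls q) n"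
  by (simp add: qfact_def fps_to_fls_prod fps_to_fls_power)

lemma fps_to_fls_qratio: "fps_to_fls (qratio q n) = qratio (fps_to_fls q) n"
  unfolding qratio_def fps_to_fls_prod
  by (intro prod.cong refl)
    (simp add: fls_times_fps_to_fls fps_to_fls_inverse fps_to_fls_power fps_power_nth_0_zero[OF q0])

lemma fps_to_fls_qcentral: "fps_to_fls (qcentral q n j) = qcentral (fps_to_fls q) n j"
  by (simp add: qcentral_def fls_times_fps_to_fls fps_to_fls_power fps_to_fls_inverse
      qfact_nth_0[OF q0] fps_to_fls_qfact)

lemma fps_to_fls_square_inverse:
  assumes "0 < n"
  shows "fps_to_fls (inverse ((1 - q ^ n)\<^sup>2)) = inverse ((1 - fps_to_fls q ^ n)\<^sup>2)"
    and "fps_to_fls (inverse ((1 + q ^ n)\<^sup>2)) = inverse ((1 + fps_to_fls q ^ n)\<^sup>2)"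
proof -
  have *: "fps_nth ((1 - q ^ n)\<^sup>2) 0 \<noteq> 0" "fps_nth ((1 + q ^ n)\<^sup>2) 0 \<noteq> 0"
    using fps_power_nth_0_zero[OF q0 assms] assms by (simp_all add: fps_power_zeroth zero_power q0)
  show "fps_to_fls (inverse ((1 - q ^ n)\<^sup>2)) = inverse ((1 - fps_to_fls q ^ n)\<^sup>2)"
    by (simp only: fps_to_fls_inverse[OF *(1)]) (simp add: fps_to_fls_power)
  show "fps_to_fls (inverse ((1 + q ^ n)\<^sup>2)) = inverse ((1 + fps_to_fls q ^ n)\<^sup>2)"
    by (simp only: fps_to_fls_inverse[OF *(2)]) (simp add: fps_to_fls_power)
qed

lemma fps_to_fls_wminus: "0 < n \<Longrightarrow> fps_to_fls (wminus q n) = wminus (fps_to_fls q) n"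
  by (simp add: wminus_def fls_times_fps_to_fls fps_to_fls_power fps_to_fls_square_inverse)

lemma fps_to_fls_wplus: "0 < n \<Longrightarrow> fps_to_fls (wplus q n) = wplus (fps_to_fls q) n"
  by (simp add: wplus_def fls_times_fps_to_fls fps_to_fls_power fps_to_fls_square_inverse)

end

lemmas fps_to_fls_q =
  fps_to_fls_qratio fps_to_fls_qcentral fps_to_fls_wminus fps_to_fls_wplus

abbreviation (input) X :: "rat fps" where "X \<equiv> fps_X"

lemma qratio_expansion_fps:
  "qratio X n = 1 + 2 * (\<Sum>j=1..n. (-1) ^ j * X ^ j\<^sup>2 * qcentral X n j)"
proof -
  have "fps_to_fls (qratio X n) = fps_to_fls (1 + 2 * (\<Sum>j=1..n. (-1) ^ j * X ^ j\<^sup>2 * qcentral X n j))"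
    by (simp add: fps_to_fls_q fls_times_fps_to_fls fps_to_fls_sum fps_to_fls_power
        generic_q.qratio_expansion[OF generic_q_fls])
  then show ?thesis by (simp only: fps_to_fls_eq_iff)
qed

lemma wplus_expansion_fps:
  "(qratio X n)\<^sup>2 * (1 + 4 * (\<Sum>m=1..n. wplus X m * inverse (qratio X m)))
     = 1 + 8 * (\<Sum>j=1..n. (-1) ^ j * X ^ j\<^sup>2 * wplus X j * qcentral X n j)"
proof -
  have "fps_to_fls ((qratio X n)\<^sup>2 * (1 + 4 * (\<Sum>m=1..n. wplus X m * inverse (qratio X m))))
     = fps_to_fls (1 + 8 * (\<Sum>j=1..n. (-1) ^ j * X ^ j\<^sup>2 * wplus X j * qcentral X n j))"
    by (simp add: fps_to_fls_q fls_times_fps_to_fls fps_to_fls_sum fps_to_fls_power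
        fps_to_fls_inverse qratio_nth_0 del: One_nat_def
        flip: generic_q.wplus_expansion[OF generic_q_fls])
  then show ?thesis by (simp only: fps_to_fls_eq_iff)
qed

lemma sum_wminus_fps:
  "(\<Sum>m=1..n. wminus X m * qratio X m)
     = (\<Sum>m=1..n. wminus X m) + 2 * (\<Sum>j=1..n. (-1) ^ j * X ^ j\<^sup>2 * wminus X j * qcentral X n j)"
proof -
  interpret generic_q "fls_X :: rat fls" by (rule generic_q_fls)
  have "qratio (fls_X :: rat fls) m = 1 + (\<Sum>j=1..m. (2 * (-1) ^ j * fls_X ^ j\<^sup>2) * qcentral fls_X m j)" for m
    by (simp add: qratio_expansion sum_distrib_left mult.assoc del: One_nat_def)
  from sum_wminus_expansion[OF this, of n]
  have "fps_to_fls (\<Sum>m=1..n. wminus X m * qratio X m)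
     = fps_to_fls ((\<Sum>m=1..n. wminus X m)
         + 2 * (\<Sum>j=1..n. (-1) ^ j * X ^ j\<^sup>2 * wminus X j * qcentral X n j))"
    by (simp add: fps_to_fls_q fls_times_fps_to_fls fps_to_fls_sum fps_to_fls_power
        sum_distrib_left mult.assoc del: One_nat_def)
  then show ?thesis by (simp only: fps_to_fls_eq_iff)
qed

lemma sum_wminus_even_fps:
  "(\<Sum>m=1..n. wminus (X\<^sup>2) m * qratio X (2 * m))
     = (\<Sum>m=1..n. wminus (X\<^sup>2) m)
       + 2 * (\<Sum>j=1..n. (-1) ^ j * X ^ j\<^sup>2 * wminus (X\<^sup>2) j * qcentral (X\<^sup>2) n j)"
proof -
  interpret generic_q "fls_X :: rat fls" by (rule generic_q_fls)
  interpret sq: generic_q "(fls_X :: rat fls)\<^sup>2" by (rule generic_q_square)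
  have "qratio (fls_X :: rat fls) (2 * m)
      = 1 + (\<Sum>j=1..m. (2 * (-1) ^ j * fls_X ^ j\<^sup>2) * qcentral (fls_X\<^sup>2) m j)" for m
    by (simp add: qratio_expansion_even sum_distrib_left mult.assoc del: One_nat_def)
  from sq.sum_wminus_expansion[OF this, of n]
  have "fps_to_fls (\<Sum>m=1..n. wminus (X\<^sup>2) m * qratio X (2 * m))
     = fps_to_fls ((\<Sum>m=1..n. wminus (X\<^sup>2) m)
         + 2 * (\<Sum>j=1..n. (-1) ^ j * X ^ j\<^sup>2 * wminus (X\<^sup>2) j * qcentral (X\<^sup>2) n j))"
    by (simp add: fps_to_fls_q fls_times_fps_to_fls fps_to_fls_sum fps_to_fls_power
        sum_distrib_left mult.assoc del: One_nat_def)
  then show ?thesis by (simp only: fps_to_fls_eq_iff)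
qed

section \<open>Limits of the finite identities\<close>

lemma self_le_square: "j \<le> j\<^sup>2" for j :: nat
  by (simp add: power2_eq_square)

lemma qfact_agree:
  assumes "m \<le> n" "M < k * Suc m"
  shows "fps_agree M (qfact (X ^ k) n) (qfact (X ^ k) m)"
  using assms(1)
proof (induction n rule: dec_induct)
  case (step i)
  have "M < k * Suc i" using assms(2) step.hyps by (meson Suc_le_mono le_trans less_le_trans mult_le_mono2)
  then have "fps_agree M (X ^ (k * Suc i) * 1) 0"
    by (rule fps_agree_X_power_mult_0)
  then have "fps_agree M (1 - X ^ (k * Suc i)) (1 - 0)"
    by (intro fps_agree_diff) simp_all
  then have "fps_agree M (qfact (X ^ k) i * (1 - X ^ (k * Suc i))) (qfact (X ^ k) m * 1)"
    using step.IH by (intro fps_agree_mult) simp_all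
  then show ?case by (simp add: qfact_Suc power_mult del: power_Suc mult_Suc_right)
qed simp

text \<open>Up to order \<open>M\<close> all three \<open>q\<close>-factorials equal the shortest
  one, with index \<open>n - j\<close>, and cancel. The precision thus shrinks as \<open>j\<close>
  grows.\<close>

lemma qcentral_agree:
  assumes "j \<le> n" "M < k * Suc (n - j)" "0 < k"
  shows "fps_agree M (qcentral (X ^ k) n j) 1"
proof -
  let ?f = "qfact (X ^ k)"
  have 0: "fps_nth (?f i) 0 \<noteq> 0" for i
    using assms(3) by (simp add: qfact_nth_0)
  have "fps_agree M (?f n * ?f n * inverse (?f (n - j)) * inverse (?f (n + j)))
     (?f (n - j) * ?f (n - j) * inverse (?f (n - j)) * inverse (?f (n - j)))"
    using assms(2) 0 by (intro fps_agree_mult fps_agree_inverse qfact_agree) auto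
  also have "?f (n - j) * ?f (n - j) * inverse (?f (n - j)) * inverse (?f (n - j)) = 1"
    using inverse_mult_eq_1'[OF 0] by (metis mult.assoc mult.right_neutral)
  finally show ?thesis
    using assms(1) by (simp add: qcentral_def power2_eq_square)
qed

text \<open>\<open>qcentral X n j\<close> is close to 1 only up to order \<open>n - j\<close>, but
  it is multiplied by \<open>X^(j^2)\<close>, and \<open>j^2 \<ge> j\<close> makes up for the
  loss.\<close>

lemma theta_agree_qratio:
  "fps_agree n (qratio X n) (1 + 2 * (\<Sum>j=1..n. (-1) ^ j * X ^ j\<^sup>2))"
proof -
  have "fps_agree n (X ^ j\<^sup>2 * qcentral X n j) (X ^ j\<^sup>2 * 1)" if "j \<in> {1..n}" for j
  proof (rule fps_agree_X_power_mult)
    show "fps_agree (n - j) (qcentral X n j) 1"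
      using that qcentral_agree[of j n "n - j" 1] by simp
    show "n \<le> j\<^sup>2 + (n - j)"
      using self_le_square[of j] by arith
  qed
  then have "fps_agree n (1 + 2 * (\<Sum>j=1..n. (-1) ^ j * (X ^ j\<^sup>2 * qcentral X n j)))
      (1 + 2 * (\<Sum>j=1..n. (-1) ^ j * (X ^ j\<^sup>2 * 1)))"
    by (rule fps_agree_add[OF fps_agree_refl fps_agree_cmult[OF fps_agree_sum_cmult]])
  then show ?thesis
    by (simp add: qratio_expansion_fps mult.assoc)
qed

lemma wplus_agree:
  "fps_agree n ((qratio X n)\<^sup>2 * (1 + 4 * (\<Sum>m=1..n. wplus X m * inverse (qratio X m))))
     (1 + 8 * (\<Sum>j=1..n. (-1) ^ j * (X ^ j\<^sup>2 * wplus X j)))"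
proof -
  have "fps_agree n (X ^ j\<^sup>2 * (wplus X j * qcentral X n j)) (X ^ j\<^sup>2 * (wplus X j * 1))"
    if "j \<in> {1..n}" for j
  proof (rule fps_agree_X_power_mult)
    show "fps_agree (n - j) (wplus X j * qcentral X n j) (wplus X j * 1)"
      using that qcentral_agree[of j n "n - j" 1] by (intro fps_agree_mult) simp_all
    show "n \<le> j\<^sup>2 + (n - j)"
      using self_le_square[of j] by arith
  qed
  then have "fps_agree n (1 + 8 * (\<Sum>j=1..n. (-1) ^ j * (X ^ j\<^sup>2 * (wplus X j * qcentral X n j))))
      (1 + 8 * (\<Sum>j=1..n. (-1) ^ j * (X ^ j\<^sup>2 * (wplus X j * 1))))"
    by (rule fps_agree_add[OF fps_agree_refl fps_agree_cmult[OF fps_agree_sum_cmult]])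
  then show ?thesis
    by (simp add: wplus_expansion_fps mult.assoc del: One_nat_def)
qed

text \<open>The odd indices are all indices minus the even ones. The bound \<open>2 * n\<close>
  makes the even ones exactly the doubles of \<open>1..n\<close>, which are then treated in base
  \<open>X^2\<close>.\<close>

lemma wminus_odd_agree:
  "fps_agree (2 * n) (\<Sum>m \<in> {m\<in>{1..2*n}. odd m}. wminus X m * qratio X m)
     ((\<Sum>m=1..2*n. wminus X m) + 2 * (\<Sum>j=1..2*n. (-1) ^ j * (X ^ j\<^sup>2 * wminus X j))
      - ((\<Sum>m=1..n. wminus (X\<^sup>2) m) + 2 * (\<Sum>j=1..n. (-1) ^ j * (X ^ j\<^sup>2 * wminus (X\<^sup>2) j))))"
proof -
  let ?N = "2 * n"
  have "(\<Sum>m=1..?N. wminus X m * qratio X m)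
      = (\<Sum>m \<in> {m\<in>{1..?N}. odd m}. wminus X m * qratio X m)
        + (\<Sum>m \<in> {m\<in>{1..?N}. even m}. wminus X m * qratio X m)"
    by (subst sum.union_disjoint[symmetric]) (auto intro!: sum.cong)
  also have "(\<Sum>m \<in> {m\<in>{1..?N}. even m}. wminus X m * qratio X m)
      = (\<Sum>m=1..n. wminus (X\<^sup>2) m * qratio X (2 * m))"
    by (rule sum.reindex_bij_witness[of _ "\<lambda>m. 2 * m" "\<lambda>m. m div 2"])
      (auto simp: wminus_def power_mult)
  finally have split: "(\<Sum>m \<in> {m\<in>{1..?N}. odd m}. wminus X m * qratio X m)
      = (\<Sum>m=1..?N. wminus X m * qratio X m) - (\<Sum>m=1..n. wminus (X\<^sup>2) m * qratio X (2 * m))"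
    by simp
  have 1: "fps_agree ?N (X ^ j\<^sup>2 * (wminus X j * qcentral X ?N j)) (X ^ j\<^sup>2 * (wminus X j * 1))"
    if "j \<in> {1..?N}" for j
  proof (rule fps_agree_X_power_mult)
    show "fps_agree (?N - j) (wminus X j * qcentral X ?N j) (wminus X j * 1)"
      using that qcentral_agree[of j ?N "?N - j" 1] by (intro fps_agree_mult) simp_all
    show "?N \<le> j\<^sup>2 + (?N - j)"
      using self_le_square[of j] by arith
  qed
  have 2: "fps_agree ?N (X ^ j\<^sup>2 * (wminus (X\<^sup>2) j * qcentral (X\<^sup>2) n j)) (X ^ j\<^sup>2 * (wminus (X\<^sup>2) j * 1))"
    if j: "j \<in> {1..n}" for j
  proof (rule fps_agree_X_power_mult)
    show "fps_agree (2 * (n - j) + 1) (wminus (X\<^sup>2) j * qcentral (X\<^sup>2) n j) (wminus (X\<^sup>2) j * 1)"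
      using j qcentral_agree[of j n "2 * (n - j) + 1" 2] by (intro fps_agree_mult) simp_all
    \<comment> \<open>In base \<open>X^2\<close> the precision is \<open>2 * (n - j) + 1\<close>.
      The extra 1 is essential: for \<open>j = 1\<close> two orders are lost and
      \<open>X^(j^2)\<close> restores only one.\<close>
    have "2 * j \<le> j\<^sup>2 + 1"
      by (cases j) (simp_all add: power2_eq_square)
    then show "?N \<le> j\<^sup>2 + (2 * (n - j) + 1)"
      using j by simp
  qed
  have "fps_agree ?N ((\<Sum>m=1..?N. wminus X m)
       + 2 * (\<Sum>j=1..?N. (-1) ^ j * (X ^ j\<^sup>2 * (wminus X j * qcentral X ?N j)))
      - ((\<Sum>m=1..n. wminus (X\<^sup>2) m)
       + 2 * (\<Sum>j=1..n. (-1) ^ j * (X ^ j\<^sup>2 * (wminus (X\<^sup>2) j * qcentral (X\<^sup>2) n j)))))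
     ((\<Sum>m=1..2*n. wminus X m) + 2 * (\<Sum>j=1..2*n. (-1) ^ j * (X ^ j\<^sup>2 * (wminus X j * 1)))
      - ((\<Sum>m=1..n. wminus (X\<^sup>2) m) + 2 * (\<Sum>j=1..n. (-1) ^ j * (X ^ j\<^sup>2 * (wminus (X\<^sup>2) j * 1)))))"
    by (rule fps_agree_diff[OF fps_agree_add[OF fps_agree_refl fps_agree_cmult[OF fps_agree_sum_cmult]]
          fps_agree_add[OF fps_agree_refl fps_agree_cmult[OF fps_agree_sum_cmult]], OF 1 2])
  then show ?thesis
    unfolding split sum_wminus_fps sum_wminus_even_fps by (simp add: mult.assoc)
qed


section \<open>The q-binomial series and the alternating sum of differences\<close>

lemma cancel_inverse: "a * b = 1 \<Longrightarrow> b * (a * c) = c" for a b c :: "'a::comm_ring_1"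
  by (metis mult.assoc mult.commute mult_1)

text \<open>The quotient of the \<open>q\<close>-Pochhammer symbols of -1 and of \<open>q\<close>,
  each with \<open>k\<close> factors: the coefficients in the \<open>q\<close>-binomial theorem for
  \<open>(-x)_\<infinity> / (x)_\<infinity>\<close>. The factor at \<open>k = 0\<close> is
  \<open>1 + X^0 = 2\<close>.\<close>

primrec qbinom :: "nat \<Rightarrow> rat fps" where
  "qbinom 0 = 1"
| "qbinom (Suc k) = qbinom k * (1 + X ^ k) * inverse (1 - X ^ Suc k)"

lemma one_minus_X_inverse: "0 < k \<Longrightarrow> (1 - X ^ k) * inverse (1 - X ^ k) = 1"
  and one_plus_X_inverse: "0 < k \<Longrightarrow> (1 + X ^ k) * inverse (1 + X ^ k) = 1"
  by (simp_all add: inverse_mult_eq_1' fps_power_zeroth zero_power)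

lemma qbinom_Suc_mult: "qbinom (Suc k) * (1 - X ^ Suc k) = qbinom k * (1 + X ^ k)"
  using one_minus_X_inverse[of "Suc k"]
  by (simp del: power_Suc add: mult.assoc mult.commute[of "inverse _"])

text \<open>One more factor in the numerator of \<open>qbinom\<close> turns it into twice the
  product of \<open>1 + q^i\<close> for \<open>i = 1..k\<close>, which is the denominator of
  \<open>qratio\<close>.\<close>

lemma qbinom_qratio: "0 < k \<Longrightarrow> qbinom k * (1 + X ^ k) * qratio X k = 2"
proof (induction k)
  case (Suc k)
  have "qbinom (Suc k) * (1 + X ^ Suc k) * qratio X (Suc k)
      = qbinom (Suc k) * (1 - X ^ Suc k) * qratio X k
          * ((1 + X ^ Suc k) * inverse (1 + X ^ Suc k))"
    unfolding qratio_Suc by (simp only: mult_ac)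
  also have "\<dots> = qbinom k * (1 + X ^ k) * qratio X k"
    by (simp only: qbinom_Suc_mult one_plus_X_inverse mult_1_right zero_less_Suc)
  also have "\<dots> = 2"
    using Suc by (cases "k = 0") simp_all
  finally show ?case .
qed simp

text \<open>The truncated \<open>q\<close>-binomial series \<open>(-x)\<^sub>\<infinity> / (x)\<^sub>\<infinity>\<close> at \<open>x = q ^ Suc m\<close>.\<close>
definition tail_series :: "nat \<Rightarrow> nat \<Rightarrow> rat fps" where
  "tail_series n m = (\<Sum>k=0..n. qbinom k * X ^ (Suc m * k))"

text \<open>The functional equation \<open>(1 - x) f(x) = (1 + x) f(q x)\<close> of the
  \<open>q\<close>-binomial series at \<open>x = q^(m+1)\<close>. Truncation leaves a single error
  term, whose order exceeds \<open>n\<close>.\<close>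

lemma tail_series_Suc:
  "(1 - X ^ Suc m) * tail_series n m - (1 + X ^ Suc m) * tail_series n (Suc m)
     = - (qbinom n * (1 + X ^ n) * X ^ (Suc m * Suc n))"
proof (induction n)
  case 0
  then show ?case by (simp add: tail_series_def algebra_simps)
next
  case (Suc n)
  define y u where "y = X ^ Suc m" and "u = X ^ Suc n"
  have e: "X ^ (Suc m * Suc n) = X ^ (Suc m * n) * y" "X ^ (Suc (Suc m) * Suc n) = X ^ (Suc m * n) * y * u"
    "X ^ (Suc m * Suc (Suc n)) = X ^ (Suc m * n) * y * y"
    by (simp_all add: y_def u_def power_add[symmetric] algebra_simps del: power_Suc)
  let ?A = "X ^ (Suc m * n) * y"
  have "(1 - y) * tail_series (Suc n) m - (1 + y) * tail_series (Suc n) (Suc m)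
      = ((1 - y) * tail_series n m - (1 + y) * tail_series n (Suc m))
        + (1 - y) * (qbinom (Suc n) * ?A) - (1 + y) * (qbinom (Suc n) * (?A * u))"
  proof -
    have t: "tail_series (Suc n) k = tail_series n k + qbinom (Suc n) * X ^ (Suc k * Suc n)" for k
      by (simp only: tail_series_def sum.atLeast0_atMost_Suc)
    show ?thesis
      unfolding t e by (simp only: algebra_simps mult_1_left)
  qed
  also have "\<dots> = - (qbinom n * (1 + X ^ n) * ?A)
        + (1 - y) * (qbinom (Suc n) * ?A) - (1 + y) * (qbinom (Suc n) * (?A * u))"
    using Suc.IH by (simp only: y_def[symmetric] e)
  also have "qbinom n * (1 + X ^ n) = qbinom (Suc n) * (1 - u)"
    unfolding u_def qbinom_Suc_mult ..
  also have "- (qbinom (Suc n) * (1 - u) * ?A) + (1 - y) * (qbinom (Suc n) * ?A)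
        - (1 + y) * (qbinom (Suc n) * (?A * u))
      = - (qbinom (Suc n) * (1 + u) * (?A * y))"
  proof -
    have "- (c * (1 - u) * a) + (1 - y) * (c * a) - (1 + y) * (c * (a * u)) = - (c * (1 + u) * (a * y))"
      for a c by (simp add: algebra_simps)
    then show ?thesis .
  qed
  finally show ?case
    by (simp only: y_def[symmetric] u_def[symmetric] e)
qed

lemma tail_series_agree: "fps_agree n (tail_series n m) (qratio X m * tail_series n 0)"
proof (induction m)
  case (Suc m)
  define y where "y = X ^ Suc m"
  have y: "(1 + y) * inverse (1 + y) = 1"
    using one_plus_X_inverse[of "Suc m"] by (simp add: y_def)
  have "fps_agree n (X ^ (Suc m * Suc n) * (- (qbinom n * (1 + X ^ n)))) 0"
    by (rule fps_agree_X_power_mult_0) simp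
  then have "fps_agree n ((1 - y) * tail_series n m - (1 + y) * tail_series n (Suc m)) 0"
    unfolding y_def tail_series_Suc by (simp only: mult_minus_right mult_ac)
  then have "fps_agree n ((1 + y) * tail_series n (Suc m)) ((1 - y) * tail_series n m)"
    by (simp add: fps_agree_def)
  then have "fps_agree n (inverse (1 + y) * ((1 + y) * tail_series n (Suc m)))
      (inverse (1 + y) * ((1 - y) * tail_series n m))"
    by (rule fps_agree_cmult)
  also have "fps_agree n (inverse (1 + y) * ((1 - y) * tail_series n m))
      (inverse (1 + y) * ((1 - y) * (qratio X m * tail_series n 0)))"
    using Suc.IH by (intro fps_agree_cmult)
  also have "inverse (1 + y) * ((1 + y) * tail_series n (Suc m)) = tail_series n (Suc m)"
    by (rule cancel_inverse[OF y])
  also have "inverse (1 + y) * ((1 - y) * (qratio X m * tail_series n 0)) = qratio X (Suc m) * tail_series n 0"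
    unfolding qratio_Suc y_def by (simp only: mult_ac)
  finally show ?case .
qed simp

text \<open>The quotient of \<open>b_m\<close> by its limit is the product of
  \<open>(1 + q^i) / (1 - q^i)\<close> over \<open>i > m\<close>, which the
  \<open>q\<close>-binomial theorem expands in powers of \<open>q^(m+1)\<close>. The constant is
  fixed by the case \<open>m = n\<close>, where the truncated series is 1 up to order
  \<open>n\<close>.\<close>

lemma qratio_tail_series: "fps_agree n (qratio X m) (qratio X n * tail_series n m)"
proof -
  have "fps_agree n (tail_series n n) 1"
  proof -
    have "fps_agree n (qbinom k * X ^ (Suc n * k)) 0" if "k \<in> {1..n}" for k
    proof -
      have "Suc n * 1 \<le> Suc n * k"
        using that by (intro mult_le_mono2) simp
      then have "n < Suc n * k" by (simp only: mult_1_right Suc_le_eq)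
      then show ?thesis
        using fps_agree_X_power_mult_0[of n "Suc n * k" "qbinom k"] by (simp only: mult.commute)
    qed
    then have "fps_agree n (\<Sum>k=1..n. qbinom k * X ^ (Suc n * k)) (\<Sum>k=1..n. 0)"
      by (rule fps_agree_sum)
    then have "fps_agree n (1 + (\<Sum>k=1..n. qbinom k * X ^ (Suc n * k))) (1 + 0)"
      by (intro fps_agree_add) simp_all
    then show ?thesis
      by (simp add: tail_series_def sum.atLeast_Suc_atMost[of 0 n] del: mult_Suc)
  qed
  then have one: "fps_agree n (qratio X n * tail_series n 0) 1"
    using tail_series_agree fps_agree_sym fps_agree_trans by blast
  have "fps_agree n (qratio X n * tail_series n m) (qratio X n * (qratio X m * tail_series n 0))"
    by (intro fps_agree_cmult tail_series_agree)
  also have "qratio X n * (qratio X m * tail_series n 0) = qratio X m * (qratio X n * tail_series n 0)"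
    by (simp only: mult_ac)
  also have "fps_agree n \<dots> (qratio X m * 1)"
    by (intro fps_agree_cmult one)
  finally show ?thesis
    by (simp add: fps_agree_sym)
qed

text \<open>This uses the regularised value \<open>y - y\<^sup>2 + y\<^sup>3 - \<dots> = y / (1 + y)\<close> termwise in the \<open>q\<close>-binomial series.\<close>
lemma alternating_qratio_agree:
  "fps_agree n (1 - (\<Sum>m=1..n. (-1) ^ m * (qratio X (m - 1) - qratio X m)))
     (qratio X n * (1 + 4 * (\<Sum>k=1..n. wplus X k * inverse (qratio X k))))"
proof -
  let ?b = "qratio X n"
  \<comment> \<open>Taking differences inserts the factor \<open>1 - X^k\<close>. It kills
    \<open>k = 0\<close>, the one term whose alternating sum over \<open>m\<close> has no
    limit.\<close>
  have diff: "tail_series n (m - 1) - tail_series n m = (\<Sum>k=1..n. qbinom k * (1 - X ^ k) * (X ^ k) ^ m)"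
    if "m \<in> {1..n}" for m
  proof -
    have "tail_series n (m - 1) - tail_series n m
        = (\<Sum>k=0..n. qbinom k * X ^ (m * k) - qbinom k * X ^ (Suc m * k))"
      using that by (simp add: tail_series_def sum_subtractf)
    also have "\<dots> = (\<Sum>k=0..n. qbinom k * (1 - X ^ k) * (X ^ k) ^ m)"
      by (intro sum.cong refl) (simp add: power_add algebra_simps flip: power_mult)
    finally show ?thesis
      by (simp add: sum.atLeast_Suc_atMost[of 0 n])
  qed
  have geo: "fps_agree n (\<Sum>m=1..n. (-1) ^ m * (X ^ k) ^ m) (- (X ^ k * inverse (1 + X ^ k)))"
    if "k \<in> {1..n}" for k
  proof -
    define y where "y = X ^ k"
    have y: "(1 + y) * inverse (1 + y) = 1"
      using one_plus_X_inverse[of k] that by (simp add: y_def)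
    have g: "(1 + y) * (\<Sum>m=1..l. (-1) ^ m * y ^ m) = - y + (-1) ^ l * y ^ Suc l" for l
      by (induction l) (simp_all add: algebra_simps)
    have "inverse (1 + y) * ((1 + y) * (\<Sum>m=1..n. (-1) ^ m * y ^ m))
        = - (y * inverse (1 + y)) + y ^ Suc n * ((-1) ^ n * inverse (1 + y))"
      unfolding g by (simp add: algebra_simps)
    moreover have "inverse (1 + y) * ((1 + y) * (\<Sum>m=1..n. (-1) ^ m * y ^ m)) = (\<Sum>m=1..n. (-1) ^ m * y ^ m)"
      by (rule cancel_inverse[OF y])
    moreover have "1 * Suc n \<le> k * Suc n"
      using that by (intro mult_le_mono1) simp
    then have "fps_agree n (X ^ (k * Suc n) * ((-1) ^ n * inverse (1 + y))) 0"
      by (intro fps_agree_X_power_mult_0) (simp only: mult_1 Suc_le_eq)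
    then have "fps_agree n (- (y * inverse (1 + y)) + y ^ Suc n * ((-1) ^ n * inverse (1 + y)))
       (- (y * inverse (1 + y)) + 0)"
      unfolding y_def by (intro fps_agree_add fps_agree_refl) (simp only: power_mult)
    ultimately show ?thesis by (simp add: y_def)
  qed
  have "fps_agree n (\<Sum>m=1..n. (-1) ^ m * (qratio X (m - 1) - qratio X m))
     (\<Sum>m=1..n. (-1) ^ m * (?b * tail_series n (m - 1) - ?b * tail_series n m))"
    by (intro fps_agree_sum_cmult fps_agree_diff qratio_tail_series)
  also have "(\<Sum>m=1..n. (-1) ^ m * (?b * tail_series n (m - 1) - ?b * tail_series n m))
      = (\<Sum>m=1..n. \<Sum>k=1..n. (-1) ^ m * (?b * (qbinom k * (1 - X ^ k) * (X ^ k) ^ m)))"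
    by (intro sum.cong refl) (simp only: right_diff_distrib[symmetric] diff sum_distrib_left)
  also have "\<dots> = (\<Sum>k=1..n. \<Sum>m=1..n. (-1) ^ m * (?b * (qbinom k * (1 - X ^ k) * (X ^ k) ^ m)))"
    by (rule sum.swap)
  also have "\<dots> = (\<Sum>k=1..n. (?b * (qbinom k * (1 - X ^ k))) * (\<Sum>m=1..n. (-1) ^ m * (X ^ k) ^ m))"
    by (simp only: sum_distrib_left mult_ac)
  also have "fps_agree n \<dots>
      (\<Sum>k=1..n. (?b * (qbinom k * (1 - X ^ k))) * (- (X ^ k * inverse (1 + X ^ k))))"
    by (intro fps_agree_sum_cmult geo)
  finally have E: "fps_agree n (\<Sum>m=1..n. (-1) ^ m * (qratio X (m - 1) - qratio X m))
      (\<Sum>k=1..n. (?b * (qbinom k * (1 - X ^ k))) * (- (X ^ k * inverse (1 + X ^ k))))" .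
  have "fps_agree n 1 (?b * tail_series n 0)"
    using qratio_tail_series[of n 0] by simp
  also have "tail_series n 0 = 1 + (\<Sum>k=1..n. qbinom k * X ^ k)"
    by (simp add: tail_series_def sum.atLeast_Suc_atMost[of 0 n])
  finally have "fps_agree n (1 - (\<Sum>m=1..n. (-1) ^ m * (qratio X (m - 1) - qratio X m)))
     (?b * (1 + (\<Sum>k=1..n. qbinom k * X ^ k))
       - (\<Sum>k=1..n. (?b * (qbinom k * (1 - X ^ k))) * (- (X ^ k * inverse (1 + X ^ k)))))"
    using E by (rule fps_agree_diff)
  also have "?b * (1 + (\<Sum>k=1..n. qbinom k * X ^ k))
       - (\<Sum>k=1..n. (?b * (qbinom k * (1 - X ^ k))) * (- (X ^ k * inverse (1 + X ^ k))))
     = ?b * (1 + (\<Sum>k=1..n. qbinom k * X ^ k * (1 + (1 - X ^ k) * inverse (1 + X ^ k))))"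
  proof -
    have "?b * (1 + (\<Sum>k=1..n. qbinom k * X ^ k))
       - (\<Sum>k=1..n. (?b * (qbinom k * (1 - X ^ k))) * (- (X ^ k * inverse (1 + X ^ k))))
     = ?b + (\<Sum>k=1..n. ?b * (qbinom k * X ^ k)
         - (?b * (qbinom k * (1 - X ^ k))) * (- (X ^ k * inverse (1 + X ^ k))))"
      by (simp only: distrib_left mult_1_right sum_distrib_left sum_subtractf add_diff_eq)
    also have "(\<Sum>k=1..n. ?b * (qbinom k * X ^ k)
         - (?b * (qbinom k * (1 - X ^ k))) * (- (X ^ k * inverse (1 + X ^ k))))
      = (\<Sum>k=1..n. ?b * (qbinom k * X ^ k * (1 + (1 - X ^ k) * inverse (1 + X ^ k))))"
      by (intro sum.cong refl) (simp add: algebra_simps)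
    finally show ?thesis
      by (simp only: distrib_left mult_1_right sum_distrib_left)
  qed
  also have "(\<Sum>k=1..n. qbinom k * X ^ k * (1 + (1 - X ^ k) * inverse (1 + X ^ k)))
     = (\<Sum>k=1..n. 4 * (wplus X k * inverse (qratio X k)))"
  proof (intro sum.cong refl)
    fix k assume "k \<in> {1..n}"
    \<comment> \<open>By \<open>qbinom_qratio\<close>, \<open>D\<close> is
      \<open>2 / ((1 + y) * qratio X k)\<close>, and
      \<open>1 + (1 - y) / (1 + y) = 2 / (1 + y)\<close>; the product with \<open>y\<close> is
      \<open>4 y / ((1 + y)^2 * qratio X k)\<close>.\<close>
    define y i D where "y = X ^ k" and "i = inverse (1 + y)" and "D = qbinom k"
    have y: "(1 + y) * i = 1"
      using one_plus_X_inverse[of k] \<open>k \<in> {1..n}\<close> by (simp add: y_def i_def)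
    have w: "wplus X k = y * i * i"
      by (simp add: wplus_def y_def i_def power2_eq_square fps_inverse_mult)
    have D: "D * (1 + y) * qratio X k = 2"
      using qbinom_qratio[of k] \<open>k \<in> {1..n}\<close> by (simp add: y_def D_def)
    have b: "qratio X k * inverse (qratio X k) = 1"
      by (rule inverse_mult_eq_1') (simp add: qratio_nth_0)
    have "1 + (1 - y) * i = (1 + y) * i + (1 - y) * i"
      using y by simp
    also have "\<dots> = 2 * i"
      by (simp add: algebra_simps)
    finally have "D * y * (1 + (1 - y) * i) = 2 * (D * y * i)"
      by simp
    also have "\<dots> = 2 * (D * y * i) * ((1 + y) * i) * (qratio X k * inverse (qratio X k))"
      by (simp only: y b mult_1_right)
    also have "\<dots> = (D * (1 + y) * qratio X k) * (2 * (y * i * i * inverse (qratio X k)))"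
      by (simp only: mult_ac)
    also have "\<dots> = 4 * (wplus X k * inverse (qratio X k))"
      unfolding D w by simp
    finally show "qbinom k * X ^ k * (1 + (1 - X ^ k) * inverse (1 + X ^ k)) = 4 * (wplus X k * inverse (qratio X k))"
      by (simp only: y_def i_def D_def)
  qed
  finally show ?thesis
    by (simp only: sum_distrib_left)
qed

section \<open>Generating functions of overpartitions\<close>

text \<open>The factor that the part size \<open>i\<close> contributes to a generating function when
  multiplicity \<open>k\<close> carries the weight \<open>h k\<close>.\<close>

definition spread :: "nat \<Rightarrow> (nat \<Rightarrow> 'a) \<Rightarrow> 'a::comm_ring_1 fps" where
  "spread i h = Abs_fps (\<lambda>n. if i dvd n then h (n div i) else 0)"

lemma spread_nth: "fps_nth (spread i h) n = (if i dvd n then h (n div i) else 0)"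
  by (simp add: spread_def)

text \<open>Multiplication by a linear factor takes a first-order difference of the weights. Closed
  forms of \<open>spread\<close> are therefore proved by clearing denominators and comparing
  weights.\<close>

lemma spread_mult_linear:
  assumes "0 < i"
  shows "spread i h * (1 - fps_const c * fps_X ^ i)
       = spread i (\<lambda>k. h k - (case k of 0 \<Rightarrow> 0 | Suc l \<Rightarrow> c * h l))"
proof (rule fps_ext)
  fix n
  have "fps_nth (spread i h * (1 - fps_const c * fps_X ^ i)) n
      = fps_nth (spread i h) n - c * fps_nth (fps_X ^ i * spread i h) n"
  proof -
    have "spread i h * (1 - fps_const c * fps_X ^ i) = spread i h - fps_const c * (fps_X ^ i * spread i h)"
      by (simp only: right_diff_distrib mult_1_left mult_1_right mult_ac)
    then show ?thesis by simp
  qed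
  also have "\<dots> = fps_nth (spread i h) n - c * (if n < i then 0 else fps_nth (spread i h) (n - i))"
    by (simp add: fps_X_power_mult_nth)
  also have "\<dots> = fps_nth (spread i (\<lambda>k. h k - (case k of 0 \<Rightarrow> 0 | Suc l \<Rightarrow> c * h l))) n"
  proof (cases "i dvd n")
    case True
    then obtain k where "n = i * k" by blast
    then show ?thesis
      using assms by (cases k) (simp_all add: spread_nth)
  next
    case False
    then show ?thesis
      using dvd_diffD[of i n i] by (auto simp: spread_nth)
  qed
  finally show "fps_nth (spread i h * (1 - fps_const c * fps_X ^ i)) n
      = fps_nth (spread i (\<lambda>k. h k - (case k of 0 \<Rightarrow> 0 | Suc l \<Rightarrow> c * h l))) n" .
qed

lemma spread_1: "0 < i \<Longrightarrow> spread i (\<lambda>k. if k = 1 then 1 else 0) = fps_X ^ i"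
proof (rule fps_ext)
  fix n
  assume i: "0 < i"
  show "fps_nth (spread i (\<lambda>k. if k = 1 then 1 else 0)) n = fps_nth (fps_X ^ i) n"
  proof (cases "i dvd n")
    case True
    then obtain k where "n = i * k" by blast
    then show ?thesis
      using i by (auto simp: spread_nth fps_X_power_nth)
  next
    case False
    then have "n \<noteq> i" by auto
    with False show ?thesis by (simp add: spread_nth fps_X_power_nth)
  qed
qed

lemma spread_0_1:
  "0 < i \<Longrightarrow> spread i (\<lambda>k. if k = 0 then 1 else if k = 1 then c else 0) = 1 + fps_const c * fps_X ^ i"
proof (rule fps_ext)
  fix n
  assume i: "0 < i"
  show "fps_nth (spread i (\<lambda>k. if k = 0 then 1 else if k = 1 then c else 0)) n
      = fps_nth (1 + fps_const c * fps_X ^ i) n"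
  proof (cases "i dvd n")
    case True
    then obtain k where "n = i * k" by blast
    then show ?thesis
      using i by (auto simp: spread_nth fps_X_power_nth)
  next
    case False
    then have "n \<noteq> 0" "n \<noteq> i" by (metis dvd_0_right, metis dvd_refl)
    with False show ?thesis by (simp add: spread_nth fps_X_power_nth)
  qed
qed

lemma wminus_eq_spread: "0 < i \<Longrightarrow> wminus X i = spread i of_nat"
  and wplus_eq_spread: "0 < i \<Longrightarrow> wplus X i = spread i (\<lambda>k. (-1) ^ (k - 1) * of_nat k)"
proof -
  assume i: "0 < i"
  have *: "f * (g * g) = x \<Longrightarrow> fps_nth g 0 = 1 \<Longrightarrow> x * inverse (g\<^sup>2) = f" for f g x :: "rat fps"
  proof -
    assume "f * (g * g) = x" "fps_nth g 0 = 1"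
    then have "x * inverse (g\<^sup>2) = f * (g\<^sup>2 * inverse (g\<^sup>2))"
      unfolding \<open>f * (g * g) = x\<close>[symmetric] power2_eq_square by (simp only: mult.assoc)
    also have "g\<^sup>2 * inverse (g\<^sup>2) = 1"
      using \<open>fps_nth g 0 = 1\<close> by (intro inverse_mult_eq_1') (simp add: fps_power_zeroth)
    finally show ?thesis by simp
  qed
  show "wminus X i = spread i of_nat"
    unfolding wminus_def
  proof (rule *)
    have "spread i of_nat * (1 - X ^ i) * (1 - X ^ i)
        = spread i (\<lambda>k. if k = 1 then 1 else 0)"
      unfolding spread_mult_linear[OF i, where c = "1::rat", simplified]
      by (intro arg_cong[of _ _ "spread i"] ext) (auto split: nat.split)
    then show "spread i of_nat * ((1 - X ^ i) * (1 - X ^ i)) = X ^ i"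
      by (simp only: spread_1[OF i] mult.assoc)
  qed (use i in \<open>simp add: fps_power_zeroth zero_power\<close>)
  show "wplus X i = spread i (\<lambda>k. (-1) ^ (k - 1) * of_nat k)"
    unfolding wplus_def
  proof (rule *)
    have minus: "1 + X ^ i = 1 - fps_const (-1) * X ^ i"
      by (simp flip: fps_const_neg)
    have sgn: "of_nat k * (-1) ^ (k - Suc 0) = - (of_nat k * (-1) ^ k :: rat)" for k
      by (cases k) auto
    have "spread i (\<lambda>k. (-1) ^ (k - 1) * of_nat k) * (1 + X ^ i) * (1 + X ^ i)
        = spread i (\<lambda>k. if k = 1 then 1 else 0)"
      unfolding minus spread_mult_linear[OF i]
      by (intro arg_cong[of _ _ "spread i"] ext) (auto simp: sgn algebra_simps split: nat.split)
    then show "spread i (\<lambda>k. (-1) ^ (k - 1) * of_nat k) * ((1 + X ^ i) * (1 + X ^ i)) = X ^ i"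
      by (simp only: spread_1[OF i] mult.assoc)
  qed (use i in \<open>simp add: fps_power_zeroth zero_power\<close>)
qed

text \<open>The weight 2 for positive multiplicity is the choice whether to overline, and
  \<open>c\<close> marks the number of parts: \<open>c = -1\<close> serves the rank,
  \<open>c = 1\<close> the spt function.\<close>

lemma spread_overline:
  assumes "0 < i"
  shows "spread i (\<lambda>k. if k = 0 then 1 else 2 * c ^ k)
       = (1 + fps_const c * X ^ i) * inverse (1 - fps_const c * X ^ i)"
proof -
  let ?g = "1 - fps_const c * X ^ i"
  have "spread i (\<lambda>k. if k = 0 then 1 else 2 * c ^ k) * ?g
      = spread i (\<lambda>k. if k = 0 then 1 else if k = 1 then c else 0)"
    unfolding spread_mult_linear[OF assms]
    by (intro arg_cong[of _ _ "spread i"]) (auto split: nat.split)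
  also have "\<dots> = 1 + fps_const c * X ^ i"
    by (rule spread_0_1[OF assms])
  finally have *: "spread i (\<lambda>k. if k = 0 then 1 else 2 * c ^ k) * ?g = 1 + fps_const c * X ^ i" .
  have "?g * inverse ?g = 1"
    using assms by (intro inverse_mult_eq_1') (simp add: fps_power_zeroth zero_power)
  then show ?thesis
    unfolding *[symmetric] by (simp only: mult.assoc mult_1_right)
qed

section \<open>Generating functions as products over part sizes\<close>

definition partitions_into :: "nat set \<Rightarrow> nat \<Rightarrow> nat multiset set" where
  "partitions_into I n = {M. set_mset M \<subseteq> I \<and> sum_mset M = n}"

text \<open>The component \<open>l\<close> is the total size of the copies of \<open>i\<close>, not
  their number, so that it matches the index of the Cauchy product.\<close>

lemma partitions_into_insert:
  fixes i n :: nat and I :: "nat set"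
  assumes "0 < i" "i \<notin> I"
  defines "S \<equiv> SIGMA l:{l\<in>{0..n}. i dvd l}. partitions_into I (n - l)"
  shows "bij_betw (\<lambda>(l, M). M + replicate_mset (l div i) i) S (partitions_into (insert i I) n)"
proof (rule bij_betw_byWitness[where f' = "\<lambda>M. (i * count M i, filter_mset (\<lambda>x. x \<noteq> i) M)"])
  have filter: "filter_mset (\<lambda>x. x \<noteq> i) M = M" if "set_mset M \<subseteq> I" for M
    using that assms(2) by (auto simp: filter_mset_eq_conv)
  have split: "M = filter_mset (\<lambda>x. x \<noteq> i) M + replicate_mset (count M i) i" for M
    by (rule multiset_eqI) auto
  show "\<forall>a\<in>S. (\<lambda>M. (i * count M i, filter_mset (\<lambda>x. x \<noteq> i) M))
      ((\<lambda>(l, M). M + replicate_mset (l div i) i) a) = a"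
  proof
    fix a assume "a \<in> S"
    obtain l M where a: "a = (l, M)" by fastforce
    with \<open>a \<in> S\<close> have "i dvd l" and M: "set_mset M \<subseteq> I"
      by (auto simp: S_def partitions_into_def)
    moreover have "count M i = 0"
      using M assms(2) by (auto simp: not_in_iff[symmetric])
    moreover have "filter_mset (\<lambda>x. x \<noteq> i) (replicate_mset k i) = {#}" for k
      by (induction k) auto
    ultimately show "(\<lambda>M. (i * count M i, filter_mset (\<lambda>x. x \<noteq> i) M))
        ((\<lambda>(l, M). M + replicate_mset (l div i) i) a) = a"
      using filter by (simp add: a)
  qed
  show "\<forall>M\<in>partitions_into (insert i I) n.
      (\<lambda>(l, M). M + replicate_mset (l div i) i) (i * count M i, filter_mset (\<lambda>x. x \<noteq> i) M) = M"
    using assms(1) split by simp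
  show "(\<lambda>(l, M). M + replicate_mset (l div i) i) ` S \<subseteq> partitions_into (insert i I) n"
    by (auto simp: S_def partitions_into_def split: if_splits)
  show "(\<lambda>M. (i * count M i, filter_mset (\<lambda>x. x \<noteq> i) M)) ` partitions_into (insert i I) n \<subseteq> S"
  proof clarify
    fix M assume M: "M \<in> partitions_into (insert i I) n"
    have "sum_mset M = sum_mset (filter_mset (\<lambda>x. x \<noteq> i) M) + i * count M i"
      by (subst split) (simp add: mult.commute)
    then show "(i * count M i, filter_mset (\<lambda>x. x \<noteq> i) M) \<in> S"
      using M by (auto simp: S_def partitions_into_def)
  qed
qed

lemma finite_partitions_into: "finite I \<Longrightarrow> 0 \<notin> I \<Longrightarrow> finite (partitions_into I n)"
proof (induction I arbitrary: n rule: finite_induct)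
  case empty
  then show ?case
    by (auto simp: partitions_into_def intro: finite_subset[of _ "{{#}}"])
next
  case (insert i I)
  have "finite (SIGMA l:{l\<in>{0..n}. i dvd l}. partitions_into I (n - l))"
    using insert by (intro finite_SigmaI) auto
  then show ?case
    using partitions_into_insert[of i I n] insert bij_betw_finite by blast
qed

lemma prod_spread_nth:
  fixes h :: "nat \<Rightarrow> nat \<Rightarrow> 'a::comm_ring_1"
  assumes "finite I" "0 \<notin> I"
  shows "fps_nth (\<Prod>i\<in>I. spread i (h i)) n = (\<Sum>M\<in>partitions_into I n. \<Prod>i\<in>I. h i (count M i))"
  using assms
proof (induction I arbitrary: n rule: finite_induct)
  case empty
  have "partitions_into {} n = (if n = 0 then {{#}} else {})"
    by (auto simp: partitions_into_def)
  then show ?case by simp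
next
  case (insert i I)
  then have i: "0 < i" by auto
  let ?S = "SIGMA l:{l\<in>{0..n}. i dvd l}. partitions_into I (n - l)"
  have "fps_nth (\<Prod>i\<in>insert i I. spread i (h i)) n
      = (\<Sum>l=0..n. fps_nth (spread i (h i)) l * (\<Sum>M\<in>partitions_into I (n - l). \<Prod>i\<in>I. h i (count M i)))"
    using insert by (simp add: fps_mult_nth)
  also have "\<dots> = (\<Sum>l\<in>{l\<in>{0..n}. i dvd l}. h i (l div i) * (\<Sum>M\<in>partitions_into I (n - l). \<Prod>i\<in>I. h i (count M i)))"
    by (intro sum.mono_neutral_cong_right) (auto simp: spread_nth)
  also have "\<dots> = (\<Sum>(l, M)\<in>?S. h i (l div i) * (\<Prod>i\<in>I. h i (count M i)))"
    using insert by (subst sum.Sigma[symmetric]) (auto simp: sum_distrib_left finite_partitions_into)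
  also have "\<dots> = (\<Sum>M\<in>partitions_into (insert i I) n. \<Prod>i\<in>insert i I. h i (count M i))"
  proof (subst sum.reindex_bij_betw[OF partitions_into_insert[OF i insert(2)], symmetric])
    show "(\<Sum>(l, M)\<in>?S. h i (l div i) * (\<Prod>i\<in>I. h i (count M i)))
       = (\<Sum>x\<in>?S. \<Prod>j\<in>insert i I. h j (count ((\<lambda>(l, M). M + replicate_mset (l div i) i) x) j))"
    proof (intro sum.cong refl, clarify)
      fix l M assume M: "M \<in> partitions_into I (n - l)"
      then have "count M i = 0"
        using insert(2) by (auto simp: partitions_into_def not_in_iff[symmetric])
      moreover have "(\<Prod>j\<in>I. h j (count (M + replicate_mset (l div i) i) j)) = (\<Prod>j\<in>I. h j (count M j))"
        using insert(2) by (intro prod.cong refl) auto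
      ultimately show "h i (l div i) * (\<Prod>i\<in>I. h i (count M i))
        = (\<Prod>j\<in>insert i I. h j (count (M + replicate_mset (l div i) i) j))"
        using insert(1,2) by simp
    qed
  qed
  finally show ?case .
qed

lemma sum_overpartitions:
  fixes f :: "nat multiset \<Rightarrow> int"
  assumes "n \<le> N"
  shows "(\<Sum>p\<in>overpartitions n. f (fst p)) = (\<Sum>M\<in>partitions_into {1..N} n. 2 ^ card (set_mset M) * f M)"
proof -
  have "overpartitions n = (SIGMA M:partitions_into {1..N} n. Pow (set_mset M))"
    using assms by (force simp: overpartitions_def partitions_into_def dest: sum_mset.remove)
  then have "(\<Sum>p\<in>overpartitions n. f (fst p)) = (\<Sum>M\<in>partitions_into {1..N} n. \<Sum>S\<in>Pow (set_mset M). f M)"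
    by (subst sum.Sigma) (auto simp: finite_partitions_into case_prod_unfold)
  then show ?thesis
    by (simp add: card_Pow)
qed

lemma finite_overpartitions: "finite (overpartitions n)"
proof (rule finite_subset)
  show "overpartitions n \<subseteq> (SIGMA M:partitions_into {1..n} n. Pow (set_mset M))"
    by (force simp: overpartitions_def partitions_into_def dest: sum_mset.remove)
qed (auto simp: finite_partitions_into)


lemma card_diff_eq_sum:
  "finite S \<Longrightarrow> int (card {p\<in>S. P p}) - int (card {p\<in>S. \<not> P p}) = (\<Sum>p\<in>S. if P p then 1 else -1)"
  by (simp add: sum.If_cases Int_def)

lemma prod_count:
  fixes a :: "'a::comm_ring_1"
  assumes "finite I" "set_mset M \<subseteq> I"
  shows "(\<Prod>i\<in>I. if count M i = 0 then 1 else a * c ^ count M i) = a ^ card (set_mset M) * c ^ size M"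
proof -
  have "(\<Prod>i\<in>I. if count M i = 0 then 1 else a * c ^ count M i)
      = (\<Prod>i\<in>set_mset M. a * c ^ count M i)"
    using assms by (intro prod.mono_neutral_cong_right) (auto simp: count_eq_zero_iff)
  also have "\<dots> = a ^ card (set_mset M) * c ^ (\<Sum>i\<in>set_mset M. count M i)"
    by (simp add: prod.distrib power_sum)
  finally show ?thesis by (simp add: size_multiset_overloaded_eq)
qed

lemma partitions_into_Max:
  assumes "1 \<le> n" "m \<in> {1..N}"
  shows "{M \<in> partitions_into {1..N} n. Max (set_mset M) = m} = {M \<in> partitions_into {1..m} n. m \<in># M}"
proof -
  have "M \<noteq> {#}" if "sum_mset M = n" for M using that assms(1) by auto
  then have "Max (set_mset M) = m \<longleftrightarrow> m \<in># M \<and> (\<forall>x\<in>#M. x \<le> m)" if "sum_mset M = n" for M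
    using that by (subst Max_eq_iff) auto
  then show ?thesis
    using assms(2) by (auto simp: partitions_into_def subset_iff)
qed

lemma partitions_into_Min:
  assumes "1 \<le> n" "m \<in> {1..N}"
  shows "{M \<in> partitions_into {1..N} n. Min (set_mset M) = m} = {M \<in> partitions_into {m..N} n. m \<in># M}"
proof -
  have "M \<noteq> {#}" if "sum_mset M = n" for M using that assms(1) by auto
  then have "Min (set_mset M) = m \<longleftrightarrow> m \<in># M \<and> (\<forall>x\<in>#M. m \<le> x)" if "sum_mset M = n" for M
    using that by (subst Min_eq_iff) auto
  then show ?thesis
    using assms(2) by (auto simp: partitions_into_def subset_iff)
qed

lemma Max_Min_in_interval:
  assumes "1 \<le> n" "M \<in> partitions_into {1..N} n"
  shows "Max (set_mset M) \<in> {1..N}" "Min (set_mset M) \<in> {1..N}"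
proof -
  have "M \<noteq> {#}" using assms by (auto simp: partitions_into_def)
  then have "Max (set_mset M) \<in> set_mset M" "Min (set_mset M) \<in> set_mset M"
    by simp_all
  then show "Max (set_mset M) \<in> {1..N}" "Min (set_mset M) \<in> {1..N}"
    using assms(2) by (auto simp: partitions_into_def)
qed

text \<open>The parity of the rank splits into that of the largest part \<open>m\<close> and that of
  the number of parts. The sign of the latter makes the factor of each part size
  \<open>(1 - q^i) / (1 + q^i)\<close>. Forcing \<open>m\<close> to occur subtracts 1 from its
  factor, and the product becomes \<open>qratio X m - qratio X (m - 1)\<close>.\<close>

lemma alphabar_eq:
  assumes n: "1 \<le> n" "n \<le> N"
  shows "rat_of_int (alphabar n) = fps_nth (- (\<Sum>m=1..N. (-1) ^ m * (qratio X (m - 1) - qratio X m))) n"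
proof -
  define g :: "nat multiset \<Rightarrow> int" where
    "g M = 2 ^ card (set_mset M) * (-1) ^ (Max (set_mset M) + size M)" for M
  have "alphabar n = (\<Sum>p\<in>overpartitions n. if even (ovrank p) then 1 else -1)"
    unfolding alphabar_def by (rule card_diff_eq_sum[OF finite_overpartitions])
  also have "\<dots> = (\<Sum>p\<in>overpartitions n. (-1) ^ (Max (set_mset (fst p)) + size (fst p)))"
    by (intro sum.cong refl) (auto simp: ovrank_def largest_part_def)
  also have "\<dots> = (\<Sum>M\<in>partitions_into {1..N} n. g M)"
    unfolding g_def by (rule sum_overpartitions[OF n(2)])
  also have "\<dots> = (\<Sum>m\<in>{1..N}. \<Sum>M\<in>{M\<in>partitions_into {1..N} n. Max (set_mset M) = m}. g M)"
    using Max_Min_in_interval[OF n(1)] by (intro sum.group[symmetric]) (auto simp: finite_partitions_into)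
  also have "\<dots> = (\<Sum>m\<in>{1..N}. \<Sum>M\<in>{M \<in> partitions_into {1..m} n. m \<in># M}. g M)"
    by (intro sum.cong refl partitions_into_Max n(1))
  finally have "rat_of_int (alphabar n)
      = (\<Sum>m\<in>{1..N}. \<Sum>M\<in>{M \<in> partitions_into {1..m} n. m \<in># M}. rat_of_int (g M))"
    by simp
  also have "\<dots> = (\<Sum>m\<in>{1..N}. fps_nth ((-1) ^ m * (qratio X m - qratio X (m - 1))) n)"
  proof (intro sum.cong refl)
    fix m assume m: "m \<in> {1..N}"
    \<comment> \<open>The value 0 at multiplicity zero of \<open>m\<close> encodes that
      \<open>m\<close> occurs, so the sum may run over all partitions into parts up to
      \<open>m\<close>.\<close>
    define h :: "nat \<Rightarrow> nat \<Rightarrow> rat" where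
      "h i k = (if k = 0 then (if i = m then 0 else 1) else 2 * (-1) ^ k)" for i k
    have "(\<Sum>M\<in>{M \<in> partitions_into {1..m} n. m \<in># M}. rat_of_int (g M))
        = (-1) ^ m * (\<Sum>M\<in>{M \<in> partitions_into {1..m} n. m \<in># M}. \<Prod>i\<in>{1..m}. h i (count M i))"
      unfolding sum_distrib_left
    proof (intro sum.cong refl)
      fix M assume M: "M \<in> {M \<in> partitions_into {1..m} n. m \<in># M}"
      then have "Max (set_mset M) = m"
        by (intro Max_eqI) (auto simp: partitions_into_def)
      moreover have "(\<Prod>i\<in>{1..m}. h i (count M i)) = (\<Prod>i\<in>{1..m}. if count M i = 0 then 1 else 2 * (-1) ^ count M i)"
        using M by (intro prod.cong refl) (auto simp: h_def count_eq_zero_iff)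
      moreover have "\<dots> = 2 ^ card (set_mset M) * (-1) ^ size M"
        using M by (intro prod_count) (auto simp: partitions_into_def)
      ultimately show "rat_of_int (g M) = (-1) ^ m * (\<Prod>i\<in>{1..m}. h i (count M i))"
        by (simp add: g_def power_add)
    qed
    also have "(\<Sum>M\<in>{M \<in> partitions_into {1..m} n. m \<in># M}. \<Prod>i\<in>{1..m}. h i (count M i))
        = (\<Sum>M\<in>partitions_into {1..m} n. \<Prod>i\<in>{1..m}. h i (count M i))"
    proof (intro sum.mono_neutral_left ballI)
      fix M assume "M \<in> partitions_into {1..m} n - {M \<in> partitions_into {1..m} n. m \<in># M}"
      then have "h m (count M m) = 0"
        by (auto simp: h_def count_eq_zero_iff)
      then show "(\<Prod>i\<in>{1..m}. h i (count M i)) = 0"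
        using m by (intro prod_zero) auto
    qed (auto simp: finite_partitions_into)
    also have "\<dots> = fps_nth (\<Prod>i\<in>{1..m}. spread i (h i)) n"
      by (rule prod_spread_nth[symmetric]) auto
    also have "(\<Prod>i\<in>{1..m}. spread i (h i)) = qratio X m - qratio X (m - 1)"
    proof -
      obtain l where l: "m = Suc l" using m by (cases m) auto
      have *: "spread i (h i) = (1 - X ^ i) * inverse (1 + X ^ i)" if "i \<in> {1..l}" for i
      proof -
        have "h i = (\<lambda>k. if k = 0 then 1 else 2 * (-1) ^ k)"
          using that by (intro ext) (simp add: h_def l)
        then show ?thesis
          using that spread_overline[of i "-1"] by (simp flip: fps_const_neg)
      qed
      have "spread m (h m) = (1 - X ^ m) * inverse (1 + X ^ m) - 1"
      proof -
        have "spread m (h m) = spread m (\<lambda>k. if k = 0 then 1 else 2 * (-1) ^ k) - 1"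
        proof (rule fps_ext)
          fix k
          show "fps_nth (spread m (h m)) k
              = fps_nth (spread m (\<lambda>k. if k = 0 then 1 else 2 * (-1) ^ k) - 1) k"
          proof (cases "m dvd k")
            case True
            then obtain c where "k = m * c" by blast
            then show ?thesis
              using m by (cases "c = 0") (simp_all add: spread_nth h_def)
          next
            case False
            then show ?thesis by (cases "k = 0") (simp_all add: spread_nth)
          qed
        qed
        also have "spread m (\<lambda>k. if k = 0 then 1 else 2 * (-1) ^ k) = (1 - X ^ m) * inverse (1 + X ^ m)"
          using m spread_overline[of m "-1"] by (simp flip: fps_const_neg)
        finally show ?thesis .
      qed
      moreover have "(\<Prod>i\<in>{1..l}. spread i (h i)) = qratio X l"
        unfolding qratio_def by (intro prod.cong refl *)
      moreover have "(\<Prod>i\<in>{1..m}. spread i (h i)) = (\<Prod>i\<in>{1..l}. spread i (h i)) * spread m (h m)"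
        by (simp add: l)
      ultimately have "(\<Prod>i\<in>{1..m}. spread i (h i)) = qratio X l * ((1 - X ^ m) * inverse (1 + X ^ m) - 1)"
        by (simp only:)
      also have "\<dots> = qratio X m - qratio X (m - 1)"
        by (simp only: l qratio_Suc right_diff_distrib mult_1_right diff_Suc_1)
      finally show ?thesis .
    qed
    finally show "(\<Sum>M\<in>{M \<in> partitions_into {1..m} n. m \<in># M}. rat_of_int (g M))
        = fps_nth ((-1) ^ m * (qratio X m - qratio X (m - 1))) n"
      by (cases "even m") simp_all
  qed
  also have "\<dots> = fps_nth (\<Sum>m=1..N. (-1) ^ m * (qratio X m - qratio X (m - 1))) n"
    by (simp only: fps_sum_nth)
  also have "(\<Sum>m=1..N. (-1) ^ m * (qratio X m - qratio X (m - 1)))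
      = - (\<Sum>m=1..N. (-1) ^ m * (qratio X (m - 1) - qratio X m))"
    by (simp only: sum_negf[symmetric] minus_mult_right minus_diff_eq)
  finally show ?thesis .
qed

text \<open>The smallest part \<open>m\<close> carries the weight \<open>2 * k\<close>: 2 for the
  overlining, \<open>k\<close> for the occurrences counted. It vanishes at \<open>k = 0\<close>, so
  \<open>m\<close> is forced to occur, and its series is \<open>2 * wminus X m\<close>.\<close>

lemma spt1bar_eq:
  assumes n: "n \<le> N"
  shows "rat_of_int (spt1bar n)
    = fps_nth (\<Sum>m\<in>{m\<in>{1..N}. odd m}. 2 * wminus X m * (\<Prod>i\<in>{m<..N}. (1 + X ^ i) * inverse (1 - X ^ i))) n"
proof (cases "n = 0")
  case True
  have "fps_nth (wminus X m) 0 = 0" if "odd m" for m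
    using that by (simp add: wminus_def fps_power_zeroth odd_pos)
  then have "fps_nth (\<Sum>m\<in>{m\<in>{1..N}. odd m}. 2 * wminus X m *
      (\<Prod>i\<in>{m<..N}. (1 + X ^ i) * inverse (1 - X ^ i))) 0 = 0"
    by (simp add: fps_sum_nth)
  \<comment> \<open>Whether the empty overpartition is selected depends on the unspecified
    \<open>Min {}\<close>, but its count is 0 in either case.\<close>
  moreover have "fst p = {#}" if "p \<in> overpartitions 0" for p
    using that by (cases "fst p") (auto simp: overpartitions_def)
  then have "spt1bar 0 = 0"
    unfolding spt1bar_def by (intro sum.neutral) auto
  ultimately show ?thesis
    by (simp only: True of_int_0)
next
  case False
  then have n1: "1 \<le> n" by simp
  define g :: "nat multiset \<Rightarrow> int" where
    "g M = 2 ^ card (set_mset M) * (if odd (Min (set_mset M)) then int (count M (Min (set_mset M))) else 0)" for M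
  have "spt1bar n = (\<Sum>p\<in>overpartitions n. if odd (Min (set_mset (fst p))) then
      int (count (fst p) (Min (set_mset (fst p)))) else 0)"
    unfolding spt1bar_def smallest_part_def
    by (intro sum.mono_neutral_cong_left) (auto simp: finite_overpartitions)
  also have "\<dots> = (\<Sum>M\<in>partitions_into {1..N} n. g M)"
    unfolding g_def by (rule sum_overpartitions[OF n])
  also have "\<dots> = (\<Sum>m\<in>{1..N}. \<Sum>M\<in>{M\<in>partitions_into {1..N} n. Min (set_mset M) = m}. g M)"
    using Max_Min_in_interval[OF n1] by (intro sum.group[symmetric]) (auto simp: finite_partitions_into)
  also have "\<dots> = (\<Sum>m\<in>{1..N}. \<Sum>M\<in>{M \<in> partitions_into {m..N} n. m \<in># M}. g M)"
    by (intro sum.cong refl partitions_into_Min n1)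
  also have "\<dots> = (\<Sum>m\<in>{m\<in>{1..N}. odd m}. \<Sum>M\<in>{M \<in> partitions_into {m..N} n. m \<in># M}. g M)"
  proof (intro sum.mono_neutral_right ballI)
    fix m assume "m \<in> {1..N} - {m\<in>{1..N}. odd m}"
    moreover have "Min (set_mset M) = m" if "M \<in> {M \<in> partitions_into {m..N} n. m \<in># M}" for M
      using that by (intro Min_eqI) (auto simp: partitions_into_def)
    ultimately show "(\<Sum>M\<in>{M \<in> partitions_into {m..N} n. m \<in># M}. g M) = 0"
      by (intro sum.neutral) (auto simp: g_def)
  qed auto
  finally have "rat_of_int (spt1bar n)
      = (\<Sum>m\<in>{m\<in>{1..N}. odd m}. \<Sum>M\<in>{M \<in> partitions_into {m..N} n. m \<in># M}. rat_of_int (g M))"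
    by simp
  also have "\<dots> = (\<Sum>m\<in>{m\<in>{1..N}. odd m}.
      fps_nth (2 * wminus X m * (\<Prod>i\<in>{m<..N}. (1 + X ^ i) * inverse (1 - X ^ i))) n)"
  proof (intro sum.cong refl)
    fix m assume "m \<in> {m\<in>{1..N}. odd m}"
    then have m: "m \<in> {1..N}" "odd m" by auto
    define h :: "nat \<Rightarrow> nat \<Rightarrow> rat" where
      "h i k = (if i = m then 2 * of_nat k else if k = 0 then 1 else 2)" for i k
    have "(\<Sum>M\<in>{M \<in> partitions_into {m..N} n. m \<in># M}. rat_of_int (g M))
        = (\<Sum>M\<in>{M \<in> partitions_into {m..N} n. m \<in># M}. \<Prod>i\<in>{m..N}. h i (count M i))"
    proof (intro sum.cong refl)
      fix M assume M: "M \<in> {M \<in> partitions_into {m..N} n. m \<in># M}"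
      then have "Min (set_mset M) = m"
        by (intro Min_eqI) (auto simp: partitions_into_def)
      then have "rat_of_int (g M) = of_nat (count M m) * 2 ^ card (set_mset M)"
        using m by (simp add: g_def)
      also have "2 ^ card (set_mset M) = (\<Prod>i\<in>{m..N}. if count M i = 0 then 1 else 2 * 1 ^ count M i :: rat)"
        using M by (subst prod_count) (auto simp: partitions_into_def)
      also have "of_nat (count M m) * \<dots> = (\<Prod>i\<in>{m..N}. h i (count M i))"
        using M m by (simp add: prod.remove[of "{m..N}" m] h_def cong: if_cong)
      finally show "rat_of_int (g M) = (\<Prod>i\<in>{m..N}. h i (count M i))" .
    qed
    also have "\<dots> = (\<Sum>M\<in>partitions_into {m..N} n. \<Prod>i\<in>{m..N}. h i (count M i))"
    proof (intro sum.mono_neutral_left ballI)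
      fix M assume "M \<in> partitions_into {m..N} n - {M \<in> partitions_into {m..N} n. m \<in># M}"
      then have "h m (count M m) = 0"
        by (auto simp: h_def count_eq_zero_iff)
      then show "(\<Prod>i\<in>{m..N}. h i (count M i)) = 0"
        using m by (intro prod_zero) auto
    qed (use m in \<open>auto simp: finite_partitions_into\<close>)
    also have "\<dots> = fps_nth (\<Prod>i\<in>{m..N}. spread i (h i)) n"
      using m by (intro prod_spread_nth[symmetric]) auto
    also have "(\<Prod>i\<in>{m..N}. spread i (h i))
        = 2 * wminus X m * (\<Prod>i\<in>{m<..N}. (1 + X ^ i) * inverse (1 - X ^ i))"
    proof -
      have "spread i (h i) = (1 + X ^ i) * inverse (1 - X ^ i)" if "i \<in> {m<..N}" for i
      proof -
        have "h i = (\<lambda>k. if k = 0 then 1 else 2 * 1 ^ k)"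
          using that by (intro ext) (simp add: h_def)
        then show ?thesis
          using that spread_overline[of i 1] by simp
      qed
      moreover have "spread m (h m) = 2 * wminus X m"
      proof -
        have "spread m (h m) = fps_const 2 * spread m of_nat"
          by (simp add: fps_eq_iff spread_nth h_def fps_mult_left_const_nth)
        then show ?thesis
          using m by (simp add: wminus_eq_spread numeral_fps_const)
      qed
      moreover have "{m..N} = insert m {m<..N}" using m by auto
      ultimately show ?thesis by simp
    qed
    finally show "(\<Sum>M\<in>{M \<in> partitions_into {m..N} n. m \<in># M}. rat_of_int (g M))
      = fps_nth (2 * wminus X m * (\<Prod>i\<in>{m<..N}. (1 + X ^ i) * inverse (1 - X ^ i))) n" .
  qed
  finally show ?thesis by (simp add: fps_sum_nth)
qed

lemma qratio_tail:
  assumes "m \<le> N"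
  shows "qratio X N * (\<Prod>i\<in>{m<..N}. (1 + X ^ i) * inverse (1 - X ^ i)) = qratio X m"
proof -
  have "{1..N} = {1..m} \<union> {m<..N}" using assms by auto
  then have "qratio X N = qratio X m * (\<Prod>i\<in>{m<..N}. (1 - X ^ i) * inverse (1 + X ^ i))"
    unfolding qratio_def by (simp add: prod.union_disjoint ivl_disj_int)
  moreover have "(\<Prod>i\<in>{m<..N}. (1 - X ^ i) * inverse (1 + X ^ i))
      * (\<Prod>i\<in>{m<..N}. (1 + X ^ i) * inverse (1 - X ^ i)) = 1"
  proof -
    have "(1 - X ^ i) * inverse (1 + X ^ i) * ((1 + X ^ i) * inverse (1 - X ^ i)) = 1" if "i \<in> {m<..N}" for i
    proof -
      have "0 < i" using that by simp
      have "(1 - X ^ i) * inverse (1 + X ^ i) * ((1 + X ^ i) * inverse (1 - X ^ i))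
          = ((1 - X ^ i) * inverse (1 - X ^ i)) * ((1 + X ^ i) * inverse (1 + X ^ i))"
        by (simp only: mult_ac)
      then show ?thesis
        by (simp only: one_minus_X_inverse[OF \<open>0 < i\<close>] one_plus_X_inverse[OF \<open>0 < i\<close>] mult_1)
    qed
    then show ?thesis by (simp add: prod.distrib[symmetric])
  qed
  ultimately show ?thesis by (simp add: mult.assoc)
qed

section \<open>Divisor sums\<close>

definition psgn :: "int \<Rightarrow> int" where
  "psgn k = (if even k then 1 else -1)"

lemma psgn_of_nat: "psgn (int k) = (-1) ^ k"
  by (simp add: psgn_def)

lemma psgn_minus [simp]: "psgn (- k) = psgn k"
  by (simp add: psgn_def)

definition factor_pairs :: "int \<Rightarrow> (int \<times> int) set" where
  "factor_pairs n = {(d, e). 0 < d \<and> 0 < e \<and> d * e = n}"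

text \<open>This is \<open>k\<close> minus the half of \<open>k\<close> when \<open>k\<close> is
  even: the weight left after the contribution of the even indices, in base \<open>q^2\<close>, is
  subtracted.\<close>

definition halve :: "int \<Rightarrow> int" where
  "halve k = (if even k then k div 2 else k)"

definition theta :: "int fps" where
  "theta = Abs_fps (\<lambda>n. \<Sum>j | j\<^sup>2 = int n. psgn j)"

text \<open>The expansion of \<open>1 + 8 * (\<Sum>j. (-1)^j * q^(j^2) * wplus q j)\<close>. The
  exponent \<open>j^2 + j k\<close> factors as \<open>d e\<close> with \<open>d = j\<close> and
  \<open>e = j + k\<close>, and the signs \<open>(-1)^j\<close> and \<open>(-1)^(k-1)\<close>
  combine to \<open>- psgn e\<close>.\<close>

definition rank_appell :: "int fps" where
  "rank_appell = Abs_fps (\<lambda>n. if n = 0 then 1 else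
     - 8 * (\<Sum>(d, e)\<in>{(d, e)\<in>factor_pairs (int n). d < e}. psgn e * (e - d)))"

text \<open>The same factorisation \<open>d = j\<close>, \<open>e = j + k\<close>. The first sum
  stems from the constant 1 in the expansion of \<open>qratio\<close>, the second from its terms
  with \<open>j > 0\<close>.\<close>

definition spt_appell :: "int fps" where
  "spt_appell = Abs_fps (\<lambda>n. 2 * (\<Sum>(d, e)\<in>factor_pairs (int n). halve e)
     + 4 * (\<Sum>(d, e)\<in>{(d, e)\<in>factor_pairs (int n). d < e}. psgn d * halve (e - d)))"

text \<open>The constant term is set to 1 because \<open>alphabar 0\<close> depends on the unspecified \<open>Max {}\<close>.\<close>
definition rank_series :: "int fps" where
  "rank_series = Abs_fps (\<lambda>n. if n = 0 then 1 else alphabar n)"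

definition spt_series :: "int fps" where
  "spt_series = Abs_fps spt1bar"

definition rat_fps :: "int fps \<Rightarrow> rat fps" where
  "rat_fps f = Abs_fps (\<lambda>n. of_int (fps_nth f n))"

lemma rat_fps_mult: "rat_fps (f * g) = rat_fps f * rat_fps g"
  by (simp add: rat_fps_def fps_eq_iff fps_mult_nth)

lemma rat_fps_eq_iff: "rat_fps f = rat_fps g \<longleftrightarrow> f = g"
  by (simp add: rat_fps_def fps_eq_iff)

lemma finite_factor_pairs [simp]: "finite (factor_pairs n)"
proof (rule finite_subset)
  show "factor_pairs n \<subseteq> {1..n} \<times> {1..n}"
    by (auto simp: factor_pairs_def)
qed auto

lemma factor_pairs_0 [simp]: "factor_pairs 0 = {}"
  by (auto simp: factor_pairs_def)

lemma sum_factor_pairs: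
  assumes "1 \<le> i" "i \<le> n"
  shows "(\<Sum>(d, e)\<in>factor_pairs (int i). h d e)
       = (\<Sum>j\<in>{1..n}. if j dvd i then h (int j) (int (i div j)) else 0)"
proof -
  have "(\<Sum>j\<in>{1..n}. if j dvd i then h (int j) (int (i div j)) else 0)
      = (\<Sum>j\<in>{j\<in>{1..n}. j dvd i}. h (int j) (int (i div j)))"
    by (intro sum.mono_neutral_cong_right) auto
  also have "\<dots> = (\<Sum>(d, e)\<in>factor_pairs (int i). h d e)"
  proof (rule sum.reindex_bij_witness[of _ "\<lambda>(d, e). nat d" "\<lambda>j. (int j, int (i div j))"])
    fix j assume "j \<in> {j\<in>{1..n}. j dvd i}"
    then show "(case (int j, int (i div j)) of (d, e) \<Rightarrow> nat d) = j"
      "(int j, int (i div j)) \<in> factor_pairs (int i)"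
      "(case (int j, int (i div j)) of (d, e) \<Rightarrow> h d e) = h (int j) (int (i div j))"
      using assms by (auto simp: factor_pairs_def div_greater_zero_iff dvd_imp_le
          simp flip: of_nat_mult)
  next
    fix p assume p: "p \<in> factor_pairs (int i)"
    then obtain d e where de: "p = (int d, int e)" "0 < d" "0 < e" "d * e = i"
      by (auto simp: factor_pairs_def simp flip: of_nat_mult elim!: pos_int_cases)
    moreover from de have "d \<le> i"
      by (metis dvd_imp_le dvd_triv_left mult_pos_pos)
    ultimately show "(int (case p of (d, e) \<Rightarrow> nat d), int (i div (case p of (d, e) \<Rightarrow> nat d))) = p"
      "(case p of (d, e) \<Rightarrow> nat d) \<in> {j\<in>{1..n}. j dvd i}"
      using assms by auto
  qed
  finally show ?thesis ..
qed

lemma sum_factor_pairs_less: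
  "(\<Sum>(d, e)\<in>{(d, e)\<in>factor_pairs n. d < e}. h d e)
     = (\<Sum>(d, e)\<in>factor_pairs n. if d < e then h d e else 0)"
  by (intro sum.mono_neutral_cong_left) (auto split: if_splits)

lemma square_roots:
  "{j. j\<^sup>2 = int (k\<^sup>2)} = {int k, - int k}"
  by (auto simp: power2_eq_iff)

lemma theta_agree: "fps_agree n (1 + 2 * (\<Sum>j=1..n. (-1) ^ j * X ^ j\<^sup>2)) (rat_fps theta)"
  unfolding fps_agree_def
proof (intro allI impI)
  fix i assume i: "i \<le> n"
  have sgn: "fps_nth ((-1) ^ j * f) i = (-1) ^ j * fps_nth f i" for j and f :: "rat fps"
    by (cases "even j") simp_all
  have nth: "fps_nth (1 + 2 * (\<Sum>j=1..n. (-1) ^ j * X ^ j\<^sup>2)) i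
      = (if i = 0 then 1 else 0) + 2 * (\<Sum>j=1..n. if i = j\<^sup>2 then (-1) ^ j else 0)"
    by (simp add: fps_sum_nth sgn fps_X_power_nth numeral_fps_const fps_mult_left_const_nth
        if_distrib[of "(*) _"] cong: if_cong)
  show "fps_nth (1 + 2 * (\<Sum>j=1..n. (-1) ^ j * X ^ j\<^sup>2)) i = fps_nth (rat_fps theta) i"
  proof (cases "\<exists>k. i = k\<^sup>2")
    case True
    then obtain k where k: "i = k\<^sup>2" by blast
    have "k \<le> n" using i k self_le_square[of k] by linarith
    have "(\<Sum>j=1..n. if i = j\<^sup>2 then (-1) ^ j else 0) = (\<Sum>j=1..n. if j = k then (-1) ^ j else 0 :: rat)"
      by (intro sum.cong refl) (auto simp: k)
    also have "\<dots> = (if k = 0 then 0 else (-1) ^ k)"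
      using \<open>k \<le> n\<close> by simp
    finally have "fps_nth (1 + 2 * (\<Sum>j=1..n. (-1) ^ j * X ^ j\<^sup>2)) i = (if k = 0 then 1 else 2 * (-1) ^ k)"
      unfolding nth by (simp add: k)
    moreover have "fps_nth theta i = (if k = 0 then 1 else 2 * (-1) ^ k)"
      by (auto simp: theta_def k square_roots psgn_def simp del: of_nat_power)
    ultimately show ?thesis by (simp add: rat_fps_def)
  next
    case False
    have "{j. j\<^sup>2 = int i} = {}"
    proof safe
      fix j :: int assume "j\<^sup>2 = int i"
      then have "int ((nat \<bar>j\<bar>)\<^sup>2) = int i" by simp
      then show "j \<in> {}" using False by (metis of_nat_eq_iff)
    qed
    then have "fps_nth theta i = 0" by (simp add: theta_def)
    moreover have "fps_nth (1 + 2 * (\<Sum>j=1..n. (-1) ^ j * X ^ j\<^sup>2)) i = 0"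
    proof -
      have "i \<noteq> 0" using False by (metis zero_power2)
      moreover have "(\<Sum>j=1..n. if i = j\<^sup>2 then (-1) ^ j else 0 :: rat) = 0"
        using False by (intro sum.neutral) auto
      ultimately show ?thesis unfolding nth by simp
    qed
    ultimately show ?thesis by (simp add: rat_fps_def)
  qed
qed

text \<open>The exponent \<open>j^2 + j k = j (j + k)\<close> gives \<open>k = i div j - j\<close>.
  If this is negative, truncated subtraction makes it 0, and \<open>h 0 = 0\<close> gives the right
  coefficient.\<close>

lemma theta_shift_spread_nth:
  fixes h :: "nat \<Rightarrow> rat"
  assumes "0 < j" "h 0 = 0"
  shows "fps_nth ((-1) ^ j * (X ^ j\<^sup>2 * spread j h)) i = (if j dvd i then (-1) ^ j * h (i div j - j) else 0)"
proof -
  have "fps_nth ((-1) ^ j * (X ^ j\<^sup>2 * spread j h)) i = (-1) ^ j * fps_nth (X ^ j\<^sup>2 * spread j h) i"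
    by (cases "even j") simp_all
  also have "fps_nth (X ^ j\<^sup>2 * spread j h) i = (if j dvd i then h (i div j - j) else 0)"
  proof (cases "i < j\<^sup>2")
    case True
    then have "i div j < j"
      using assms(1) by (simp add: power2_eq_square div_less_iff_less_mult)
    then show ?thesis using True assms by (simp add: fps_X_power_mult_nth)
  next
    case False
    then have le: "j * j \<le> i" by (simp add: power2_eq_square)
    have dvd: "j dvd i - j * j \<longleftrightarrow> j dvd i"
      using dvd_diffD[OF _ dvd_triv_left le] dvd_diff_nat[OF _ dvd_triv_left, of j i j] by blast
    have "(i - j * j) div j = i div j - j" if "j dvd i"
    proof -
      from that obtain k where "i = j * k" by blast
      then have "i - j * j = j * (k - j)" by (simp only: diff_mult_distrib2)
      then show ?thesis using \<open>i = j * k\<close> assms(1) by simp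
    qed
    then show ?thesis
      using False dvd by (simp add: fps_X_power_mult_nth spread_nth power2_eq_square)
  qed
  finally show ?thesis by simp
qed

lemma rank_appell_agree:
  "fps_agree n (1 + 8 * (\<Sum>j=1..n. (-1) ^ j * (X ^ j\<^sup>2 * wplus X j))) (rat_fps rank_appell)"
  unfolding fps_agree_def
proof (intro allI impI)
  fix i assume i: "i \<le> n"
  have "(\<Sum>j=1..n. fps_nth ((-1) ^ j * (X ^ j\<^sup>2 * wplus X j)) i)
      = (\<Sum>j=1..n. if j dvd i then (-1) ^ j * ((-1) ^ (i div j - j - 1) * of_nat (i div j - j)) else 0)"
    by (intro sum.cong refl) (simp add: wplus_eq_spread theta_shift_spread_nth)
  then have nth: "fps_nth (1 + 8 * (\<Sum>j=1..n. (-1) ^ j * (X ^ j\<^sup>2 * wplus X j))) i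
      = (if i = 0 then 1 else 0)
        + 8 * (\<Sum>j=1..n. if j dvd i then (-1) ^ j * ((-1) ^ (i div j - j - 1) * of_nat (i div j - j)) else 0)"
    by (simp add: fps_sum_nth numeral_fps_const fps_mult_left_const_nth)
  show "fps_nth (1 + 8 * (\<Sum>j=1..n. (-1) ^ j * (X ^ j\<^sup>2 * wplus X j))) i = fps_nth (rat_fps rank_appell) i"
  proof (cases "i = 0")
    case True
    then show ?thesis unfolding nth by (simp add: rat_fps_def rank_appell_def)
  next
    case False
    have "(\<Sum>(d, e)\<in>{(d, e)\<in>factor_pairs (int i). d < e}. psgn e * (e - d))
        = (\<Sum>j\<in>{1..n}. if j dvd i then (if int j < int (i div j)
            then psgn (int (i div j)) * (int (i div j) - int j) else 0) else 0)"
      unfolding sum_factor_pairs_less using False i by (intro sum_factor_pairs) auto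
    then have "of_int (fps_nth rank_appell i)
      = - 8 * (\<Sum>j\<in>{1..n}. of_int (if j dvd i then (if int j < int (i div j)
            then psgn (int (i div j)) * (int (i div j) - int j) else 0) else 0) :: rat)"
      using False by (simp add: rank_appell_def)
    also have "\<dots> = 8 * (\<Sum>j\<in>{1..n}. if j dvd i then (-1) ^ j * ((-1) ^ (i div j - j - 1) * of_nat (i div j - j)) else 0)"
      unfolding sum_distrib_left
    proof (intro sum.cong refl)
      fix j
      show "- 8 * of_int (if j dvd i then (if int j < int (i div j)
            then psgn (int (i div j)) * (int (i div j) - int j) else 0) else 0)
          = 8 * (if j dvd i then (-1) ^ j * ((-1) ^ (i div j - j - 1) * of_nat (i div j - j)) else 0 :: rat)"
      proof (cases "j < i div j")
        case True
        then obtain k where "i div j = j + Suc k" by (metis add_Suc_right less_imp_Suc_add)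
        then show ?thesis
          by (auto simp: psgn_def minus_one_power_iff)
      qed simp
    qed
    finally show ?thesis
      unfolding nth using False by (simp add: rat_fps_def)
  qed
qed

lemma sum_if_diff:
  "(\<Sum>x\<in>S. if P x then f x else 0) - (\<Sum>x\<in>S. if P x then g x else 0)
     = (\<Sum>x\<in>S. if P x then f x - g x else (0::'a::ab_group_add))"
  unfolding sum_subtractf[symmetric] by (intro sum.cong refl) simp

lemma of_int_sum_if:
  "of_int (\<Sum>x\<in>S. if P x then f x else 0) = (\<Sum>x\<in>S. if P x then of_int (f x) else (0::'a::ring_1))"
  unfolding of_int_sum by (intro sum.cong refl) simp

lemma spt_appell_agree:
  "fps_agree (2 * n) (2 * ((\<Sum>m=1..2*n. wminus X m) + 2 * (\<Sum>j=1..2*n. (-1) ^ j * (X ^ j\<^sup>2 * wminus X j))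
      - ((\<Sum>m=1..n. wminus (X\<^sup>2) m) + 2 * (\<Sum>j=1..n. (-1) ^ j * (X ^ j\<^sup>2 * wminus (X\<^sup>2) j)))))
     (rat_fps spt_appell)"
  unfolding fps_agree_def
proof (intro allI impI)
  fix i assume i: "i \<le> 2 * n"
  let ?N = "2 * n"
  define g where "g j = rat_of_nat (i div j - j)" for j
  define g' where "g' j = rat_of_nat (if even (i div j - j) then (i div j - j) div 2 else 0)" for j
  have w2: "wminus (X\<^sup>2) m = spread (2 * m) of_nat" if "0 < m" for m
    using wminus_eq_spread[of "2 * m"] that by (simp add: wminus_def power_mult)
  have w2': "spread (2 * m) of_nat = spread m (\<lambda>k. rat_of_nat (if even k then k div 2 else 0))" if "0 < m" for m
  proof (rule fps_ext)
    fix k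
    show "fps_nth (spread (2 * m) of_nat) k
        = fps_nth (spread m (\<lambda>k. rat_of_nat (if even k then k div 2 else 0))) k"
    proof (cases "m dvd k")
      case True
      then obtain c where c: "k = m * c" by blast
      have "2 * m dvd m * c \<longleftrightarrow> 2 dvd c"
        using that by (simp add: mult.commute[of 2])
      moreover have "m * c div (2 * m) = c div 2"
        using that by (simp add: mult.commute[of 2])
      ultimately show ?thesis
        unfolding spread_nth c using that by simp
    next
      case False
      then have "\<not> 2 * m dvd k" by (meson dvd_mult_right)
      with False show ?thesis by (simp add: spread_nth)
    qed
  qed
  have w3: "fps_nth (wminus (X\<^sup>2) m) i
      = (if m dvd i then rat_of_nat (if even (i div m) then i div m div 2 else 0) else 0)" if "0 < m" for m
    unfolding w2[OF that] w2'[OF that] spread_nth ..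
  have w4: "fps_nth ((-1) ^ j * (X ^ j\<^sup>2 * wminus (X\<^sup>2) j)) i = (if j dvd i then (-1) ^ j * g' j else 0)"
    if "0 < j" for j
    unfolding w2[OF that] w2'[OF that] g'_def using that by (subst theta_shift_spread_nth) simp_all
  \<comment> \<open>Beyond \<open>n\<close> the quotient is at most 1 and an even one is 0, so the
    base \<open>X^2\<close> sums up to \<open>n\<close> extend to \<open>2 * n\<close> and can be
    subtracted termwise.\<close>
  have less_2: "i div m < 2" if "m \<in> {1..?N} - {1..n}" for m
  proof -
    have "i < 2 * m" "0 < m" using that i by auto
    then show ?thesis by (simp only: div_less_iff_less_mult)
  qed
  have s1: "(\<Sum>m=1..?N. fps_nth (wminus X m) i) = (\<Sum>m=1..?N. if m dvd i then rat_of_nat (i div m) else 0)"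
    by (intro sum.cong refl) (simp add: wminus_eq_spread spread_nth)
  have s2: "(\<Sum>m=1..n. fps_nth (wminus (X\<^sup>2) m) i)
      = (\<Sum>m=1..?N. if m dvd i then rat_of_nat (if even (i div m) then i div m div 2 else 0) else 0)"
  proof (intro sum.mono_neutral_cong_left ballI)
    fix m assume "m \<in> {1..?N} - {1..n}"
    then have "i div m < 2" by (rule less_2)
    moreover have "k < 2 \<Longrightarrow> (if even k then k div 2 else 0) = 0" for k :: nat
      by simp
    ultimately have "(if even (i div m) then i div m div 2 else 0) = 0" by blast
    then show "(if m dvd i then rat_of_nat (if even (i div m) then i div m div 2 else 0) else 0) = 0"
      by (simp only: of_nat_0 if_cancel)
  next
    show "fps_nth (wminus (X\<^sup>2) m) i
      = (if m dvd i then rat_of_nat (if even (i div m) then i div m div 2 else 0) else 0)"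
      if "m \<in> {1..n}" for m
      using that by (intro w3) simp
  qed simp_all
  have s3: "(\<Sum>j=1..?N. fps_nth ((-1) ^ j * (X ^ j\<^sup>2 * wminus X j)) i)
      = (\<Sum>j=1..?N. if j dvd i then (-1) ^ j * g j else 0)"
    by (intro sum.cong refl) (simp add: wminus_eq_spread theta_shift_spread_nth g_def)
  have s4: "(\<Sum>j=1..n. fps_nth ((-1) ^ j * (X ^ j\<^sup>2 * wminus (X\<^sup>2) j)) i)
      = (\<Sum>j=1..?N. if j dvd i then (-1) ^ j * g' j else 0)"
  proof (intro sum.mono_neutral_cong_left ballI)
    fix m assume "m \<in> {1..?N} - {1..n}"
    then have "i div m < 2" "1 \<le> m" using less_2[of m] by simp_all
    then have "i div m - m = 0" by linarith
    then show "(if m dvd i then (-1) ^ m * g' m else 0) = 0"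
      by (simp add: g'_def)
  next
    show "fps_nth ((-1) ^ j * (X ^ j\<^sup>2 * wminus (X\<^sup>2) j)) i = (if j dvd i then (-1) ^ j * g' j else 0)"
      if "j \<in> {1..n}" for j
      using that by (intro w4) simp
  qed simp_all
  have nth: "fps_nth (2 * ((\<Sum>m=1..2*n. wminus X m) + 2 * (\<Sum>j=1..2*n. (-1) ^ j * (X ^ j\<^sup>2 * wminus X j))
      - ((\<Sum>m=1..n. wminus (X\<^sup>2) m) + 2 * (\<Sum>j=1..n. (-1) ^ j * (X ^ j\<^sup>2 * wminus (X\<^sup>2) j))))) i
    = 2 * ((\<Sum>m=1..?N. if m dvd i then rat_of_nat (i div m) else 0)
        - (\<Sum>m=1..?N. if m dvd i then rat_of_nat (if even (i div m) then i div m div 2 else 0) else 0))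
      + 4 * ((\<Sum>j=1..?N. if j dvd i then (-1) ^ j * g j else 0)
        - (\<Sum>j=1..?N. if j dvd i then (-1) ^ j * g' j else 0))"
    unfolding s1[symmetric] s2[symmetric] s3[symmetric] s4[symmetric]
    by (simp add: fps_sum_nth numeral_fps_const fps_mult_left_const_nth algebra_simps)
  also have "\<dots> = 2 * (\<Sum>m=1..?N. if m dvd i then of_int (halve (int (i div m))) else 0)
      + 4 * (\<Sum>j=1..?N. if j dvd i then of_int (if int j < int (i div j)
            then psgn (int j) * halve (int (i div j) - int j) else 0) else 0)"
  proof -
    have half: "of_int (int k div 2) = (of_nat (k div 2) :: rat)" for k
      using arg_cong[OF zdiv_int[of k 2], of rat_of_int] by simp
    have h: "rat_of_nat k - rat_of_nat (if even k then k div 2 else 0) = of_int (halve (int k))" for k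
      by (auto simp: halve_def half elim!: evenE)
    have "(-1) ^ j * g j - (-1) ^ j * g' j
        = of_int (if int j < int (i div j) then psgn (int j) * halve (int (i div j) - int j) else 0)" for j
    proof (cases "j < i div j")
      case True
      then have "int (i div j) - int j = int (i div j - j)" by simp
      then show ?thesis
        using True h[of "i div j - j"] by (simp add: g_def g'_def psgn_of_nat flip: right_diff_distrib)
    next
      case False
      then show ?thesis by (simp add: g_def g'_def)
    qed
    then show ?thesis
      by (simp only: sum_if_diff h)
  qed
  also have "\<dots> = fps_nth (rat_fps spt_appell) i"
  proof (cases "i = 0")
    case True
    then show ?thesis
      by (auto simp: rat_fps_def spt_appell_def halve_def)
  next
    case False
    then have "1 \<le> i" by simp
    have "fps_nth spt_appell i = 2 * (\<Sum>m=1..?N. if m dvd i then halve (int (i div m)) else 0)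
      + 4 * (\<Sum>j=1..?N. if j dvd i then (if int j < int (i div j)
            then psgn (int j) * halve (int (i div j) - int j) else 0) else 0)"
      unfolding spt_appell_def sum_factor_pairs_less fps_nth_Abs_fps
      unfolding sum_factor_pairs[OF \<open>1 \<le> i\<close> i] ..
    then show ?thesis
      by (simp only: rat_fps_def fps_nth_Abs_fps of_int_add of_int_mult of_int_numeral of_int_sum_if)
  qed
  finally show "fps_nth (2 * ((\<Sum>m=1..2*n. wminus X m) + 2 * (\<Sum>j=1..2*n. (-1) ^ j * (X ^ j\<^sup>2 * wminus X j))
      - ((\<Sum>m=1..n. wminus (X\<^sup>2) m) + 2 * (\<Sum>j=1..n. (-1) ^ j * (X ^ j\<^sup>2 * wminus (X\<^sup>2) j))))) i
    = fps_nth (rat_fps spt_appell) i" .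
qed

text \<open>The square of \<open>qratio\<close> in \<open>wplus_expansion\<close> is met here: one
  factor comes from the \<open>q\<close>-binomial form of the rank series, the other replaces
  \<open>theta\<close>.\<close>

lemma theta_rank_series: "theta * rank_series = rank_appell"
proof -
  have "fps_agree n (rat_fps (theta * rank_series)) (rat_fps rank_appell)" for n
  proof -
    let ?b = "qratio X n"
    have th: "fps_agree n (rat_fps theta) ?b"
      using theta_agree theta_agree_qratio fps_agree_sym fps_agree_trans by blast
    have "fps_agree n (rat_fps rank_series) (1 - (\<Sum>m=1..n. (-1) ^ m * (qratio X (m - 1) - qratio X m)))"
      unfolding fps_agree_def
    proof (intro allI impI)
      fix i assume "i \<le> n"
      have "fps_nth (\<Sum>m=1..n. (-1) ^ m * (qratio X (m - 1) - qratio X m)) 0 = 0"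
        by (simp add: fps_sum_nth qratio_nth_0 fps_power_zeroth)
      then show "fps_nth (rat_fps rank_series) i
          = fps_nth (1 - (\<Sum>m=1..n. (-1) ^ m * (qratio X (m - 1) - qratio X m))) i"
        using alphabar_eq[of i n] \<open>i \<le> n\<close> by (cases "i = 0") (simp_all add: rat_fps_def rank_series_def)
    qed
    also note alternating_qratio_agree
    finally have "fps_agree n (rat_fps theta * rat_fps rank_series)
        (?b * (?b * (1 + 4 * (\<Sum>k=1..n. wplus X k * inverse (qratio X k)))))"
      by (intro fps_agree_mult th)
    also have "?b * (?b * (1 + 4 * (\<Sum>k=1..n. wplus X k * inverse (qratio X k))))
        = ?b\<^sup>2 * (1 + 4 * (\<Sum>k=1..n. wplus X k * inverse (qratio X k)))"
      by (simp only: power2_eq_square mult.assoc)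
    also note wplus_agree
    also note rank_appell_agree
    finally show ?thesis by (simp add: rat_fps_mult)
  qed
  then show ?thesis
    using fps_eqI_agree rat_fps_eq_iff by blast
qed

text \<open>Replacing \<open>theta\<close> by \<open>qratio X (2 * n)\<close> cancels the product
  over the parts above \<open>m\<close> and leaves \<open>qratio X m\<close>, for which the sums
  telescope.\<close>

lemma theta_spt_series: "theta * spt_series = spt_appell"
proof -
  have "fps_agree n (rat_fps (theta * spt_series)) (rat_fps spt_appell)" for n
  proof -
    let ?N = "2 * n"
    let ?b = "qratio X ?N"
    let ?S = "\<Sum>m\<in>{m\<in>{1..?N}. odd m}. 2 * wminus X m * (\<Prod>i\<in>{m<..?N}. (1 + X ^ i) * inverse (1 - X ^ i))"
    have th: "fps_agree ?N (rat_fps theta) ?b"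
      using theta_agree theta_agree_qratio fps_agree_sym fps_agree_trans by blast
    have "fps_agree ?N (rat_fps spt_series) ?S"
      unfolding fps_agree_def using spt1bar_eq by (simp add: rat_fps_def spt_series_def)
    then have "fps_agree ?N (rat_fps theta * rat_fps spt_series) (?b * ?S)"
      by (intro fps_agree_mult th)
    also have "?b * ?S = 2 * (\<Sum>m\<in>{m\<in>{1..?N}. odd m}. wminus X m * qratio X m)"
      unfolding sum_distrib_left
    proof (intro sum.cong refl)
      fix m assume "m \<in> {m\<in>{1..?N}. odd m}"
      then have "m \<le> ?N" by simp
      then show "?b * (2 * wminus X m * (\<Prod>i\<in>{m<..?N}. (1 + X ^ i) * inverse (1 - X ^ i)))
          = 2 * (wminus X m * qratio X m)"
        by (simp only: qratio_tail[symmetric] mult_ac)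
    qed
    also have "fps_agree ?N \<dots> (2 * ((\<Sum>m=1..2*n. wminus X m) + 2 * (\<Sum>j=1..2*n. (-1) ^ j * (X ^ j\<^sup>2 * wminus X j))
      - ((\<Sum>m=1..n. wminus (X\<^sup>2) m) + 2 * (\<Sum>j=1..n. (-1) ^ j * (X ^ j\<^sup>2 * wminus (X\<^sup>2) j)))))"
      by (intro fps_agree_cmult wminus_odd_agree)
    also note spt_appell_agree
    finally have "fps_agree ?N (rat_fps (theta * spt_series)) (rat_fps spt_appell)"
      by (simp add: rat_fps_mult)
    then show ?thesis by (rule fps_agree_mono) simp
  qed
  then show ?thesis
    using fps_eqI_agree rat_fps_eq_iff by blast
qed

section \<open>A Liouville identity for j^2 + d e\<close>

lemma psgn_add: "psgn (a + b) = psgn a * psgn b"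
  and psgn_diff: "psgn (a - b) = psgn a * psgn b"
  and psgn_double [simp]: "psgn (2 * a) = 1" "psgn (a * 2) = 1"
  and psgn_self [simp]: "psgn a * psgn a = 1"
  and psgn_self_left [simp]: "psgn a * (psgn a * b) = b"
  by (auto simp: psgn_def)

lemma sum_disjoint_union:
  "finite S \<Longrightarrow> A \<union> B = S \<Longrightarrow> A \<inter> B = {} \<Longrightarrow> sum f S = sum f A + sum f B"
  by (metis finite_Un sum.union_disjoint)

definition quads :: "int \<Rightarrow> (int \<times> int \<times> int) set" where
  "quads n = {(j, d, e). 0 < d \<and> 0 < e \<and> j\<^sup>2 + d * e = n}"

text \<open>The image of \<open>quads\<close> under the shear. Here \<open>e\<close> may be zero or
  negative, and these extra regions must be evaluated separately.\<close>

definition shear_quads :: "int \<Rightarrow> (int \<times> int \<times> int) set" where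
  "shear_quads n = {(j, d, e). 0 < d \<and> d + 2 * j < e \<and> j\<^sup>2 + d * e = n}"

text \<open>Solutions with factors of equal parity, written through half sum and half difference.
  The form is symmetric in \<open>J\<close> and \<open>m\<close>, so either of them can be paired
  with \<open>k\<close> to recover a product \<open>d e\<close>.\<close>

definition diag_quads :: "int \<Rightarrow> (int \<times> int \<times> int) set" where
  "diag_quads n = {(J, k, m). 0 < k \<and> k < J \<and> J\<^sup>2 - k\<^sup>2 + m\<^sup>2 = n}"

text \<open>Chosen for its pullback along the shear: \<open>e - d - 2 j\<close> becomes the old
  second factor \<open>b\<close>, \<open>d + e\<close> becomes \<open>2 j + b\<close>, and the sign
  becomes \<open>psgn j * psgn b\<close>. It also vanishes on the boundary
  \<open>e = d + 2 j\<close>.\<close>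

fun shear_weight :: "int \<times> int \<times> int \<Rightarrow> int" where
  "shear_weight (j, d, e) = psgn j * psgn e * (e - d - 2 * j) * (d + e)\<^sup>2"

fun diag_weight :: "int \<times> int \<times> int \<Rightarrow> int" where
  "diag_weight (J, k, m) = 8 * psgn m * psgn (J - k) * (J - k) * m\<^sup>2"

context
  fixes n :: int
begin

lemma finite_quads: "finite (quads n)"
proof (rule finite_subset)
  show "quads n \<subseteq> {-n..n} \<times> {1..n} \<times> {1..n}"
  proof
    fix x assume "x \<in> quads n"
    then obtain j d e where x: "x = (j, d, e)" "0 < d" "0 < e" "j\<^sup>2 + d * e = n"
      by (auto simp: quads_def)
    have "\<bar>j\<bar> \<le> j\<^sup>2"
    proof -
      have "\<bar>j\<bar> * 1 \<le> \<bar>j\<bar> * \<bar>j\<bar>"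
        using mult_left_mono[of 1 "\<bar>j\<bar>" "\<bar>j\<bar>"] by (cases "j = 0") simp_all
      then show ?thesis by (simp add: power2_eq_square)
    qed
    moreover have "d * 1 \<le> d * e" "1 * e \<le> d * e"
      using x(2,3) by (intro mult_left_mono mult_right_mono; simp)+
    ultimately have "- n \<le> j" "j \<le> n" "d \<le> n" "e \<le> n" "1 \<le> d" "1 \<le> e"
      using x(2-4) zero_le_power2[of j] by linarith+
    then show "x \<in> {-n..n} \<times> {1..n} \<times> {1..n}"
      by (simp add: x(1))
  qed
qed simp

lemma sum_quads_neg: "(\<Sum>(j, d, e)\<in>{(j, d, e)\<in>quads n. P d e}. f (- j) d e)
    = (\<Sum>(j, d, e)\<in>{(j, d, e)\<in>quads n. P d e}. f j d e :: int)"
  by (rule sum.reindex_bij_witness[of _ "\<lambda>(j, d, e). (- j, d, e)" "\<lambda>(j, d, e). (- j, d, e)"])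
    (auto simp: quads_def)

lemma shear_bij:
  "bij_betw (\<lambda>(j, a, b). (j - a, a, 2 * j + b - a)) (quads n) (shear_quads n)"
  by (rule bij_betw_byWitness[where f' = "\<lambda>(j, d, e). (j + d, d, e - d - 2 * j)"])
    (auto simp: quads_def shear_quads_def power2_eq_square algebra_simps)

lemma finite_shear_quads: "finite (shear_quads n)"
  using bij_betw_finite[OF shear_bij] finite_quads by simp

text \<open>After the pullback the weight contains \<open>(2 j + e)^2\<close>; averaging over
  \<open>j\<close> and \<open>- j\<close> removes the cross term.\<close>

lemma sum_shear:
  "(\<Sum>x\<in>shear_quads n. shear_weight x) = (\<Sum>(j, d, e)\<in>quads n. psgn j * psgn e * (e ^ 3 + 4 * j\<^sup>2 * e))"
proof -
  let ?f = "\<lambda>j d e. psgn j * psgn e * (e * (2 * j + e)\<^sup>2)"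
  have "(\<Sum>x\<in>shear_quads n. shear_weight x) = (\<Sum>(j, d, e)\<in>quads n. ?f j d e)"
    by (subst sum.reindex_bij_betw[OF shear_bij, symmetric], intro sum.cong refl)
      (auto simp: psgn_add psgn_diff algebra_simps)
  moreover have "(\<Sum>(j, d, e)\<in>quads n. ?f j d e) = (\<Sum>(j, d, e)\<in>quads n. ?f (- j) d e)"
    using sum_quads_neg[of ?f "\<lambda>_ _. True"] by simp
  moreover have "(\<Sum>(j, d, e)\<in>quads n. ?f j d e) + (\<Sum>(j, d, e)\<in>quads n. ?f (- j) d e)
      = 2 * (\<Sum>(j, d, e)\<in>quads n. psgn j * psgn e * (e ^ 3 + 4 * j\<^sup>2 * e))"
    unfolding sum.distrib[symmetric] sum_distrib_left
    by (intro sum.cong refl) (auto simp: power2_eq_square power3_eq_cube algebra_simps)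
  ultimately show ?thesis by simp
qed

lemma sum_quads_less:
  "(\<Sum>x\<in>{(j, d, e)\<in>quads n. d < e}. shear_weight x)
     = (\<Sum>(j, d, e)\<in>{(j, d, e)\<in>quads n. d < e}. psgn j * psgn e * (e - d) * (d + e)\<^sup>2)"
proof -
  let ?f = "\<lambda>j d e. psgn j * psgn e * (e - d - 2 * j) * (d + e)\<^sup>2"
  have "(\<Sum>x\<in>{(j, d, e)\<in>quads n. d < e}. shear_weight x) = (\<Sum>(j, d, e)\<in>{(j, d, e)\<in>quads n. d < e}. ?f j d e)"
    by (intro sum.cong refl) auto
  moreover have "(\<Sum>(j, d, e)\<in>{(j, d, e)\<in>quads n. d < e}. ?f j d e)
      = (\<Sum>(j, d, e)\<in>{(j, d, e)\<in>quads n. d < e}. ?f (- j) d e)"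
    using sum_quads_neg[of ?f "(<)"] by simp
  moreover have "(\<Sum>(j, d, e)\<in>{(j, d, e)\<in>quads n. d < e}. ?f j d e)
      + (\<Sum>(j, d, e)\<in>{(j, d, e)\<in>quads n. d < e}. ?f (- j) d e)
      = 2 * (\<Sum>(j, d, e)\<in>{(j, d, e)\<in>quads n. d < e}. psgn j * psgn e * (e - d) * (d + e)\<^sup>2)"
    unfolding sum.distrib[symmetric] sum_distrib_left
    by (intro sum.cong refl) (auto simp: algebra_simps)
  ultimately show ?thesis by simp
qed

lemma parity_sum:
  assumes "finite S"
  shows "(\<Sum>(j, d, e)\<in>S. psgn j * (psgn d + psgn e) * f j d e)
       = (\<Sum>(j, d, e)\<in>{(j, d, e)\<in>S. even (d + e)}. 2 * psgn j * psgn d * f j d e)"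
  using assms by (intro sum.mono_neutral_cong_right) (auto simp: psgn_def split: if_splits)

text \<open>The factor \<open>psgn d + psgn e\<close> keeps only pairs of equal parity, for which
  \<open>d = J - k\<close>, \<open>e = J + k\<close> and \<open>d e = J^2 - k^2\<close>.\<close>

lemma sum_diag:
  "(\<Sum>(m, d, e)\<in>{(j, d, e)\<in>quads n. d < e}. psgn m * (psgn d + psgn e) * (4 * d * m\<^sup>2))
     = (\<Sum>x\<in>diag_quads n. diag_weight x)"
proof -
  have "finite {(j, d, e)\<in>quads n. d < e}"
    using finite_quads by (rule finite_subset[rotated]) auto
  then have "(\<Sum>(m, d, e)\<in>{(j, d, e)\<in>quads n. d < e}. psgn m * (psgn d + psgn e) * (4 * d * m\<^sup>2))
      = (\<Sum>(m, d, e)\<in>{(j, d, e)\<in>{(j, d, e)\<in>quads n. d < e}. even (d + e)}. 2 * psgn m * psgn d * (4 * d * m\<^sup>2))"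
    by (rule parity_sum)
  also have "\<dots> = (\<Sum>x\<in>diag_quads n. diag_weight x)"
  proof (rule sum.reindex_bij_witness[of _ "\<lambda>(J, k, m). (m, J - k, J + k)"
        "\<lambda>(m, d, e). ((d + e) div 2, (e - d) div 2, m)"], goal_cases)
    case (1 x)
    then obtain m d e where x: "x = (m, d, e)" "even (d + e)" by auto
    from x(2) obtain c where "d + e = 2 * c" by (rule evenE)
    then have "e = 2 * c - d" by simp
    then show ?case using x by simp
  next
    case (2 x)
    then obtain m d e where x: "x = (m, d, e)" "0 < d" "d < e" "m\<^sup>2 + d * e = n" "even (d + e)"
      by (auto simp: quads_def)
    from x(5) obtain c where "d + e = 2 * c" by (rule evenE)
    then have e: "e = 2 * c - d" by simp
    have h: "(d + (2 * c - d)) div 2 = c" "(2 * c - d - d) div 2 = c - d" by simp_all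
    show ?case
      using x(2-5) unfolding x(1) e prod.case h
      by (auto simp: diag_quads_def power2_eq_square algebra_simps)
  next
    case (3 x)
    then show ?case by (auto simp: diag_quads_def)
  next
    case (4 x)
    then show ?case by (auto simp: diag_quads_def quads_def power2_eq_square algebra_simps)
  next
    case (5 x)
    then obtain m d e where x: "x = (m, d, e)" "even (d + e)" by auto
    from x(2) obtain c where "d + e = 2 * c" by (rule evenE)
    then have "e = 2 * c - d" by simp
    then show ?case using x by simp
  qed
  finally show ?thesis .
qed

lemma finite_diag_quads: "finite (diag_quads n)"
proof -
  have "diag_quads n \<subseteq> (\<lambda>(m, d, e). ((d + e) div 2, (e - d) div 2, m)) ` quads n"
  proof
    fix x assume "x \<in> diag_quads n"
    then obtain J k m where x: "x = (J, k, m)" "0 < k" "k < J" "J\<^sup>2 - k\<^sup>2 + m\<^sup>2 = n"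
      by (auto simp: diag_quads_def)
    then have "(m, J - k, J + k) \<in> quads n"
      by (auto simp: quads_def power2_eq_square algebra_simps)
    then show "x \<in> (\<lambda>(m, d, e). ((d + e) div 2, (e - d) div 2, m)) ` quads n"
      unfolding x by (rule rev_image_eqI) simp
  qed
  then show ?thesis
    using finite_quads finite_surj by blast
qed

lemma sum_diag_neg:
  "(\<Sum>x\<in>{(J, k, m)\<in>diag_quads n. P k (- m)}. diag_weight x)
     = (\<Sum>x\<in>{(J, k, m)\<in>diag_quads n. P k m}. diag_weight x)"
  by (rule sum.reindex_bij_witness[of _ "\<lambda>(J, k, m). (J, k, - m)" "\<lambda>(J, k, m). (J, k, - m)"])
    (auto simp: diag_quads_def)

text \<open>The pieces are cut to match regions of \<open>shear_quads\<close>: \<open>k < m\<close>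
  belongs to \<open>0 < e < d\<close>, \<open>k = m\<close> to \<open>e = 0\<close>, and
  \<open>\<bar>m\<bar> < k\<close> to \<open>e < 0\<close>.\<close>

lemma sum_diag_split:
  "(\<Sum>x\<in>diag_quads n. diag_weight x)
     = 2 * (\<Sum>x\<in>{(J, k, m)\<in>diag_quads n. k < m}. diag_weight x)
     + 2 * (\<Sum>x\<in>{(J, k, m)\<in>diag_quads n. k = m}. diag_weight x)
     + (\<Sum>x\<in>{(J, k, m)\<in>diag_quads n. \<bar>m\<bar> < k}. diag_weight x)"
proof -
  have fin: "finite {(J, k, m)\<in>diag_quads n. P J k m}" for P
    using finite_diag_quads by (rule finite_subset[rotated]) auto
  let ?s = "\<lambda>P. \<Sum>x\<in>{(J, k, m)\<in>diag_quads n. P k m}. diag_weight x"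
  have split: "?s P = ?s Q + ?s R" if "\<And>k m. 0 < k \<Longrightarrow> P k m \<longleftrightarrow> Q k m \<or> R k m"
    "\<And>k m. 0 < k \<Longrightarrow> \<not> (Q k m \<and> R k m)" for P Q R
    using that by (intro sum_disjoint_union fin) (fastforce simp: diag_quads_def)+
  have "?s (\<lambda>_ _. True) = ?s (\<lambda>k m. k < m \<or> k = m \<or> \<bar>m\<bar> < k) + ?s (\<lambda>k m. k < - m \<or> k = - m)"
    by (intro split) auto
  also have "?s (\<lambda>k m. k < m \<or> k = m \<or> \<bar>m\<bar> < k) = ?s (\<lambda>k m. k < m) + ?s (\<lambda>k m. k = m \<or> \<bar>m\<bar> < k)"
    by (intro split) auto
  also have "?s (\<lambda>k m. k = m \<or> \<bar>m\<bar> < k) = ?s (\<lambda>k m. k = m) + ?s (\<lambda>k m. \<bar>m\<bar> < k)"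
    by (intro split) auto
  also have "?s (\<lambda>k m. k < - m \<or> k = - m) = ?s (\<lambda>k m. k < - m) + ?s (\<lambda>k m. k = - m)"
    by (intro split) auto
  also have "?s (\<lambda>k m. k < - m) = ?s (\<lambda>k m. k < m)"
    by (rule sum_diag_neg)
  also have "?s (\<lambda>k m. k = - m) = ?s (\<lambda>k m. k = m)"
    by (rule sum_diag_neg)
  finally show ?thesis by simp
qed

text \<open>Exchanging \<open>d\<close> and \<open>e\<close> and negating \<open>j\<close> carries
  the first region onto the second, up to the boundary where the weight is 0. The two signs add to
  \<open>psgn d + psgn e\<close>, so equal parity survives. Now \<open>m\<close> is the half sum and
  \<open>k\<close> the half difference, with \<open>d e = m^2 - k^2\<close> and
  \<open>J = j\<close>, so \<open>J\<close> and \<open>m\<close> have exchanged roles compared with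
  \<open>sum_diag\<close>.\<close>

lemma sum_shear_below:
  "(\<Sum>x\<in>{(j, d, e)\<in>shear_quads n. 0 < e \<and> e < d}. shear_weight x)
     - (\<Sum>x\<in>{(j, d, e)\<in>quads n. d < e \<and> e \<le> d + 2 * j}. shear_weight x)
   = 2 * (\<Sum>x\<in>{(J, k, m)\<in>diag_quads n. k < m}. diag_weight x)"
proof -
  let ?C = "{(j, d, e)\<in>quads n. d < e \<and> e < d + 2 * j}"
  have fin: "finite {(j, d, e)\<in>quads n. P j d e}" for P
    using finite_quads by (rule finite_subset[rotated]) auto
  have 1: "(\<Sum>x\<in>{(j, d, e)\<in>shear_quads n. 0 < e \<and> e < d}. shear_weight x)
      = (\<Sum>(j, d, e)\<in>?C. psgn j * psgn d * ((2 * j + d - e) * (d + e)\<^sup>2))"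
    by (rule sum.reindex_bij_witness[of _ "\<lambda>(j, d, e). (- j, e, d)" "\<lambda>(j, d, e). (- j, e, d)"])
      (auto simp: quads_def shear_quads_def algebra_simps)
  have 2: "(\<Sum>x\<in>{(j, d, e)\<in>quads n. d < e \<and> e \<le> d + 2 * j}. shear_weight x)
      = (\<Sum>(j, d, e)\<in>?C. - (psgn j * psgn e * ((2 * j + d - e) * (d + e)\<^sup>2)))"
  proof (intro sum.mono_neutral_cong_right fin ballI)
    fix x assume "x \<in> {(j, d, e)\<in>quads n. d < e \<and> e \<le> d + 2 * j} - ?C"
    then obtain j d where "x = (j, d, d + 2 * j)" by fastforce
    then show "shear_weight x = 0" by simp
  qed (auto simp: algebra_simps)
  have "(\<Sum>x\<in>{(j, d, e)\<in>shear_quads n. 0 < e \<and> e < d}. shear_weight x)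
     - (\<Sum>x\<in>{(j, d, e)\<in>quads n. d < e \<and> e \<le> d + 2 * j}. shear_weight x)
    = (\<Sum>(j, d, e)\<in>?C. psgn j * (psgn d + psgn e) * ((2 * j + d - e) * (d + e)\<^sup>2))"
    unfolding 1 2 sum_subtractf[symmetric]
    by (intro sum.cong refl) (auto simp: algebra_simps)
  also have "\<dots> = (\<Sum>(j, d, e)\<in>{(j, d, e)\<in>?C. even (d + e)}.
      2 * psgn j * psgn d * ((2 * j + d - e) * (d + e)\<^sup>2))"
    by (rule parity_sum[OF fin])
  also have "\<dots> = (\<Sum>x\<in>{(J, k, m)\<in>diag_quads n. k < m}. 2 * diag_weight x)"
  proof (rule sum.reindex_bij_witness[of _ "\<lambda>(J, k, m). (J, m - k, m + k)"
        "\<lambda>(j, d, e). (j, (e - d) div 2, (d + e) div 2)"], goal_cases)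
    case (1 x)
    then obtain j d e where x: "x = (j, d, e)" "even (d + e)" by auto
    from x(2) obtain c where "d + e = 2 * c" by (rule evenE)
    then have "e = 2 * c - d" by simp
    then show ?case using x by simp
  next
    case (2 x)
    then obtain j d e where x: "x = (j, d, e)" "0 < d" "d < e" "e < d + 2 * j" "j\<^sup>2 + d * e = n" "even (d + e)"
      by (auto simp: quads_def)
    from x(6) obtain c where "d + e = 2 * c" by (rule evenE)
    then have e: "e = 2 * c - d" by simp
    have h: "(d + (2 * c - d)) div 2 = c" "(2 * c - d - d) div 2 = c - d" by simp_all
    show ?case
      using x(2-5) unfolding x(1) e prod.case h
      by (auto simp: diag_quads_def power2_eq_square algebra_simps)
  next
    case (3 x)
    then show ?case by (auto simp: diag_quads_def)
  next
    case (4 x)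
    then show ?case by (auto simp: diag_quads_def quads_def power2_eq_square algebra_simps)
  next
    case (5 x)
    then obtain j d e where x: "x = (j, d, e)" "even (d + e)" by auto
    from x(2) obtain c where "d + e = 2 * c" by (rule evenE)
    then have e: "e = 2 * c - d" by simp
    have h: "(d + (2 * c - d)) div 2 = c" "(2 * c - d - d) div 2 = c - d" by simp_all
    show ?case
      unfolding x(1) e prod.case h diag_weight.simps
      by (simp add: psgn_add psgn_diff power2_eq_square algebra_simps)
  qed
  finally show ?thesis by (simp add: sum_distrib_left)
qed

text \<open>The involution \<open>(j, d, e) \<mapsto> (j, - e, - d)\<close> preserves the region and
  the weight apart from exchanging \<open>psgn e\<close> and \<open>psgn d\<close>. Averaging leaves
  pairs of equal parity; \<open>J = - j\<close> is positive because
  \<open>d + 2 j < e < 0\<close>.\<close>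

lemma sum_shear_negative:
  "(\<Sum>x\<in>{(j, d, e)\<in>shear_quads n. e < 0}. shear_weight x)
     = (\<Sum>x\<in>{(J, k, m)\<in>diag_quads n. \<bar>m\<bar> < k}. diag_weight x)"
proof -
  let ?B = "{(j, d, e)\<in>shear_quads n. e < 0}"
  let ?f = "\<lambda>j d e. (e - d - 2 * j) * (d + e)\<^sup>2"
  have fin: "finite ?B"
    using finite_shear_quads by (rule finite_subset[rotated]) auto
  have 1: "(\<Sum>x\<in>?B. shear_weight x) = (\<Sum>(j, d, e)\<in>?B. psgn j * psgn e * ?f j d e)"
    by (intro sum.cong refl) auto
  have 2: "(\<Sum>x\<in>?B. shear_weight x) = (\<Sum>(j, d, e)\<in>?B. psgn j * psgn d * ?f j d e)"
    by (rule sum.reindex_bij_witness[of _ "\<lambda>(j, d, e). (j, - e, - d)" "\<lambda>(j, d, e). (j, - e, - d)"])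
      (auto simp: shear_quads_def power2_eq_square algebra_simps)
  have "2 * (\<Sum>x\<in>?B. shear_weight x)
      = (\<Sum>(j, d, e)\<in>?B. psgn j * psgn d * ?f j d e) + (\<Sum>(j, d, e)\<in>?B. psgn j * psgn e * ?f j d e)"
    using 1 2 by linarith
  also have "\<dots> = (\<Sum>(j, d, e)\<in>?B. psgn j * (psgn d + psgn e) * ?f j d e)"
    unfolding sum.distrib[symmetric] by (intro sum.cong refl) (auto simp: algebra_simps)
  also have "\<dots> = (\<Sum>(j, d, e)\<in>{(j, d, e)\<in>?B. even (d + e)}. 2 * psgn j * psgn d * ?f j d e)"
    by (rule parity_sum[OF fin])
  also have "\<dots> = (\<Sum>x\<in>{(J, k, m)\<in>diag_quads n. \<bar>m\<bar> < k}. 2 * diag_weight x)"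
  proof (rule sum.reindex_bij_witness[of _ "\<lambda>(J, k, m). (- J, m + k, m - k)"
        "\<lambda>(j, d, e). (- j, (d - e) div 2, (d + e) div 2)"], goal_cases)
    case (1 x)
    then obtain j d e where x: "x = (j, d, e)" "even (d + e)" by auto
    from x(2) obtain c where "d + e = 2 * c" by (rule evenE)
    then have "d = 2 * c - e" by simp
    then show ?case using x by simp
  next
    case (2 x)
    then obtain j d e where x: "x = (j, d, e)" "0 < d" "e < 0" "d + 2 * j < e" "j\<^sup>2 + d * e = n" "even (d + e)"
      by (auto simp: shear_quads_def)
    from x(6) obtain c where "d + e = 2 * c" by (rule evenE)
    then have d: "d = 2 * c - e" by simp
    have h: "(2 * c - e + e) div 2 = c" "(2 * c - e - e) div 2 = c - e" by simp_all
    show ?case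
      using x(2-5) unfolding x(1) d prod.case h
      by (auto simp: diag_quads_def power2_eq_square algebra_simps)
  next
    case (3 x)
    then show ?case by (auto simp: diag_quads_def)
  next
    case (4 x)
    then show ?case by (auto simp: diag_quads_def shear_quads_def power2_eq_square algebra_simps)
  next
    case (5 x)
    then obtain j d e where x: "x = (j, d, e)" "even (d + e)" by auto
    from x(2) obtain c where "d + e = 2 * c" by (rule evenE)
    then have d: "d = 2 * c - e" by simp
    have h: "(2 * c - e + e) div 2 = c" "(2 * c - e - e) div 2 = c - e" by simp_all
    show ?case
      unfolding x(1) d prod.case h diag_weight.simps
      by (simp add: psgn_add psgn_diff power2_eq_square algebra_simps)
  qed
  finally show ?thesis by (simp flip: sum_distrib_left)
qed

text \<open>For \<open>d = e\<close> the form is \<open>j^2 + d^2\<close>, and \<open>j\<close> can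
  be interchanged with \<open>d\<close>. The left side has only \<open>j < 0\<close>; on the right
  both signs of \<open>j\<close> occur, which explains 4 in place of 8.\<close>

lemma sum_shear_diagonal:
  "(\<Sum>x\<in>{(j, d, e)\<in>shear_quads n. e = d}. shear_weight x)
     = (\<Sum>(m, d, e)\<in>{(j, d, e)\<in>quads n. d = e}. 4 * psgn m * psgn d * d * m\<^sup>2)"
proof -
  let ?g = "\<lambda>(m, d, e). 4 * psgn m * psgn d * d * m\<^sup>2"
  let ?D = "{(j, d, e)\<in>quads n. d = e}"
  have fin: "finite {(j, d, e)\<in>quads n. P j d e}" for P
    using finite_quads by (rule finite_subset[rotated]) auto
  have "sum ?g ?D = sum ?g {(j, d, e)\<in>quads n. d = e \<and> j \<noteq> 0}"
    by (intro sum.mono_neutral_right fin) auto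
  also have "\<dots> = sum ?g {(j, d, e)\<in>quads n. d = e \<and> 0 < j} + sum ?g {(j, d, e)\<in>quads n. d = e \<and> j < 0}"
    by (intro sum_disjoint_union fin) auto
  also have "sum ?g {(j, d, e)\<in>quads n. d = e \<and> j < 0} = sum ?g {(j, d, e)\<in>quads n. d = e \<and> 0 < j}"
    by (rule sum.reindex_bij_witness[of _ "\<lambda>(j, d, e). (- j, d, e)" "\<lambda>(j, d, e). (- j, d, e)"])
      (auto simp: quads_def)
  also have "sum ?g {(j, d, e)\<in>quads n. d = e \<and> 0 < j} + sum ?g {(j, d, e)\<in>quads n. d = e \<and> 0 < j}
      = (\<Sum>(m, d, e)\<in>{(j, d, e)\<in>quads n. d = e \<and> 0 < j}. 8 * psgn m * psgn d * d * m\<^sup>2)"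
    unfolding sum.distrib[symmetric] by (intro sum.cong refl) auto
  also have "\<dots> = (\<Sum>x\<in>{(j, d, e)\<in>shear_quads n. e = d}. shear_weight x)"
    by (rule sum.reindex_bij_witness[of _ "\<lambda>(j, d, e). (d, - j, - j)" "\<lambda>(j, d, e). (- d, j, j)"])
      (auto simp: quads_def shear_quads_def power2_eq_square algebra_simps)
  finally show ?thesis ..
qed

text \<open>Both sums are empty unless \<open>n = N^2\<close>. Then \<open>J = N\<close> and
  \<open>j = - N\<close> are forced, and both become sums of \<open>(M - d) d^2\<close> over
  \<open>d < M\<close>, with \<open>M = 2 N\<close> and \<open>M = N\<close>. Twelve times such a
  sum is \<open>M^2 (M^2 - 1)\<close>; the quartic parts cancel and the quadratic remainder is the
  sum over the square roots of \<open>n\<close>.\<close>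

lemma sum_shear_zero:
  assumes "0 < n"
  shows "2 * (\<Sum>x\<in>{(j, d, e)\<in>shear_quads n. e = 0}. shear_weight x)
     = 4 * (\<Sum>x\<in>{(J, k, m)\<in>diag_quads n. k = m}. diag_weight x) + (\<Sum>j | j\<^sup>2 = n. psgn j * j\<^sup>2)"
proof (cases "\<exists>N. n = (int N)\<^sup>2")
  case True
  then obtain N where N: "n = (int N)\<^sup>2" by blast
  then have "0 < N" using assms by (cases N) auto
  have roots: "{j. j\<^sup>2 = n} = {int N, - int N}"
    using square_roots[of N] by (simp add: N)
  then have root_iff: "j\<^sup>2 = n \<longleftrightarrow> j = int N \<or> j = - int N" for j
    by blast
  have shear: "{(j, d, e)\<in>shear_quads n. e = 0} = {(j, d, e). j = - int N \<and> e = 0 \<and> 0 < d \<and> d < 2 * int N}"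
  proof -
    have "(j, d, e) \<in> shear_quads n \<and> e = 0 \<longleftrightarrow> j = - int N \<and> e = 0 \<and> 0 < d \<and> d < 2 * int N" for j d e
    proof -
      have "(j, d, e) \<in> shear_quads n \<and> e = 0 \<longleftrightarrow> j\<^sup>2 = n \<and> e = 0 \<and> 0 < d \<and> d + 2 * j < 0"
        by (auto simp: shear_quads_def)
      also have "\<dots> \<longleftrightarrow> j = - int N \<and> e = 0 \<and> 0 < d \<and> d < 2 * int N"
        unfolding root_iff by auto
      finally show ?thesis .
    qed
    then show ?thesis by (simp only:)
  qed
  have diag: "{(J, k, m)\<in>diag_quads n. k = m} = {(J, k, m). J = int N \<and> k = m \<and> 0 < k \<and> k < int N}"
  proof -
    have "(J, k, m) \<in> diag_quads n \<and> k = m \<longleftrightarrow> J = int N \<and> k = m \<and> 0 < k \<and> k < int N" for J k m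
    proof -
      have "(J, k, m) \<in> diag_quads n \<and> k = m \<longleftrightarrow> J\<^sup>2 = n \<and> k = m \<and> 0 < k \<and> k < J"
        by (auto simp: diag_quads_def)
      also have "\<dots> \<longleftrightarrow> J = int N \<and> k = m \<and> 0 < k \<and> k < int N"
        unfolding root_iff by auto
      finally show ?thesis .
    qed
    then show ?thesis by (simp only:)
  qed
  have "6 * (\<Sum>d<M. (int d)\<^sup>2) = int M * (int M - 1) * (2 * int M - 1)" for M
    by (induction M) (simp_all add: algebra_simps power2_eq_square)
  then have closed: "12 * (\<Sum>d<M. (int M - int d) * (int d)\<^sup>2) = (int M)\<^sup>2 * ((int M)\<^sup>2 - 1)" for M
  proof (induction M)
    case (Suc M)
    have "(\<Sum>d<Suc M. (int (Suc M) - int d) * (int d)\<^sup>2)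
        = (\<Sum>d<Suc M. (int M - int d) * (int d)\<^sup>2 + (int d)\<^sup>2)"
      by (intro sum.cong refl) (simp add: algebra_simps)
    also have "\<dots> = (\<Sum>d<M. (int M - int d) * (int d)\<^sup>2) + (\<Sum>d<Suc M. (int d)\<^sup>2)"
      by (simp add: sum.distrib)
    finally have "12 * (\<Sum>d<Suc M. (int (Suc M) - int d) * (int d)\<^sup>2)
        = (int M)\<^sup>2 * ((int M)\<^sup>2 - 1) + 2 * (int (Suc M) * (int (Suc M) - 1) * (2 * int (Suc M) - 1))"
      using Suc.IH[OF Suc.prems] Suc.prems[of "Suc M"] by linarith
    then show ?case
      by (simp add: algebra_simps power2_eq_square)
  qed simp
  have "(\<Sum>x\<in>{(j, d, e)\<in>shear_quads n. e = 0}. shear_weight x)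
      = (\<Sum>d\<in>{1..<2 * N}. psgn (int N) * ((int (2 * N) - int d) * (int d)\<^sup>2))"
    unfolding shear
    by (rule sum.reindex_bij_witness[of _ "\<lambda>d. (- int N, int d, 0)" "\<lambda>(j, d, e). nat d"])
      (auto simp: psgn_def algebra_simps)
  also have "\<dots> = psgn (int N) * (\<Sum>d<2 * N. (int (2 * N) - int d) * (int d)\<^sup>2)"
    unfolding sum_distrib_left by (intro sum.mono_neutral_left) auto
  finally have B: "12 * (\<Sum>x\<in>{(j, d, e)\<in>shear_quads n. e = 0}. shear_weight x)
      = psgn (int N) * ((int (2 * N))\<^sup>2 * ((int (2 * N))\<^sup>2 - 1))"
    unfolding closed[symmetric] by simp
  have "(\<Sum>x\<in>{(J, k, m)\<in>diag_quads n. k = m}. diag_weight x)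
      = (\<Sum>m\<in>{1..<N}. 8 * psgn (int N) * ((int N - int m) * (int m)\<^sup>2))"
    unfolding diag
    by (rule sum.reindex_bij_witness[of _ "\<lambda>m. (int N, int m, int m)" "\<lambda>(J, k, m). nat m"])
      (auto simp: psgn_diff)
  also have "\<dots> = 8 * psgn (int N) * (\<Sum>m<N. (int N - int m) * (int m)\<^sup>2)"
    unfolding sum_distrib_left by (intro sum.mono_neutral_left) auto
  finally have D: "12 * (\<Sum>x\<in>{(J, k, m)\<in>diag_quads n. k = m}. diag_weight x)
      = 8 * psgn (int N) * ((int N)\<^sup>2 * ((int N)\<^sup>2 - 1))"
    unfolding closed[symmetric] by simp
  have "(\<Sum>j | j\<^sup>2 = n. psgn j * j\<^sup>2) = 2 * (psgn (int N) * (int N)\<^sup>2)"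
    unfolding roots using \<open>0 < N\<close> by simp
  moreover have "2 * (psgn (int N) * ((int (2 * N))\<^sup>2 * ((int (2 * N))\<^sup>2 - 1)))
      = 4 * (8 * psgn (int N) * ((int N)\<^sup>2 * ((int N)\<^sup>2 - 1))) + 24 * (psgn (int N) * (int N)\<^sup>2)"
    by (simp add: power2_eq_square algebra_simps)
  ultimately show ?thesis
    using B D by linarith
next
  case False
  have no: "j\<^sup>2 \<noteq> n" for j
  proof
    assume "j\<^sup>2 = n"
    then have "n = (int (nat \<bar>j\<bar>))\<^sup>2" by simp
    then show False using False by blast
  qed
  have "\<not> ((j, d, e) \<in> shear_quads n \<and> e = 0)" for j d e
    using no[of j] by (auto simp: shear_quads_def)
  moreover have "\<not> ((J, k, m) \<in> diag_quads n \<and> k = m)" for J k m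
    using no[of J] by (auto simp: diag_quads_def)
  ultimately have empty: "{(j, d, e)\<in>shear_quads n. e = 0} = {}" "{(J, k, m)\<in>diag_quads n. k = m} = {}"
    by simp_all
  show ?thesis
    unfolding empty using no by simp
qed

text \<open>The shear \<open>(j, a, b) \<mapsto> (j - a, a, 2 j + b - a)\<close> preserves \<open>j\<^sup>2 + a b\<close>; comparing the regions
  \<open>quads\<close> and \<open>shear_quads\<close> leaves only terms of the diagonal type.\<close>
lemma quads_identity:
  assumes "0 < n"
  shows "2 * (\<Sum>(j, d, e)\<in>{(j, d, e)\<in>quads n. d < e}. psgn j * psgn e * ((e - d) * ((d + e)\<^sup>2 - 4 * j\<^sup>2)))
     + (\<Sum>j | j\<^sup>2 = n. psgn j * j\<^sup>2)
   = 2 * (\<Sum>(j, d, e)\<in>quads n. psgn j * psgn e * e ^ 3)"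
proof -
  have finq: "finite {(j, d, e)\<in>quads n. P j d e}" for P
    using finite_quads by (rule finite_subset[rotated]) auto
  have fins: "finite {(j, d, e)\<in>shear_quads n. P j d e}" for P
    using finite_shear_quads by (rule finite_subset[rotated]) auto
  let ?s = "\<lambda>P. \<Sum>x\<in>{(j, d, e)\<in>shear_quads n. P d e}. shear_weight x"
  have split: "?s P = ?s Q + ?s R" if "\<And>d e. 0 < d \<Longrightarrow> P d e \<longleftrightarrow> Q d e \<or> R d e"
    "\<And>d e. 0 < d \<Longrightarrow> \<not> (Q d e \<and> R d e)" for P Q R
    using that by (intro sum_disjoint_union fins) (fastforce simp: shear_quads_def)+
  have "?s (\<lambda>_ _. True) = ?s (\<lambda>d e. d < e) + ?s (\<lambda>d e. e = d \<or> 0 < e \<and> e < d \<or> e = 0 \<or> e < 0)"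
    by (intro split) auto
  also have "?s (\<lambda>d e. e = d \<or> 0 < e \<and> e < d \<or> e = 0 \<or> e < 0)
      = ?s (\<lambda>d e. e = d) + ?s (\<lambda>d e. 0 < e \<and> e < d \<or> e = 0 \<or> e < 0)"
    by (intro split) auto
  also have "?s (\<lambda>d e. 0 < e \<and> e < d \<or> e = 0 \<or> e < 0)
      = ?s (\<lambda>d e. 0 < e \<and> e < d) + ?s (\<lambda>d e. e = 0 \<or> e < 0)"
    by (intro split) auto
  also have "?s (\<lambda>d e. e = 0 \<or> e < 0) = ?s (\<lambda>d e. e = 0) + ?s (\<lambda>d e. e < 0)"
    by (intro split) auto
  finally have S: "(\<Sum>x\<in>shear_quads n. shear_weight x) = ?s (\<lambda>d e. d < e) + (?s (\<lambda>d e. e = d)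
      + (?s (\<lambda>d e. 0 < e \<and> e < d) + (?s (\<lambda>d e. e = 0) + ?s (\<lambda>d e. e < 0))))"
    by simp
  have Q: "(\<Sum>x\<in>{(j, d, e)\<in>quads n. d < e}. shear_weight x) = ?s (\<lambda>d e. d < e)
      + (\<Sum>x\<in>{(j, d, e)\<in>quads n. d < e \<and> e \<le> d + 2 * j}. shear_weight x)"
    by (intro sum_disjoint_union finq) (auto simp: quads_def shear_quads_def)
  let ?diag = "\<Sum>(m, d, e)\<in>{(j, d, e)\<in>quads n. d < e}. psgn m * (psgn d + psgn e) * (4 * d * m\<^sup>2)"
  let ?eq = "\<Sum>(m, d, e)\<in>{(j, d, e)\<in>quads n. d = e}. 4 * psgn m * psgn d * d * m\<^sup>2"
  let ?sq = "\<Sum>j | j\<^sup>2 = n. psgn j * j\<^sup>2"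
  \<comment> \<open>The region \<open>d < e\<close> is common to both sets. The others contribute
    the pieces of \<open>sum_diag_split\<close>: \<open>k < m\<close> and
    \<open>\<bar>m\<bar> < k\<close> directly, and \<open>k = m\<close> through
    \<open>e = 0\<close>, at the price of \<open>?sq\<close>.\<close>
  have main: "2 * (\<Sum>x\<in>shear_quads n. shear_weight x)
      = 2 * (\<Sum>x\<in>{(j, d, e)\<in>quads n. d < e}. shear_weight x) + 2 * ?diag + 2 * ?eq + ?sq"
    using S Q sum_diag sum_diag_split sum_shear_below sum_shear_negative sum_shear_diagonal sum_shear_zero[OF assms]
    by linarith
  have "(\<Sum>(j, d, e)\<in>quads n. psgn j * psgn e * (4 * j\<^sup>2 * e)) =
      (\<Sum>(j, d, e)\<in>{(j, d, e)\<in>quads n. d < e}. psgn j * psgn e * (4 * j\<^sup>2 * e))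
      + ((\<Sum>(j, d, e)\<in>{(j, d, e)\<in>quads n. e < d}. psgn j * psgn e * (4 * j\<^sup>2 * e))
      + (\<Sum>(j, d, e)\<in>{(j, d, e)\<in>quads n. d = e}. psgn j * psgn e * (4 * j\<^sup>2 * e)))"
  proof -
    have "(\<Sum>(j, d, e)\<in>{(j, d, e)\<in>quads n. e < d \<or> d = e}. psgn j * psgn e * (4 * j\<^sup>2 * e))
      = (\<Sum>(j, d, e)\<in>{(j, d, e)\<in>quads n. e < d}. psgn j * psgn e * (4 * j\<^sup>2 * e))
      + (\<Sum>(j, d, e)\<in>{(j, d, e)\<in>quads n. d = e}. psgn j * psgn e * (4 * j\<^sup>2 * e))"
      by (intro sum_disjoint_union finq) auto
    moreover have "(\<Sum>(j, d, e)\<in>quads n. psgn j * psgn e * (4 * j\<^sup>2 * e)) =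
      (\<Sum>(j, d, e)\<in>{(j, d, e)\<in>quads n. d < e}. psgn j * psgn e * (4 * j\<^sup>2 * e))
      + (\<Sum>(j, d, e)\<in>{(j, d, e)\<in>quads n. e < d \<or> d = e}. psgn j * psgn e * (4 * j\<^sup>2 * e))"
      by (intro sum_disjoint_union finite_quads) auto
    ultimately show ?thesis by simp
  qed
  also have "(\<Sum>(j, d, e)\<in>{(j, d, e)\<in>quads n. e < d}. psgn j * psgn e * (4 * j\<^sup>2 * e))
      = (\<Sum>(j, d, e)\<in>{(j, d, e)\<in>quads n. d < e}. psgn j * psgn d * (4 * j\<^sup>2 * d))"
    by (rule sum.reindex_bij_witness[of _ "\<lambda>(j, d, e). (j, e, d)" "\<lambda>(j, d, e). (j, e, d)"])
      (auto simp: quads_def mult.commute)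
  also have "(\<Sum>(j, d, e)\<in>{(j, d, e)\<in>quads n. d = e}. psgn j * psgn e * (4 * j\<^sup>2 * e)) = ?eq"
    by (intro sum.cong refl) auto
  finally have J: "(\<Sum>(j, d, e)\<in>quads n. psgn j * psgn e * (4 * j\<^sup>2 * e)) =
      (\<Sum>(j, d, e)\<in>{(j, d, e)\<in>quads n. d < e}. psgn j * psgn e * (4 * j\<^sup>2 * e))
      + ((\<Sum>(j, d, e)\<in>{(j, d, e)\<in>quads n. d < e}. psgn j * psgn d * (4 * j\<^sup>2 * d)) + ?eq)" .
  have U: "(\<Sum>x\<in>shear_quads n. shear_weight x) = (\<Sum>(j, d, e)\<in>quads n. psgn j * psgn e * e ^ 3)
      + (\<Sum>(j, d, e)\<in>quads n. psgn j * psgn e * (4 * j\<^sup>2 * e))"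
    unfolding sum_shear sum.distrib[symmetric] by (intro sum.cong refl) (auto simp: algebra_simps)
  \<comment> \<open>The \<open>psgn d\<close> half of \<open>?diag\<close> cancels against the last
    sum; its \<open>psgn e\<close> half supplies the term \<open>4 j^2 d\<close> in the expansion of
    \<open>(e - d) * (- 4 j^2)\<close>.\<close>
  have "(\<Sum>(j, d, e)\<in>{(j, d, e)\<in>quads n. d < e}. psgn j * psgn e * ((e - d) * ((d + e)\<^sup>2 - 4 * j\<^sup>2)))
      = (\<Sum>(j, d, e)\<in>{(j, d, e)\<in>quads n. d < e}. psgn j * psgn e * (e - d) * (d + e)\<^sup>2)
      + ?diag - (\<Sum>(j, d, e)\<in>{(j, d, e)\<in>quads n. d < e}. psgn j * psgn e * (4 * j\<^sup>2 * e))
      - (\<Sum>(j, d, e)\<in>{(j, d, e)\<in>quads n. d < e}. psgn j * psgn d * (4 * j\<^sup>2 * d))"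
    unfolding sum.distrib[symmetric] sum_subtractf[symmetric]
    by (intro sum.cong refl) (auto simp: algebra_simps)
  then show ?thesis
    using main U J sum_quads_less by linarith
qed

end

section \<open>Convolution with theta and the bracket\<close>

lemma finite_square_le: "finite {j::int. j\<^sup>2 \<le> int n}"
proof (rule finite_subset)
  show "{j::int. j\<^sup>2 \<le> int n} \<subseteq> {- int n..int n}"
  proof clarify
    fix j :: int assume "j\<^sup>2 \<le> int n"
    moreover have "\<bar>j\<bar> * 1 \<le> \<bar>j\<bar> * \<bar>j\<bar>"
      using mult_left_mono[of 1 "\<bar>j\<bar>" "\<bar>j\<bar>"] by (cases "j = 0") simp_all
    ultimately have "\<bar>j\<bar> \<le> int n"
      by (simp add: power2_eq_square)
    then show "j \<in> {- int n..int n}" by auto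
  qed
qed simp

lemma theta_convolution:
  "(\<Sum>i=0..n. fps_nth theta i * h i) = (\<Sum>j | j\<^sup>2 \<le> int n. psgn j * h (nat (j\<^sup>2)))"
proof -
  have "(\<Sum>i=0..n. fps_nth theta i * h i)
      = (\<Sum>i\<in>{0..n}. \<Sum>j\<in>{j\<in>{j. j\<^sup>2 \<le> int n}. nat (j\<^sup>2) = i}. psgn j * h (nat (j\<^sup>2)))"
  proof (intro sum.cong refl)
    fix i assume "i \<in> {0..n}"
    then have "{j\<in>{j. j\<^sup>2 \<le> int n}. nat (j\<^sup>2) = i} = {j. j\<^sup>2 = int i}"
      by auto
    then show "fps_nth theta i * h i = (\<Sum>j\<in>{j\<in>{j. j\<^sup>2 \<le> int n}. nat (j\<^sup>2) = i}. psgn j * h (nat (j\<^sup>2)))"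
      by (simp add: theta_def sum_distrib_right)
  qed
  also have "\<dots> = (\<Sum>j | j\<^sup>2 \<le> int n. psgn j * h (nat (j\<^sup>2)))"
    by (intro sum.group finite_square_le) auto
  finally show ?thesis .
qed

lemma sum_over_quads:
  "(\<Sum>j | j\<^sup>2 \<le> int n. \<Sum>(d, e)\<in>{(d, e)\<in>factor_pairs (int (n - nat (j\<^sup>2))). P d e}. g j d e)
     = (\<Sum>(j, d, e)\<in>{(j, d, e)\<in>quads (int n). P d e}. g j d e :: int)"
proof -
  have fin: "finite {(d, e)\<in>factor_pairs k. P d e}" for k
    using finite_factor_pairs by (rule finite_subset[rotated]) auto
  have "(SIGMA j:{j. j\<^sup>2 \<le> int n}. {(d, e)\<in>factor_pairs (int (n - nat (j\<^sup>2))). P d e})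
      = {(j, d, e)\<in>quads (int n). P d e}"
    (is "?S = ?T")
  proof -
    have "x \<in> ?S \<longleftrightarrow> x \<in> ?T" for x
    proof -
      obtain j d e where x: "x = (j, d, e)" by (cases x)
      have "x \<in> ?S" if "x \<in> ?T"
      proof -
        have de: "0 < d" "0 < e" "j\<^sup>2 + d * e = int n" "P d e"
          using that by (auto simp: quads_def x)
        moreover have "0 < d * e" using de by simp
        ultimately have "j\<^sup>2 \<le> int n" by linarith
        moreover from this have "int (n - nat (j\<^sup>2)) = d * e"
          using de(3) by (simp add: of_nat_diff nat_le_iff)
        ultimately show ?thesis
          using de by (auto simp: factor_pairs_def x)
      qed
      moreover have "x \<in> ?T" if "x \<in> ?S"
        using that by (auto simp: x quads_def factor_pairs_def of_nat_diff nat_le_iff)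
      ultimately show ?thesis by blast
    qed
    then show ?thesis by (intro subset_antisym subsetI) simp_all
  qed
  then show ?thesis
    by (subst sum.Sigma) (auto simp: finite_square_le fin)
qed

definition bracket_series :: "int fps" where
  "bracket_series = Abs_fps (\<lambda>n. - 2 * (\<Sum>(d, e)\<in>factor_pairs (int n). psgn e * e ^ 3)
     + 2 * (\<Sum>(d, e)\<in>{(d, e)\<in>factor_pairs (int n). d < e}. psgn e * (e - d) ^ 3))"

definition qderiv :: "int fps \<Rightarrow> int fps" where
  "qderiv f = fps_X * fps_deriv f"

lemma qderiv_nth: "fps_nth (qderiv f) n = int n * fps_nth f n"
  by (cases n) (simp_all add: qderiv_def)

text \<open>In the bracket the product of the coefficients with indices \<open>i\<close> and
  \<open>n - i\<close> is weighted by \<open>(n - i) - i\<close>, which is \<open>d e - j^2\<close>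
  for \<open>i = j^2\<close> and \<open>n - i = d e\<close>.\<close>

lemma bracket_identity: "theta * qderiv rank_appell - rank_appell * qderiv theta = theta * bracket_series"
proof (rule fps_ext)
  fix n
  show "fps_nth (theta * qderiv rank_appell - rank_appell * qderiv theta) n = fps_nth (theta * bracket_series) n"
  proof (cases "n = 0")
    case True
    then show ?thesis by (simp add: fps_mult_nth bracket_series_def qderiv_nth)
  next
    case False
    let ?m = "\<lambda>j::int. n - nat (j\<^sup>2)"
    let ?A = "\<Sum>(j, d, e)\<in>{(j, d, e)\<in>quads (int n). d < e}. psgn j * (psgn e * (e - d) * (d * e - j\<^sup>2))"
    have "fps_nth (theta * qderiv rank_appell - rank_appell * qderiv theta) n
        = (\<Sum>i=0..n. fps_nth theta i * ((int (n - i) - int i) * fps_nth rank_appell (n - i)))"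
      unfolding mult.commute[of rank_appell] fps_sub_nth fps_mult_nth qderiv_nth sum_subtractf[symmetric]
      by (intro sum.cong refl) (simp add: algebra_simps)
    also have "\<dots> = (\<Sum>j | j\<^sup>2 \<le> int n. psgn j * ((int (?m j) - j\<^sup>2) * fps_nth rank_appell (?m j)))"
      by (simp add: theta_convolution)
    also have "\<dots> = (\<Sum>j | j\<^sup>2 \<le> int n. - 8 * (\<Sum>(d, e)\<in>{(d, e)\<in>factor_pairs (int (?m j)). d < e}.
        psgn j * (psgn e * (e - d) * (d * e - j\<^sup>2))) - (if j\<^sup>2 = int n then psgn j * j\<^sup>2 else 0))"
    \<comment> \<open>The constant term 1 of \<open>rank_appell\<close> is not a divisor sum; it is
      met when \<open>j^2 = n\<close> and gives the separate term
      \<open>- psgn j * j^2\<close>.\<close>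
    proof (intro sum.cong refl)
      fix j :: int assume "j \<in> {j. j\<^sup>2 \<le> int n}"
      then have j: "j\<^sup>2 \<le> int n" by simp
      show "psgn j * ((int (?m j) - j\<^sup>2) * fps_nth rank_appell (?m j))
        = - 8 * (\<Sum>(d, e)\<in>{(d, e)\<in>factor_pairs (int (?m j)). d < e}.
        psgn j * (psgn e * (e - d) * (d * e - j\<^sup>2))) - (if j\<^sup>2 = int n then psgn j * j\<^sup>2 else 0)"
      proof (cases "j\<^sup>2 = int n")
        case True
        then show ?thesis by (simp add: rank_appell_def)
      next
        case neq: False
        then have "nat (j\<^sup>2) < n" using j by (simp add: nat_less_iff)
        then have pos: "?m j \<noteq> 0" by simp
        have "(\<Sum>(d, e)\<in>{(d, e)\<in>factor_pairs (int (?m j)). d < e}. psgn j * (psgn e * (e - d) * (d * e - j\<^sup>2)))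
          = (\<Sum>(d, e)\<in>{(d, e)\<in>factor_pairs (int (?m j)). d < e}.
              (psgn j * (int (?m j) - j\<^sup>2)) * (psgn e * (e - d)))"
          by (intro sum.cong refl) (auto simp: factor_pairs_def)
        also have "\<dots> = (psgn j * (int (?m j) - j\<^sup>2)) *
            (\<Sum>(d, e)\<in>{(d, e)\<in>factor_pairs (int (?m j)). d < e}. psgn e * (e - d))"
          by (simp add: sum_distrib_left case_prod_unfold)
        finally show ?thesis
          using neq pos by (simp add: rank_appell_def)
      qed
    qed
    also have "\<dots> = - 8 * ?A - (\<Sum>j | j\<^sup>2 \<le> int n. if j\<^sup>2 = int n then psgn j * j\<^sup>2 else 0)"
      unfolding sum_over_quads[symmetric] by (simp only: sum_subtractf sum_distrib_left)
    also have "(\<Sum>j | j\<^sup>2 \<le> int n. if j\<^sup>2 = int n then psgn j * j\<^sup>2 else 0) = (\<Sum>j | j\<^sup>2 = int n. psgn j * j\<^sup>2)"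
      by (intro sum.mono_neutral_cong_right finite_square_le) auto
    finally have L: "fps_nth (theta * qderiv rank_appell - rank_appell * qderiv theta) n
        = - 8 * ?A - (\<Sum>j | j\<^sup>2 = int n. psgn j * j\<^sup>2)" .
    let ?B = "\<Sum>(j, d, e)\<in>quads (int n). psgn j * (psgn e * e ^ 3)"
    let ?C = "\<Sum>(j, d, e)\<in>{(j, d, e)\<in>quads (int n). d < e}. psgn j * (psgn e * (e - d) ^ 3)"
    have B: "?B = (\<Sum>j | j\<^sup>2 \<le> int n. \<Sum>(d, e)\<in>factor_pairs (int (?m j)). psgn j * (psgn e * e ^ 3))"
      using sum_over_quads[where n = n and g = "\<lambda>j d e. psgn j * (psgn e * e ^ 3)" and P = "\<lambda>_ _. True"] by simp
    have "fps_nth (theta * bracket_series) n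
        = (\<Sum>j | j\<^sup>2 \<le> int n. psgn j * fps_nth bracket_series (?m j))"
      by (simp add: fps_mult_nth theta_convolution)
    also have "\<dots> = - 2 * ?B + 2 * ?C"
      unfolding B sum_over_quads[symmetric]
      by (simp add: bracket_series_def sum_distrib_left case_prod_unfold sum.distrib algebra_simps)
    finally have R: "fps_nth (theta * bracket_series) n = - 2 * ?B + 2 * ?C" .
    have "0 < int n" using False by simp
    note quads_identity[OF this]
    \<comment> \<open>This is \<open>(d + e)^2 - 4 j^2 = (e - d)^2 + 4 (d e - j^2)\<close>: the
      weight of \<open>quads_identity\<close> is the cube of \<open>e - d\<close> plus four times
      the bracket weight.\<close>
    moreover have "(\<Sum>(j, d, e)\<in>{(j, d, e)\<in>quads (int n). d < e}. psgn j * psgn e * ((e - d) * ((d + e)\<^sup>2 - 4 * j\<^sup>2)))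
        = ?C + 4 * ?A"
      unfolding sum_distrib_left sum.distrib[symmetric]
      by (intro sum.cong refl) (auto simp: power2_eq_square power3_eq_cube algebra_simps)
    moreover have "(\<Sum>(j, d, e)\<in>quads (int n). psgn j * psgn e * e ^ 3) = ?B"
      by (intro sum.cong refl) (auto simp: mult.assoc)
    ultimately show ?thesis
      unfolding L R by linarith
  qed
qed

section \<open>Reduction modulo 3\<close>

lemma cube_cong_3: "[a ^ 3 = a] (mod 3)" for a :: int
proof -
  have "a mod 3 = 0 \<or> a mod 3 = 1 \<or> a mod 3 = 2"
    by presburger
  then have "(a mod 3) ^ 3 mod 3 = a mod 3"
    by auto
  then show ?thesis
    by (simp add: cong_def power_mod)
qed

text \<open>The inverse of 2 modulo 3 is -1, which settles even \<open>a\<close>; for odd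
  \<open>a\<close> both sides are equal.\<close>

lemma halve_cong_3: "[halve a = - psgn a * a] (mod 3)"
  by (auto simp: halve_def psgn_def cong_iff_dvd_diff elim!: evenE)

text \<open>Once cubes and halves are reduced, the signs match because
  \<open>psgn d * psgn (e - d) = psgn e\<close>, and the coefficients 2 and -4 of the sum over
  \<open>d < e\<close> differ by a multiple of 3.\<close>

lemma bracket_cong_spt: "[fps_nth bracket_series n = fps_nth spt_appell n] (mod 3)"
proof -
  let ?P = "factor_pairs (int n)"
  let ?L = "{(d, e)\<in>?P. d < e}"
  have "[fps_nth bracket_series n = - 2 * (\<Sum>(d, e)\<in>?P. psgn e * e) + 2 * (\<Sum>(d, e)\<in>?L. psgn e * (e - d))] (mod 3)"
    unfolding bracket_series_def fps_nth_Abs_fps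
    by (intro cong_add cong_mult cong_refl cong_sum) (auto intro!: cong_mult cong_refl cube_cong_3)
  also have "[- 2 * (\<Sum>(d, e)\<in>?P. psgn e * e) + 2 * (\<Sum>(d, e)\<in>?L. psgn e * (e - d))
      = 2 * (\<Sum>(d, e)\<in>?P. - psgn e * e) + 4 * (\<Sum>(d, e)\<in>?L. psgn d * (- psgn (e - d) * (e - d)))] (mod 3)"
  proof -
    have "(\<Sum>(d, e)\<in>?L. psgn d * (- psgn (e - d) * (e - d))) = - (\<Sum>(d, e)\<in>?L. psgn e * (e - d))"
      unfolding sum_negf[symmetric] by (intro sum.cong refl) (auto simp: psgn_diff)
    moreover have "(\<Sum>(d, e)\<in>?P. - psgn e * e) = - (\<Sum>(d, e)\<in>?P. psgn e * e)"
      unfolding sum_negf[symmetric] by (intro sum.cong refl) auto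
    ultimately show ?thesis
      by (simp only: cong_iff_dvd_diff) presburger
  qed
  also have "[2 * (\<Sum>(d, e)\<in>?P. - psgn e * e) + 4 * (\<Sum>(d, e)\<in>?L. psgn d * (- psgn (e - d) * (e - d)))
      = fps_nth spt_appell n] (mod 3)"
    unfolding spt_appell_def fps_nth_Abs_fps
    by (intro cong_add cong_mult cong_refl cong_sum)
      (simp only: case_prod_unfold, intro cong_mult cong_refl cong_sym[OF halve_cong_3])+
  finally show ?thesis .
qed

text \<open>Turns a coefficientwise congruence into divisibility in the ring of series, which is
  preserved by multiplication with any series.\<close>

lemma fps_dvd_const_iff: "fps_const c dvd f \<longleftrightarrow> (\<forall>n. c dvd fps_nth f n)" for f :: "'a::comm_ring_1 fps"
proof
  assume "\<forall>n. c dvd fps_nth f n"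
  then obtain g where "\<And>n. fps_nth f n = c * g n"
    unfolding dvd_def by metis
  then have "f = fps_const c * Abs_fps g"
    by (simp add: fps_eq_iff)
  then show "fps_const c dvd f" by simp
qed (auto simp: fps_mult_left_const_nth elim!: dvdE)

lemma rank_spt_cong: "[int n * fps_nth rank_series n = fps_nth spt_series n] (mod 3)"
proof -
  \<comment> \<open>The constant term of \<open>theta\<close> is 1, so its inverse has integer
    coefficients and divisibility by 3 survives division by \<open>theta\<close>.\<close>
  define psi where "psi = fps_right_inverse theta 1"
  have "fps_nth theta 0 = 1"
    by (simp add: theta_def psgn_def)
  then have psi: "theta * psi = 1"
    unfolding psi_def by (intro fps_right_inverse) simp
  then have "theta \<noteq> 0" by auto
  have "fps_deriv rank_appell = fps_deriv theta * rank_series + theta * fps_deriv rank_series"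
    unfolding theta_rank_series[symmetric] by (simp add: add.commute)
  then have "theta * qderiv rank_appell - rank_appell * qderiv theta
      = theta * (theta * qderiv rank_series)"
    unfolding theta_rank_series[symmetric] qderiv_def by (simp add: algebra_simps)
  then have "theta * qderiv rank_series = bracket_series"
    unfolding bracket_identity using \<open>theta \<noteq> 0\<close> by simp
  then have "theta * (qderiv rank_series - spt_series) = bracket_series - spt_appell"
    by (simp add: right_diff_distrib theta_spt_series)
  then have "qderiv rank_series - spt_series = psi * (bracket_series - spt_appell)"
    using cancel_inverse[OF psi] by metis
  moreover have "fps_const 3 dvd bracket_series - spt_appell"
    unfolding fps_dvd_const_iff using bracket_cong_spt by (simp add: cong_iff_dvd_diff)
  ultimately have "fps_const 3 dvd qderiv rank_series - spt_series"
    by simp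
  then have "3 dvd fps_nth (qderiv rank_series - spt_series) n"
    unfolding fps_dvd_const_iff by blast
  then show ?thesis
    by (simp add: cong_iff_dvd_diff qderiv_nth)
qed

text \<open>Euler's criterion for the prime 3, where the exponent \<open>(3 - 1) / 2\<close> is
  1.\<close>

lemma Legendre_3: "[Legendre a 3 = a] (mod 3)"
proof -
  have "a mod 3 = 0 \<or> a mod 3 = 1 \<or> a mod 3 = 2" by presburger
  then consider "[a = 0] (mod 3)" | "[a = 1] (mod 3)" | "[a = 2] (mod 3)"
    by (auto simp: cong_def)
  then show ?thesis
  proof cases
    case 1
    then show ?thesis by (simp add: Legendre_def cong_sym)
  next
    case 2
    then have "QuadRes 3 a" unfolding QuadRes_def by (metis cong_sym one_power2)
    moreover have "\<not> [a = 0] (mod 3)" using 2 by (auto simp: cong_def)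
    ultimately show ?thesis using 2 by (simp add: Legendre_def cong_sym)
  next
    case 3
    have "\<not> [y\<^sup>2 = a] (mod 3)" for y
    proof
      assume "[y\<^sup>2 = a] (mod 3)"
      then have "(y mod 3)\<^sup>2 mod 3 = 2"
        using 3 by (simp add: cong_def power_mod)
      moreover have "y mod 3 = 0 \<or> y mod 3 = 1 \<or> y mod 3 = 2" by presburger
      ultimately show False by auto
    qed
    then have "\<not> QuadRes 3 a" by (simp add: QuadRes_def)
    moreover have "\<not> [a = 0] (mod 3)" using 3 by (auto simp: cong_def)
    ultimately have "Legendre a 3 = -1" by (simp add: Legendre_def)
    moreover have "[-1 = a] (mod 3)"
      using 3 by (simp add: cong_def)
    ultimately show ?thesis by simp
  qed
qed

theorem theorem1p4:
  fixes n :: nat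
  assumes "n \<ge> 1"
  shows "[spt1bar n = Legendre (int n) 3 * alphabar n] (mod 3)"
proof -
  have "[int n * alphabar n = spt1bar n] (mod 3)"
    using rank_spt_cong[of n] assms by (simp add: rank_series_def spt_series_def)
  moreover have "[Legendre (int n) 3 * alphabar n = int n * alphabar n] (mod 3)"
    by (intro cong_mult cong_refl Legendre_3)
  ultimately show ?thesis
    using cong_sym cong_trans by blast
qed

end
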